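(* Let $k,\ell,n\ge2$ be integers, $\ell'=\gcd(\ell,n)\ge2$ and $p=n/\ell'$. If $p\in[k,\infty)$, then, with $\mathcal D=\mathcal D_n(k,\ell)$ and inside the fraction field of $\mathbb C[\mathcal D]$, $$\mathcal L_n(k,\ell)\subseteq\mathbb C[\mathcal D]\subseteq\mathbb C[\Delta(\mathcal C_n(k,\ell))^{\pm1}].$$
   Context: **Distinguished component.** $\mathrm{Gr}(k,n)$ (row spans of $k\times n$ complex matrices) has Plücker coordinates $\Delta_I$, $I\in\binom{[n]}k$. The cyclic shift $\rho$ sends the row span of $(v_1,\dots,v_n)$ (columns) to that of $(v_2,\dots,v_n,(-1)^{k-1}v_1)$. The distinguished component $\mathcal D=\mathcal D_n(k,\ell)$ is the connected component of the fixed locus $\mathrm{Gr}(k,n)^{\rho^\ell}$ containing all $\rho^\ell$-fixed points with nonnegative real Plücker coordinates (up to rescaling); it is irreducible. $\mathbb C[\mathcal D]$ is its homogeneous coordinate ring in the Plücker embedding, generated by the restrictions of the $\Delta_I$. **Initial cluster.** Let $N=(k-1)(\ell'-1)$. For $1\le m\le N$ write $m=(j-1)(\ell'-1)+i$ with $j\in[k-1]$, $i\in[\ell'-1]$ and put $$I_m=\{m,m+1,\dots,m+j-1\}\cup\{1+j\ell',1+(j+1)\ell',\dots,1+(k-1)\ell'\}.$$ For $N+1\le m\le N+\ell'$ put $I_m=\{m,m+1,\dots,m+k-1\}$. Set $\mathcal C_n(k,\ell)=\{I_m:1\le m\le N+\ell'\}$ and $x_m=\Delta_{I_m}|_{\mathcal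 D}$. The variables $x_1,\dots,x_N$ are mutable and $x_{N+1},\dots,x_{N+\ell'}$ are frozen. $\mathbb C[\Delta(\mathcal C_n(k,\ell))^{\pm1}]$ is the algebra generated by all $x_m^{\pm1}$. **Initial seed and lower bound.** The extended quiver has the arrows $x_{i+1}\to x_i\to x_{i+\ell'}\to x_{i+1}$ for each $i=1,\dots,N$ (arrows counted with multiplicity; arrows between frozen variables are ignored). Let $\eta_s=\begin{bmatrix}k\\ s\end{bmatrix}_q$ at $q=e^{2\pi\sqrt{-1}/p}$, where $\begin{bmatrix}k\\ s\end{bmatrix}_q=\frac{[k]!_q}{[s]!_q[k-s]!_q}$, $[m]_q=\frac{q^{m/2}-q^{-m/2}}{q^{1/2}-q^{-1/2}}$; explicitly $\eta_0=\eta_k=1$ and $\eta_s=\prod_{j=1}^s\frac{\sin((k+1-j)\pi/p)}{\sin(j\pi/p)}$ for $0<s<k$. The variables neighbouring the initial seed are the elements $x_1',\dots,x_N'$ of the fraction field of $\mathbb C[\mathcal D]$ defined by $$x_1x_1'=\sum_{s=0}^k\eta_s\,x_2^{s}\,x_{\ell'+1}^{k-s},\qquad x_ix_i'=\prod_{y\to x_i}y+\prod_{x_i\to y}y\quad(2\le i\le N),$$ the products being over arrows of the quiver. The lower bound algebra $\mathcal L_n(k,\ell)$ is the $\mathbb C$-subalgebra generated by $x_1,\dots,x_{N+\ell'},x_1',\dots,x_N'$. *)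

theory Defs
  imports
    "HOL-Analysis.Function_Topology"
    "HOL-Library.Nonpos_Ints"
    "HOL-Algebra.Generated_Rings"
    "Jordan_Normal_Form.DL_Rank"
    "Jordan_Normal_Form.DL_Submatrix"
    "Jordan_Normal_Form.Determinant"
begin

hide_const (open) Multiset.mult

section \<open>Fraction field of an integral domain\<close>

definition fraction_rel :: "('a, 'b) ring_scheme \<Rightarrow> (('a \<times> 'a) \<times> ('a \<times> 'a)) set" where
  "fraction_rel R = {((a, b), (c, d)). a \<in> carrier R \<and> b \<in> carrier R - {\<zero>\<^bsub>R\<^esub>}
      \<and> c \<in> carrier R \<and> d \<in> carrier R - {\<zero>\<^bsub>R\<^esub>} \<and> a \<otimes>\<^bsub>R\<^esub> d = c \<otimes>\<^bsub>R\<^esub> b}"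

definition fraction :: "('a, 'b) ring_scheme \<Rightarrow> 'a \<Rightarrow> 'a \<Rightarrow> ('a \<times> 'a) set" where
  "fraction R a b = fraction_rel R `` {(a, b)}"

definition fraction_field :: "('a, 'b) ring_scheme \<Rightarrow> ('a \<times> 'a) set ring" where
  "fraction_field R =
    \<lparr>carrier = (carrier R \<times> (carrier R - {\<zero>\<^bsub>R\<^esub>})) // fraction_rel R,
     mult = (\<lambda>X Y. \<Union>(a, b)\<in>X. \<Union>(c, d)\<in>Y. fraction R (a \<otimes>\<^bsub>R\<^esub> c) (b \<otimes>\<^bsub>R\<^esub> d)),
     one = fraction R \<one>\<^bsub>R\<^esub> \<one>\<^bsub>R\<^esub>,
     zero = fraction R \<zero>\<^bsub>R\<^esub> \<one>\<^bsub>R\<^esub>,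
     add = (\<lambda>X Y. \<Union>(a, b)\<in>X. \<Union>(c, d)\<in>Y.
              fraction R (a \<otimes>\<^bsub>R\<^esub> d \<oplus>\<^bsub>R\<^esub> c \<otimes>\<^bsub>R\<^esub> b) (b \<otimes>\<^bsub>R\<^esub> d))\<rparr>"

definition fraction_embed :: "('a, 'b) ring_scheme \<Rightarrow> 'a \<Rightarrow> ('a \<times> 'a) set" where
  "fraction_embed R a = fraction R a \<one>\<^bsub>R\<^esub>"

context domain
begin

lemma equiv_fraction_rel:
  "equiv (carrier R \<times> (carrier R - {\<zero>})) (fraction_rel R)"
proof (rule equivI)
  show "fraction_rel R \<subseteq> (carrier R \<times> (carrier R - {\<zero>})) \<times> (carrier R \<times> (carrier R - {\<zero>}))"
    by (auto simp: fraction_rel_def)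
  show "refl_on (carrier R \<times> (carrier R - {\<zero>})) (fraction_rel R)"
    by (auto simp: refl_on_def fraction_rel_def)
  show "sym (fraction_rel R)"
    by (auto simp: sym_def fraction_rel_def)
  show "trans (fraction_rel R)"
  proof (rule transI)
    fix x y z assume xy: "(x, y) \<in> fraction_rel R" and yz: "(y, z) \<in> fraction_rel R"
    obtain a b c d e f where [simp]: "x = (a, b)" "y = (c, d)" "z = (e, f)"
      by (metis prod.exhaust)
    have C: "a \<in> carrier R" "b \<in> carrier R" "c \<in> carrier R" "d \<in> carrier R"
        "e \<in> carrier R" "f \<in> carrier R" "b \<noteq> \<zero>" "d \<noteq> \<zero>" "f \<noteq> \<zero>"
      and 1: "a \<otimes> d = c \<otimes> b" and 2: "c \<otimes> f = e \<otimes> d"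
      using xy yz unfolding fraction_rel_def by simp_all
    have "d \<otimes> (a \<otimes> f) = (a \<otimes> d) \<otimes> f" using C by (simp add: m_ac)
    also have "\<dots> = (c \<otimes> f) \<otimes> b" using C by (simp only: 1) (simp add: m_ac)
    also have "\<dots> = d \<otimes> (e \<otimes> b)" using C by (simp only: 2) (simp add: m_ac)
    finally have "a \<otimes> f = e \<otimes> b" using C m_lcancel by auto
    then show "(x, z) \<in> fraction_rel R" using C by (auto simp: fraction_rel_def)
  qed
qed

lemma fraction_eq_iff:
  assumes "a \<in> carrier R" "b \<in> carrier R" "b \<noteq> \<zero>" "c \<in> carrier R" "d \<in> carrier R" "d \<noteq> \<zero>"
  shows "fraction R a b = fraction R c d \<longleftrightarrow> a \<otimes> d = c \<otimes> b"
  unfolding fraction_def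
  using eq_equiv_class_iff[OF equiv_fraction_rel, of "(a, b)" "(c, d)"] assms
  by (auto simp: fraction_rel_def)

lemma fraction_in_carrier [simp]:
  assumes "a \<in> carrier R" "b \<in> carrier R" "b \<noteq> \<zero>"
  shows "fraction R a b \<in> carrier (fraction_field R)"
  unfolding fraction_field_def fraction_def using assms by (auto intro!: quotientI)

lemma fraction_cases:
  assumes "X \<in> carrier (fraction_field R)"
  obtains a b where "a \<in> carrier R" "b \<in> carrier R" "b \<noteq> \<zero>" "X = fraction R a b"
  using assms unfolding fraction_field_def fraction_def by (auto elim!: quotientE)

lemma fraction_UN:
  assumes "a \<in> carrier R" "b \<in> carrier R" "b \<noteq> \<zero>" "c \<in> carrier R" "d \<in> carrier R" "d \<noteq> \<zero>"
    and "\<And>a' b' c' d'. \<lbrakk>((a, b), (a', b')) \<in> fraction_rel R; ((c, d), (c', d')) \<in> fraction_rel R\<rbrakk>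
           \<Longrightarrow> F a' b' c' d' = Z"
  shows "(\<Union>(a', b')\<in>fraction R a b. \<Union>(c', d')\<in>fraction R c d. F a' b' c' d') = Z"
proof -
  have "(a, b) \<in> fraction R a b" "(c, d) \<in> fraction R c d"
    using assms by (auto simp: fraction_def fraction_rel_def)
  moreover have "F a' b' c' d' = Z" if "(a', b') \<in> fraction R a b" "(c', d') \<in> fraction R c d"
    for a' b' c' d' using that assms(7) by (auto simp: fraction_def)
  ultimately show ?thesis by fastforce
qed

lemma mult_fraction [simp]:
  assumes "a \<in> carrier R" "b \<in> carrier R" "b \<noteq> \<zero>" "c \<in> carrier R" "d \<in> carrier R" "d \<noteq> \<zero>"
  shows "fraction R a b \<otimes>\<^bsub>fraction_field R\<^esub> fraction R c d = fraction R (a \<otimes> c) (b \<otimes> d)"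
proof -
  have *: "fraction R (a' \<otimes> c') (b' \<otimes> d') = fraction R (a \<otimes> c) (b \<otimes> d)"
    if "((a, b), (a', b')) \<in> fraction_rel R" "((c, d), (c', d')) \<in> fraction_rel R" for a' b' c' d'
  proof -
    have C: "a' \<in> carrier R" "b' \<in> carrier R" "b' \<noteq> \<zero>" "c' \<in> carrier R" "d' \<in> carrier R" "d' \<noteq> \<zero>"
      and e: "a \<otimes> b' = a' \<otimes> b" "c \<otimes> d' = c' \<otimes> d"
      using that by (auto simp: fraction_rel_def)
    have "(a' \<otimes> c') \<otimes> (b \<otimes> d) = (a' \<otimes> b) \<otimes> (c' \<otimes> d)" using C assms by (simp add: m_ac)
    also have "\<dots> = (a \<otimes> b') \<otimes> (c \<otimes> d')" by (simp only: e)
    also have "\<dots> = (a \<otimes> c) \<otimes> (b' \<otimes> d')" using C assms by (simp add: m_ac)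
    finally show ?thesis using C assms by (subst fraction_eq_iff) (auto dest: integral)
  qed
  show ?thesis unfolding fraction_field_def
    by (simp only: ring_record_simps) (rule fraction_UN[OF assms], rule *)
qed

lemma add_fraction [simp]:
  assumes "a \<in> carrier R" "b \<in> carrier R" "b \<noteq> \<zero>" "c \<in> carrier R" "d \<in> carrier R" "d \<noteq> \<zero>"
  shows "fraction R a b \<oplus>\<^bsub>fraction_field R\<^esub> fraction R c d
           = fraction R (a \<otimes> d \<oplus> c \<otimes> b) (b \<otimes> d)"
proof -
  have *: "fraction R (a' \<otimes> d' \<oplus> c' \<otimes> b') (b' \<otimes> d') = fraction R (a \<otimes> d \<oplus> c \<otimes> b) (b \<otimes> d)"
    if "((a, b), (a', b')) \<in> fraction_rel R" "((c, d), (c', d')) \<in> fraction_rel R" for a' b' c' d'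
  proof -
    have C: "a' \<in> carrier R" "b' \<in> carrier R" "b' \<noteq> \<zero>" "c' \<in> carrier R" "d' \<in> carrier R" "d' \<noteq> \<zero>"
      and e: "a \<otimes> b' = a' \<otimes> b" "c \<otimes> d' = c' \<otimes> d"
      using that by (auto simp: fraction_rel_def)
    have "(a' \<otimes> d' \<oplus> c' \<otimes> b') \<otimes> (b \<otimes> d) = (a' \<otimes> b) \<otimes> (d \<otimes> d') \<oplus> (c' \<otimes> d) \<otimes> (b \<otimes> b')"
      using C assms by (simp add: l_distr r_distr m_ac)
    also have "\<dots> = (a \<otimes> b') \<otimes> (d \<otimes> d') \<oplus> (c \<otimes> d') \<otimes> (b \<otimes> b')" by (simp only: e)
    also have "\<dots> = (a \<otimes> d \<oplus> c \<otimes> b) \<otimes> (b' \<otimes> d')" using C assms by (simp add: l_distr r_distr m_ac)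
    finally show ?thesis using C assms by (subst fraction_eq_iff) (auto dest: integral)
  qed
  show ?thesis unfolding fraction_field_def
    by (simp only: ring_record_simps) (rule fraction_UN[OF assms], rule *)
qed

lemma one_fraction_field: "\<one>\<^bsub>fraction_field R\<^esub> = fraction R \<one> \<one>"
  and zero_fraction_field: "\<zero>\<^bsub>fraction_field R\<^esub> = fraction R \<zero> \<one>"
  by (simp_all add: fraction_field_def)

lemma nonzero_prod: "\<lbrakk>a \<in> carrier R; b \<in> carrier R; a \<noteq> \<zero>; b \<noteq> \<zero>\<rbrakk> \<Longrightarrow> a \<otimes> b \<noteq> \<zero>"
  using integral by blast

lemma field_fraction_field: "field (fraction_field R)"
proof -
  let ?K = "fraction_field R"
  note [simp] = one_fraction_field zero_fraction_field fraction_eq_iff nonzero_prod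
  have "cring ?K"
  proof (rule cringI)
    show "abelian_group ?K"
    proof (rule abelian_groupI)
      show "\<exists>Y\<in>carrier ?K. Y \<oplus>\<^bsub>?K\<^esub> X = \<zero>\<^bsub>?K\<^esub>" if "X \<in> carrier ?K" for X
        using that
      proof (cases rule: fraction_cases)
        case (1 a b)
        then show ?thesis by (intro bexI[of _ "fraction R (\<ominus> a) b"]) (auto simp: l_minus l_neg)
      qed
    qed (auto elim!: fraction_cases simp: l_distr r_distr m_ac a_ac)
    show "Group.comm_monoid ?K"
      by (rule comm_monoidI) (auto elim!: fraction_cases simp: m_ac)
    show "(X \<oplus>\<^bsub>?K\<^esub> Y) \<otimes>\<^bsub>?K\<^esub> Z = X \<otimes>\<^bsub>?K\<^esub> Z \<oplus>\<^bsub>?K\<^esub> Y \<otimes>\<^bsub>?K\<^esub> Z"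
      if XYZ: "X \<in> carrier ?K" "Y \<in> carrier ?K" "Z \<in> carrier ?K" for X Y Z
    proof -
      obtain a b where 1: "a \<in> carrier R" "b \<in> carrier R" "b \<noteq> \<zero>" "X = fraction R a b"
        using XYZ(1) by (rule fraction_cases)
      obtain c d where 2: "c \<in> carrier R" "d \<in> carrier R" "d \<noteq> \<zero>" "Y = fraction R c d"
        using XYZ(2) by (rule fraction_cases)
      obtain e f where 3: "e \<in> carrier R" "f \<in> carrier R" "f \<noteq> \<zero>" "Z = fraction R e f"
        using XYZ(3) by (rule fraction_cases)
      have "((a \<otimes> d \<oplus> c \<otimes> b) \<otimes> e) \<otimes> ((b \<otimes> f) \<otimes> (d \<otimes> f))
              = ((a \<otimes> e) \<otimes> (d \<otimes> f) \<oplus> (c \<otimes> e) \<otimes> (b \<otimes> f)) \<otimes> ((b \<otimes> d) \<otimes> f)"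
        using 1 2 3 by (simp add: l_distr r_distr m_ac)
      then show ?thesis using 1 2 3 by simp
    qed
  qed
  then show ?thesis
  proof (rule cring.cring_fieldI2)
    show "\<zero>\<^bsub>?K\<^esub> \<noteq> \<one>\<^bsub>?K\<^esub>" by simp
    show "\<exists>Y\<in>carrier ?K. X \<otimes>\<^bsub>?K\<^esub> Y = \<one>\<^bsub>?K\<^esub>" if "X \<in> carrier ?K" "X \<noteq> \<zero>\<^bsub>?K\<^esub>" for X
      using that(1)
    proof (cases rule: fraction_cases)
      case (1 a b)
      with that(2) have "a \<noteq> \<zero>" by auto
      with 1 show ?thesis by (intro bexI[of _ "fraction R b a"]) (auto simp: m_ac)
    qed
  qed
qed

lemma fraction_embed_hom: "fraction_embed R \<in> Ring.ring_hom R (fraction_field R)"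
  by (rule ring_hom_memI) (auto simp: fraction_embed_def one_fraction_field)

lemma fraction_embed_inj: "inj_on (fraction_embed R) (carrier R)"
  by (auto simp: inj_on_def fraction_embed_def fraction_eq_iff)

end


section \<open>The Grassmannian\<close>

definition full_rank_mats :: "nat \<Rightarrow> nat \<Rightarrow> complex mat set" where
  "full_rank_mats k n = {A \<in> carrier_mat k n. vec_space.rank k A = k}"

abbreviation row_span :: "nat \<Rightarrow> complex mat \<Rightarrow> complex vec set" where
  "row_span n A \<equiv> vec_space.row_space n A"

definition Gr :: "nat \<Rightarrow> nat \<Rightarrow> complex vec set set" where
  "Gr k n = row_span n ` full_rank_mats k n"

text \<open>The classical topology: full rank matrices carry the topology of entrywise convergence,
  and the Grassmannian is their quotient by the relation of having the same row span.\<close>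

definition full_rank_topology :: "nat \<Rightarrow> nat \<Rightarrow> complex mat topology" where
  "full_rank_topology k n = pullback_topology (full_rank_mats k n)
     (\<lambda>A (i, j). if i < k \<and> j < n then A $$ (i, j) else 0) euclidean"

definition Gr_topology :: "nat \<Rightarrow> nat \<Rightarrow> complex vec set topology" where
  "Gr_topology k n = topology (\<lambda>U. U \<subseteq> Gr k n \<and>
     openin (full_rank_topology k n) {A \<in> full_rank_mats k n. row_span n A \<in> U})"

lemma topspace_full_rank_topology: "topspace (full_rank_topology k n) = full_rank_mats k n"
  by (simp add: full_rank_topology_def topspace_pullback_topology)

lemma openin_Gr_topology:
  "openin (Gr_topology k n) U \<longleftrightarrow> U \<subseteq> Gr k n \<and>
     openin (full_rank_topology k n) {A \<in> full_rank_mats k n. row_span n A \<in> U}"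
proof -
  let ?L = "\<lambda>U. {A \<in> full_rank_mats k n. row_span n A \<in> U}"
  have "istopology (\<lambda>U. U \<subseteq> Gr k n \<and> openin (full_rank_topology k n) (?L U))"
    unfolding istopology_def
  proof (intro conjI allI impI)
    fix S T assume "S \<subseteq> Gr k n \<and> openin (full_rank_topology k n) (?L S)"
      and "T \<subseteq> Gr k n \<and> openin (full_rank_topology k n) (?L T)"
    moreover have "?L (S \<inter> T) = ?L S \<inter> ?L T" by auto
    ultimately show "S \<inter> T \<subseteq> Gr k n" "openin (full_rank_topology k n) (?L (S \<inter> T))" by auto
  next
    fix \<K> assume "\<forall>K\<in>\<K>. K \<subseteq> Gr k n \<and> openin (full_rank_topology k n) (?L K)"
    moreover have "?L (\<Union>\<K>) = \<Union>(?L ` \<K>)" by auto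
    ultimately show "\<Union>\<K> \<subseteq> Gr k n" "openin (full_rank_topology k n) (?L (\<Union>\<K>))"
      by (auto simp del: UN_simps)
  qed
  then show ?thesis unfolding Gr_topology_def by (simp add: topology_inverse')
qed

lemma topspace_Gr_topology: "topspace (Gr_topology k n) = Gr k n"
proof -
  have "{A \<in> full_rank_mats k n. row_span n A \<in> Gr k n} = topspace (full_rank_topology k n)"
    by (auto simp: Gr_def topspace_full_rank_topology)
  then have "openin (Gr_topology k n) (Gr k n)" by (simp add: openin_Gr_topology)
  then show ?thesis by (meson openin_Gr_topology openin_subset openin_topspace subset_antisym)
qed

lemma quotient_map_row_span: "quotient_map (full_rank_topology k n) (Gr_topology k n) (row_span n)"
  by (auto simp: quotient_map_def topspace_full_rank_topology topspace_Gr_topology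
      openin_Gr_topology Gr_def)

text \<open>Index sets are subsets of \<open>{1..n}\<close>, whereas columns of a matrix are numbered from 0.\<close>

definition plucker :: "complex mat \<Rightarrow> nat set \<Rightarrow> complex" where
  "plucker A I = Determinant.det (submatrix A UNIV {j. Suc j \<in> I})"

definition plucker_nonneg :: "nat \<Rightarrow> nat \<Rightarrow> complex vec set \<Rightarrow> bool" where
  "plucker_nonneg k n V \<longleftrightarrow> (\<exists>A\<in>full_rank_mats k n. row_span n A = V \<and>
     (\<exists>c. c \<noteq> 0 \<and> (\<forall>I. I \<subseteq> {1..n} \<and> card I = k \<longrightarrow> c * plucker A I \<in> \<real>\<^sub>\<ge>\<^sub>0)))"

text \<open>The cyclic shift on row vectors; it acts on subspaces by taking images.\<close>

definition cyclic_shift :: "nat \<Rightarrow> nat \<Rightarrow> complex vec \<Rightarrow> complex vec" where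
  "cyclic_shift k n v =
     vec n (\<lambda>j. if Suc j < n then v $ Suc j else (-1) ^ (k - 1) * v $ 0)"

definition rho :: "nat \<Rightarrow> nat \<Rightarrow> complex vec set \<Rightarrow> complex vec set" where
  "rho k n V = cyclic_shift k n ` V"

lemma rho_row_span:
  assumes A: "A \<in> carrier_mat k n"
  shows "rho k n (row_span n A) = row_span n
           (mat k n (\<lambda>(i, j). if Suc j < n then A $$ (i, Suc j) else (-1) ^ (k - 1) * A $$ (i, 0)))"
    (is "_ = row_span n ?B")
proof -
  have B: "?B \<in> carrier_mat k n" by simp
  have span: "row_span n M = (\<lambda>y. M\<^sup>T *\<^sub>v y) ` carrier_vec k" if "M \<in> carrier_mat k n" for M
  proof -
    have "M\<^sup>T *\<^sub>v y \<in> carrier_vec n" if "y \<in> carrier_vec k" for y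
      using \<open>M \<in> carrier_mat k n\<close> that by simp
    then show ?thesis
      unfolding vec_space.row_space_eq[OF that] carrier_matD[OF that] by blast
  qed
  have "cyclic_shift k n (A\<^sup>T *\<^sub>v y) = ?B\<^sup>T *\<^sub>v y" if "y \<in> carrier_vec k" for y
  proof (rule eq_vecI)
    fix j assume "j < dim_vec (?B\<^sup>T *\<^sub>v y)"
    then have j: "j < n" by simp
    have "(A\<^sup>T *\<^sub>v y) $ i = (\<Sum>r = 0..<k. A $$ (r, i) * y $ r)" if "i < n" for i
      using A \<open>y \<in> carrier_vec k\<close> that by (simp add: scalar_prod_def)
    moreover have "(?B\<^sup>T *\<^sub>v y) $ j = (\<Sum>r = 0..<k. ?B $$ (r, j) * y $ r)"
      using j that by (simp add: scalar_prod_def)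
    ultimately show "cyclic_shift k n (A\<^sup>T *\<^sub>v y) $ j = (?B\<^sup>T *\<^sub>v y) $ j"
      using j by (auto simp: cyclic_shift_def sum_distrib_left mult.assoc)
  qed (simp add: cyclic_shift_def)
  then show ?thesis
    unfolding rho_def span[OF A] span[OF B] image_image by (intro image_cong refl)
qed

definition fixed_locus :: "nat \<Rightarrow> nat \<Rightarrow> nat \<Rightarrow> complex vec set set" where
  "fixed_locus k l n = {V \<in> Gr k n. (rho k n ^^ l) V = V}"

definition distinguished_component :: "nat \<Rightarrow> nat \<Rightarrow> nat \<Rightarrow> complex vec set set" where
  "distinguished_component k l n = (THE C.
     C \<in> connected_components_of (subtopology (Gr_topology k n) (fixed_locus k l n)) \<and>
     {V \<in> fixed_locus k l n. plucker_nonneg k n V} \<subseteq> C)"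


section \<open>Homogeneous coordinate rings\<close>

definition function_ring :: "'a set \<Rightarrow> ('a \<Rightarrow> complex) ring" where
  "function_ring S =
    \<lparr>carrier = S \<rightarrow>\<^sub>E UNIV, mult = (\<lambda>f g. \<lambda>P\<in>S. f P * g P), one = (\<lambda>P\<in>S. 1),
     zero = (\<lambda>P\<in>S. 0), add = (\<lambda>f g. \<lambda>P\<in>S. f P + g P)\<rparr>"

lemma cring_function_ring: "cring (function_ring S)"
proof (rule cringI)
  show "abelian_group (function_ring S)"
  proof (rule abelian_groupI)
    show "\<exists>g\<in>carrier (function_ring S). g \<oplus>\<^bsub>function_ring S\<^esub> f = \<zero>\<^bsub>function_ring S\<^esub>"
      if "f \<in> carrier (function_ring S)" for f
      using that by (intro bexI[of _ "\<lambda>P\<in>S. - f P"]) (auto simp: function_ring_def)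
  qed (auto simp: function_ring_def fun_eq_iff PiE_def extensional_def)
  show "Group.comm_monoid (function_ring S)"
    by (rule comm_monoidI) (auto simp: function_ring_def fun_eq_iff PiE_def extensional_def)
qed (auto simp: function_ring_def fun_eq_iff PiE_def extensional_def algebra_simps)

definition affine_cone :: "nat \<Rightarrow> nat \<Rightarrow> complex vec set set \<Rightarrow> (nat set \<Rightarrow> complex) set" where
  "affine_cone k n X =
     {(\<lambda>I. if I \<subseteq> {1..n} \<and> card I = k then t * plucker A I else 0) | t A.
        A \<in> full_rank_mats k n \<and> row_span n A \<in> X}"

text \<open>The homogeneous ideal of a projective set is the ideal of all polynomials vanishing on its
  affine cone, so the homogeneous coordinate ring is the ring of restrictions of polynomial
  functions to the cone, that is, the algebra of functions generated by the coordinates.\<close>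

definition coordinate :: "nat \<Rightarrow> nat \<Rightarrow> complex vec set set \<Rightarrow> nat set \<Rightarrow>
    (nat set \<Rightarrow> complex) \<Rightarrow> complex" where
  "coordinate k n X I = (\<lambda>P\<in>affine_cone k n X. P I)"

definition const_fun :: "nat \<Rightarrow> nat \<Rightarrow> complex vec set set \<Rightarrow> complex \<Rightarrow>
    (nat set \<Rightarrow> complex) \<Rightarrow> complex" where
  "const_fun k n X c = (\<lambda>P\<in>affine_cone k n X. c)"

definition coordinate_ring :: "nat \<Rightarrow> nat \<Rightarrow> complex vec set set \<Rightarrow>
    ((nat set \<Rightarrow> complex) \<Rightarrow> complex) ring" where
  "coordinate_ring k n X = (function_ring (affine_cone k n X))
     \<lparr>carrier := generate_ring (function_ring (affine_cone k n X))
        (range (const_fun k n X) \<union> {coordinate k n X I | I. I \<subseteq> {1..n} \<and> card I = k})\<rparr>"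

lemma cring_coordinate_ring: "cring (coordinate_ring k n X)"
proof -
  let ?G = "range (const_fun k n X) \<union> {coordinate k n X I | I. I \<subseteq> {1..n} \<and> card I = k}"
  interpret F: cring "function_ring (affine_cone k n X)" by (rule cring_function_ring)
  have G: "?G \<subseteq> carrier (function_ring (affine_cone k n X))"
    by (auto simp: function_ring_def const_fun_def coordinate_def)
  show ?thesis
    unfolding coordinate_ring_def F.subcring_iff[OF F.generate_ring_incl[OF G], symmetric]
    by (rule F.subcringI'[OF F.generate_ring_is_subring[OF G]])
qed

type_synonym frac_elem =
  "(((nat set \<Rightarrow> complex) \<Rightarrow> complex) \<times> ((nat set \<Rightarrow> complex) \<Rightarrow> complex)) set"

definition D_ring :: "nat \<Rightarrow> nat \<Rightarrow> nat \<Rightarrow> ((nat set \<Rightarrow> complex) \<Rightarrow> complex) ring" where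
  "D_ring k l n = coordinate_ring k n (distinguished_component k l n)"

definition D_field :: "nat \<Rightarrow> nat \<Rightarrow> nat \<Rightarrow> frac_elem ring" where
  "D_field k l n = fraction_field (D_ring k l n)"

definition D_plucker :: "nat \<Rightarrow> nat \<Rightarrow> nat \<Rightarrow> nat set \<Rightarrow> frac_elem" where
  "D_plucker k l n I =
     fraction_embed (D_ring k l n) (coordinate k n (distinguished_component k l n) I)"

definition D_const :: "nat \<Rightarrow> nat \<Rightarrow> nat \<Rightarrow> complex \<Rightarrow> frac_elem" where
  "D_const k l n c =
     fraction_embed (D_ring k l n) (const_fun k n (distinguished_component k l n) c)"

text \<open>The coordinate ring as a subset of its fraction field.\<close>

definition D_ring_image :: "nat \<Rightarrow> nat \<Rightarrow> nat \<Rightarrow> frac_elem set" where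
  "D_ring_image k l n = fraction_embed (D_ring k l n) ` carrier (D_ring k l n)"

definition D_subalgebra :: "nat \<Rightarrow> nat \<Rightarrow> nat \<Rightarrow> frac_elem set \<Rightarrow> frac_elem set" where
  "D_subalgebra k l n S = generate_ring (D_field k l n) (range (D_const k l n) \<union> S)"


section \<open>The initial seed\<close>

text \<open>Here \<open>l'\<close> stands for \<open>gcd l n\<close>.\<close>

definition num_mutable :: "nat \<Rightarrow> nat \<Rightarrow> nat" where
  "num_mutable k l' = (k - 1) * (l' - 1)"

text \<open>For \<open>m \<le> num_mutable k l'\<close>, the unique \<open>j\<close> with \<open>m = (j - 1) * (l' - 1) + i\<close> and
  \<open>i \<in> {1..l' - 1}\<close> is \<open>(m - 1) div (l' - 1) + 1\<close>.\<close>

definition initial_index :: "nat \<Rightarrow> nat \<Rightarrow> nat \<Rightarrow> nat set" where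
  "initial_index k l' m =
     (if m \<le> num_mutable k l'
      then let j = (m - 1) div (l' - 1) + 1
           in {m..m + j - 1} \<union> {1 + t * l' | t. j \<le> t \<and> t \<le> k - 1}
      else {m..m + k - 1})"

lemma initial_index_mutable:
  assumes "m = (j - 1) * (l' - 1) + i" "j \<in> {1..k - 1}" "i \<in> {1..l' - 1}"
  shows "initial_index k l' m = {m..m + j - 1} \<union> {1 + t * l' | t. j \<le> t \<and> t \<le> k - 1}"
proof -
  have "m \<le> (j - 1) * (l' - 1) + (l' - 1)" using assms by simp
  also have "\<dots> = j * (l' - 1)" using assms by (cases j) auto
  also have "\<dots> \<le> num_mutable k l'" unfolding num_mutable_def using assms by (intro mult_right_mono) auto
  finally have "m \<le> num_mutable k l'" .
  moreover have "(m - 1) div (l' - 1) = j - 1"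
  proof -
    have "m - 1 = (i - 1) + (j - 1) * (l' - 1)" and "i - 1 < l' - 1" using assms by auto
    then show ?thesis by (simp only:) simp
  qed
  ultimately show ?thesis using assms by (simp add: initial_index_def)
qed

definition cluster_var :: "nat \<Rightarrow> nat \<Rightarrow> nat \<Rightarrow> nat \<Rightarrow> frac_elem" where
  "cluster_var k l n m = D_plucker k l n (initial_index k (gcd l n) m)"

text \<open>The multiset of arrows \<open>(source, target)\<close> of the extended quiver.\<close>

definition quiver :: "nat \<Rightarrow> nat \<Rightarrow> (nat \<times> nat) multiset" where
  "quiver k l' = filter_mset (\<lambda>(a, b). a \<le> num_mutable k l' \<or> b \<le> num_mutable k l')
     (\<Sum>i\<in>{1..num_mutable k l'}. {#(i + 1, i), (i, i + l'), (i + l', i + 1)#})"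

text \<open>The coefficient \<open>eta k p s\<close> is the symmetric Gaussian binomial coefficient at
  \<open>q = exp (2 * pi * \<i> / p)\<close>. For \<open>p = k\<close> the quotient of quantum factorials is undefined at
  \<open>s = 0\<close> and \<open>s = k\<close>, hence the separate case.\<close>

definition eta :: "nat \<Rightarrow> nat \<Rightarrow> nat \<Rightarrow> real" where
  "eta k p s = (if s = 0 \<or> s = k then 1
     else \<Prod>j = 1..s. sin (real (k + 1 - j) * pi / real p) / sin (real j * pi / real p))"

lemma eta_eq_gaussian_binomial:
  fixes k p s :: nat
  defines "qnum \<equiv> \<lambda>m::nat. (cis (real m * pi / real p) - cis (- (real m * pi / real p)))
                             / (cis (pi / real p) - cis (- (pi / real p)))"
  assumes "k < p" "s \<le> k"
  shows "complex_of_real (eta k p s)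
           = (\<Prod>m = 1..k. qnum m) / ((\<Prod>m = 1..s. qnum m) * (\<Prod>m = 1..k - s. qnum m))"
proof -
  have pos: "sin (real m * pi / real p) > 0" if "1 \<le> m" "m \<le> k" for m :: nat
  proof (rule sin_gt_zero)
    show "0 < real m * pi / real p" using that assms by simp
    have "real m * pi < real p * pi" using that assms by simp
    then show "real m * pi / real p < pi" using assms by (simp add: field_simps)
  qed
  have cis: "cis t - cis (- t) = 2 * \<i> * complex_of_real (sin t)" for t
    by (simp add: complex_eq_iff)
  have qnum: "qnum m = complex_of_real (sin (real m * pi / real p) / sin (pi / real p))" for m
    unfolding qnum_def cis by simp
  have nz: "qnum m \<noteq> 0" if "1 \<le> m" "m \<le> k" for m
    using pos[OF that] pos[of 1] that unfolding qnum by simp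
  have quot: "complex_of_real (sin (real a * pi / real p) / sin (real b * pi / real p)) = qnum a / qnum b"
    if "1 \<le> a" "a \<le> k" for a b
    using pos[of 1] that unfolding qnum by simp
  have split: "(\<Prod>m = 1..k. qnum m) = (\<Prod>m = 1..k - s. qnum m) * (\<Prod>j = 1..s. qnum (k + 1 - j))"
    if "s \<le> k" for s
    using that
  proof (induction s)
    case (Suc s)
    then have "k - s = Suc (k - Suc s)" "k + 1 - Suc s = k - s" by auto
    with Suc show ?case by (simp add: ac_simps)
  qed simp
  show ?thesis
  proof (cases "s = 0 \<or> s = k")
    case True
    have "(\<Prod>m = 1..k. qnum m) \<noteq> 0" using nz by simp
    with True show ?thesis by (auto simp: eta_def)
  next
    case False
    then have "complex_of_real (eta k p s) = (\<Prod>j = 1..s.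
        complex_of_real (sin (real (k + 1 - j) * pi / real p) / sin (real j * pi / real p)))"
      unfolding eta_def by (simp only: if_False of_real_prod)
    also have "\<dots> = (\<Prod>j = 1..s. qnum (k + 1 - j) / qnum j)"
      by (rule prod.cong[OF refl], rule quot) (use assms in auto)
    also have "\<dots> = (\<Prod>j = 1..s. qnum (k + 1 - j)) / (\<Prod>j = 1..s. qnum j)"
      by (simp add: prod_dividef)
    finally have "complex_of_real (eta k p s)
                    = (\<Prod>j = 1..s. qnum (k + 1 - j)) / (\<Prod>j = 1..s. qnum j)" .
    moreover have "(\<Prod>m = 1..k - s. qnum m) \<noteq> 0" using nz by fastforce
    ultimately show ?thesis unfolding split[OF \<open>s \<le> k\<close>] by simp
  qed
qed

definition exchange_poly :: "nat \<Rightarrow> nat \<Rightarrow> nat \<Rightarrow> nat \<Rightarrow> frac_elem" where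
  "exchange_poly k l n i = (let K = D_field k l n; x = cluster_var k l n; l' = gcd l n;
       V = {1..num_mutable k l' + l'}; Q = quiver k l' in
     if i = 1
     then \<Oplus>\<^bsub>K\<^esub>s\<in>{0..k}. D_const k l n (complex_of_real (eta k (n div l') s))
            \<otimes>\<^bsub>K\<^esub> x 2 [^]\<^bsub>K\<^esub> s \<otimes>\<^bsub>K\<^esub> x (l' + 1) [^]\<^bsub>K\<^esub> (k - s)
     else (\<Otimes>\<^bsub>K\<^esub>m\<in>V. x m [^]\<^bsub>K\<^esub> count Q (m, i)) \<oplus>\<^bsub>K\<^esub> (\<Otimes>\<^bsub>K\<^esub>m\<in>V. x m [^]\<^bsub>K\<^esub> count Q (i, m)))"

definition neighbour_var :: "nat \<Rightarrow> nat \<Rightarrow> nat \<Rightarrow> nat \<Rightarrow> frac_elem" where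
  "neighbour_var k l n i = (THE y. y \<in> carrier (D_field k l n) \<and>
     cluster_var k l n i \<otimes>\<^bsub>D_field k l n\<^esub> y = exchange_poly k l n i)"

definition lower_bound :: "nat \<Rightarrow> nat \<Rightarrow> nat \<Rightarrow> frac_elem set" where
  "lower_bound k l n = D_subalgebra k l n
     (cluster_var k l n ` {1..num_mutable k (gcd l n) + gcd l n}
      \<union> neighbour_var k l n ` {1..num_mutable k (gcd l n)})"

definition laurent_ring :: "nat \<Rightarrow> nat \<Rightarrow> nat \<Rightarrow> frac_elem set" where
  "laurent_ring k l n = D_subalgebra k l n
     (\<Union>m\<in>{1..num_mutable k (gcd l n) + gcd l n}.
        {cluster_var k l n m, inv\<^bsub>D_field k l n\<^esub> cluster_var k l n m})"

end

theory Submission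
  imports Defs
begin

text \<open>A point fixed by the \<open>l'\<close>-th power of the shift lies in the distinguished component exactly when
  the shift acts on it with the \<open>k\<close> distinct eigenvalues \<open>zeta r\<close>, so the component is parametrised by
  choosing one eigenvector \<open>u r\<close> per eigenvalue and its coordinate ring becomes a ring of functions of
  \<open>u\<close> generated by the minors of a quasi-periodic matrix. The generic exchange relations are then
  three-term Pluecker relations combined with shift invariance of the minors. For the first one, \<open>x 1\<close>
  is a constant times the product of the \<open>u r 0\<close>, while the quantum binomial theorem factors the
  right-hand side into the \<open>x (l' + 1) + zeta r * x 2\<close>, each of which is divisible by \<open>u r 0\<close>. For the
  upper bound, Cramer's rule expresses every column, one at a time, through the columns \<open>t * l'\<close> with
  Laurent polynomials as coefficients.\<close>

section \<open>Determinants of column lists\<close>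

text \<open>In the first exchange relation it is easy to divide by the product of the
  \<open>u r 0\<close> among polynomials in \<open>u\<close>; the obstacle is that the quotient must
  be a polynomial in minors. Its monomials turn out to have degree \<open>k - 1\<close> in every
  row, hence are products of monomials with one entry from each row, and Fourier inversion writes
  those as combinations of minors. The component is pinned down by two open conditions: an
  eigenvector for \<open>zeta j\<close> exists when a projection does not vanish, and none exists
  when the shift minus \<open>zeta j\<close> is injective on the subspace. A nonnegative point
  qualifies because its pairing determinant with the totally positive point is a sum of terms of one
  common phase. For the upper bound, moving a known relation by \<open>l'\<close> brings in the one
  unwanted column \<open>k * l'\<close>; the minor needed to eliminate it is, up to sign, an initial
  variable. Identities with denominators hold only where no \<open>x m\<close> vanishes; multiplying
  them by all the \<open>x m\<close> makes them hold everywhere.\<close>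

definition bracket :: "nat \<Rightarrow> (nat \<Rightarrow> 'a::field) list \<Rightarrow> 'a" where
  "bracket k xs = Determinant.det (mat k k (\<lambda>(r, i). (xs ! i) r))"

lemma bracket_swap:
  fixes xs zs :: "(nat \<Rightarrow> 'a::field) list"
  assumes "length xs + length zs + 2 = k"
  shows "bracket k (xs @ x # y # zs) = - bracket k (xs @ y # x # zs)"
proof -
  let ?m = "length xs"
  let ?A = "mat k k (\<lambda>(r, i). ((xs @ y # x # zs) ! i) r)"
  have "swapcols ?m (Suc ?m) ?A = mat k k (\<lambda>(r, i). ((xs @ x # y # zs) ! i) r)"
    using assms by (intro eq_matI) (auto simp: mat_swapcols_def nth_append nth_Cons' numeral_2_eq_2)
  moreover have "Determinant.det (swapcols ?m (Suc ?m) ?A) = - Determinant.det ?A"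
    by (rule det_swapcols[of _ k]) (use assms in auto)
  ultimately show ?thesis unfolding bracket_def by simp
qed

lemma bracket_repeat:
  assumes "length xs = k" "i < k" "j < k" "i \<noteq> j" "xs ! i = xs ! j"
  shows "bracket k xs = 0"
  unfolding bracket_def
  by (rule det_identical_columns[of _ k i j]) (use assms in \<open>auto intro!: eq_vecI\<close>)

text \<open>The cofactors along a column do not see its entries, so they may be computed with the
  zero column in its place. A bracket with one free slot thus becomes a functional that can be
  applied to vector relations.\<close>

lemma bracket_linear:
  fixes xs zs :: "(nat \<Rightarrow> 'a::field) list"
  assumes "length xs + length zs + 1 = k"
  obtains c where "\<And>v. bracket k (xs @ v # zs) = (\<Sum>r<k. c r * v r)"
proof -
  let ?m = "length xs"
  let ?A = "\<lambda>v. mat k k (\<lambda>(r, i). ((xs @ v # zs) ! i) r)"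
  have "bracket k (xs @ v # zs) = (\<Sum>r<k. cofactor (?A (\<lambda>_. 0)) r ?m * v r)" for v
  proof -
    have "bracket k (xs @ v # zs) = (\<Sum>r<k. ?A v $$ (r, ?m) * cofactor (?A v) r ?m)"
      unfolding bracket_def by (rule laplace_expansion_column) (use assms in auto)
    also have "\<dots> = (\<Sum>r<k. cofactor (?A (\<lambda>_. 0)) r ?m * v r)"
    proof (rule sum.cong[OF refl])
      fix r assume "r \<in> {..<k}"
      have "mat_delete (?A v) r ?m = mat_delete (?A (\<lambda>_. 0)) r ?m"
        using assms by (intro eq_matI) (auto simp: mat_delete_def nth_append nth_Cons')
      then show "?A v $$ (r, ?m) * cofactor (?A v) r ?m = cofactor (?A (\<lambda>_. 0)) r ?m * v r"
        using \<open>r \<in> {..<k}\<close> assms by (simp add: cofactor_def)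
    qed
    finally show ?thesis .
  qed
  then show ?thesis by (rule that)
qed

text \<open>Putting a second copy of row \<open>r\<close> on top of the \<open>k\<close> by
  \<open>k + 1\<close> matrix makes it square and singular; expansion along the copy gives
  coordinate \<open>r\<close> of the linear dependence between \<open>k + 1\<close> vectors.\<close>

lemma cramer_relation:
  fixes vs :: "(nat \<Rightarrow> 'a::field) list"
  assumes len: "length vs = Suc k" and r: "r < k"
  shows "(\<Sum>i\<le>k. (-1) ^ i * (vs ! i) r * bracket k (take i vs @ drop (Suc i) vs)) = 0"
proof -
  let ?A = "mat (Suc k) (Suc k) (\<lambda>(s, i). (vs ! i) (if s = 0 then r else s - 1))"
  have "Determinant.det ?A = 0"
    by (rule det_identical_rows[of _ "Suc k" 0 "Suc r"]) (use r in auto)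
  moreover have "Determinant.det ?A = (\<Sum>i<Suc k. ?A $$ (0, i) * cofactor ?A 0 i)"
    by (rule laplace_expansion_row[symmetric, symmetric]) auto
  moreover have "?A $$ (0, i) * cofactor ?A 0 i
      = (-1) ^ i * (vs ! i) r * bracket k (take i vs @ drop (Suc i) vs)" if "i < Suc k" for i
  proof -
    have "mat_delete ?A 0 i = mat k k (\<lambda>(s, j). ((take i vs @ drop (Suc i) vs) ! j) s)"
      using that len by (intro eq_matI) (auto simp: mat_delete_def nth_append min_def)
    then show ?thesis using that by (simp add: cofactor_def bracket_def)
  qed
  ultimately show ?thesis by (metis (no_types, lifting) lessThan_Suc_atMost lessThan_iff sum.cong)
qed

text \<open>This is the functional \<open>v\<close> to [M, a, v], applied to Cramer's relation for
  the vectors of \<open>M\<close> and \<open>b\<close>, \<open>c\<close>, \<open>d\<close>: a term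
  whose coefficient vector lies in \<open>M\<close> has a repeated column, and three terms
  survive.\<close>

lemma plucker_relation:
  fixes a b c d :: "nat \<Rightarrow> 'a::field"
  assumes len: "length M + 2 = k"
  shows "bracket k (M @ [a, b]) * bracket k (M @ [c, d])
       - bracket k (M @ [a, c]) * bracket k (M @ [b, d])
       + bracket k (M @ [a, d]) * bracket k (M @ [b, c]) = 0"
proof -
  let ?vs = "M @ [b, c, d]"
  let ?m = "length M"
  let ?br = "\<lambda>i. bracket k (take i ?vs @ drop (Suc i) ?vs)"
  obtain \<phi> where \<phi>: "\<And>v. bracket k (M @ [a] @ v # []) = (\<Sum>r<k. \<phi> r * v r)"
    using bracket_linear[of "M @ [a]" "[]" k] len by (auto simp: append_assoc)
  have "(\<Sum>i\<le>k. (-1) ^ i * bracket k (M @ [a, ?vs ! i]) * ?br i)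
      = (\<Sum>i\<le>k. \<Sum>r<k. \<phi> r * ((-1) ^ i * (?vs ! i) r * ?br i))"
    using \<phi> by (simp add: sum_distrib_left sum_distrib_right mult_ac)
  also have "\<dots> = (\<Sum>r<k. \<phi> r * (\<Sum>i\<le>k. (-1) ^ i * (?vs ! i) r * ?br i))"
    by (subst sum.swap) (simp add: sum_distrib_left)
  also have "\<dots> = 0"
    using cramer_relation[of ?vs k] len by simp
  finally have sum0: "(\<Sum>i\<le>k. (-1) ^ i * bracket k (M @ [a, ?vs ! i]) * ?br i) = 0" .
  have "bracket k (M @ [a, ?vs ! i]) = 0" if "i < ?m" for i
    by (rule bracket_repeat[of _ k i "Suc ?m"]) (use that len in \<open>auto simp: nth_append\<close>)
  moreover have "k = Suc (Suc ?m)" using len by simp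
  then have "{..k} = {..<?m} \<union> {?m, Suc ?m, Suc (Suc ?m)}" by auto
  ultimately have "(\<Sum>i\<in>{?m, Suc ?m, Suc (Suc ?m)}. (-1) ^ i * bracket k (M @ [a, ?vs ! i]) * ?br i) = 0"
    using sum0 by (subst (asm) sum.mono_neutral_right[where S = "{?m, Suc ?m, Suc (Suc ?m)}"]) auto
  moreover have "((-1) ^ ?m) * ((-1) ^ ?m) = (1::'a)" by (simp flip: power_mult_distrib)
  ultimately have "(-1) ^ ?m * (bracket k (M @ [a, b]) * bracket k (M @ [c, d])
       - bracket k (M @ [a, c]) * bracket k (M @ [b, d])
       + bracket k (M @ [a, d]) * bracket k (M @ [b, c])) = 0"
    by (simp add: nth_append algebra_simps)
  then show ?thesis by simp
qed

lemma bracket_move: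
  fixes xs ys zs :: "(nat \<Rightarrow> 'a::field) list"
  assumes "length xs + length ys + length zs + 1 = k"
  shows "bracket k (xs @ x # ys @ zs) = (-1) ^ length ys * bracket k (xs @ ys @ x # zs)"
  using assms
proof (induction ys arbitrary: xs)
  case (Cons y ys)
  have "bracket k (xs @ x # y # ys @ zs) = - bracket k (xs @ y # x # ys @ zs)"
    using Cons.prems by (intro bracket_swap) auto
  also have "bracket k (xs @ y # x # ys @ zs) = (-1) ^ length ys * bracket k ((xs @ [y]) @ ys @ x # zs)"
    using Cons.IH[of "xs @ [y]"] Cons.prems by simp
  finally show ?case by simp
qed simp

text \<open>The three-term relation in the shape in which the initial variables present it, with the
  common columns \<open>L\<close> and \<open>M\<close> between the varying ones. All brackets are
  first brought to the normal form \<open>?T\<close>, at the cost of signs.\<close>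

lemma bracket_block_identity2:
  fixes a b d f :: "nat \<Rightarrow> 'a::field"
  assumes len: "length L + length M + 2 = k"
  shows "bracket k (b # L @ M @ [f]) * bracket k (a # L @ d # M)
       = bracket k (L @ d # M @ [f]) * bracket k (a # b # L @ M)
       + bracket k (b # L @ d # M) * bracket k (a # L @ M @ [f])"
proof -
  let ?T = "\<lambda>x y. bracket k ((L @ M) @ [x, y])"
  \<comment> \<open>Naming the signs and keeping only that they square to 1 makes the rest a
    polynomial identity.\<close>
  obtain s t :: 'a where st: "(-1) ^ length L = s" "(-1) ^ length M = t"
    and sq: "s * s = 1" "t * t = 1" by (simp flip: power_mult_distrib)
  have sq': "s * (t * (s * t)) = 1" using sq by Groebner_Basis.algebra
  have 1: "bracket k (x # L @ M @ [y]) = s * t * ?T x y" for x y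
    using bracket_move[of "[]" "L @ M" "[y]" k x] len by (simp add: power_add st)
  have 2: "bracket k (x # L @ y # M) = s * ?T x y" for x y
    using bracket_move[of "x # L" M "[]" k y] 1[of x y] sq len by (simp add: st)
  have 3: "bracket k (L @ x # M @ [y]) = t * ?T x y" for x y
    using bracket_move[of L M "[y]" k x] len by (simp add: st)
  have 4: "bracket k (x # y # L @ M) = ?T x y" for x y
    using bracket_move[of "[x]" "L @ M" "[]" k y] 1[of x y] sq len
    by (simp add: power_add st sq')
  have "?T a b * ?T d f - ?T a d * ?T b f + ?T a f * ?T b d = 0"
    using len by (intro plucker_relation) auto
  then show ?thesis unfolding 1 2 3 4 using sq by Groebner_Basis.algebra
qed

text \<open>Two three-term relations are combined, \<open>R1\<close> with \<open>f\<close> and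
  \<open>R2\<close> with \<open>b\<close> as an additional common column. The new variable is a
  difference of two products of minors, not a single minor.\<close>

lemma bracket_block_identity3:
  fixes a b c d f g :: "nat \<Rightarrow> 'a::field"
  assumes len: "length K + length L + length M + 3 = k"
  shows "bracket k (b # K @ c # L @ M @ [f])
         * (bracket k (a # b # K @ L @ d # M) * bracket k (K @ c # L @ M @ [f, g])
            - bracket k (a # b # K @ c # L @ M) * bracket k (K @ L @ d # M @ [f, g]))
       = bracket k (K @ c # L @ d # M @ [f]) * bracket k (b # K @ L @ M @ [f, g])
         * bracket k (a # b # K @ c # L @ M)
       + bracket k (b # K @ c # L @ d # M) * bracket k (a # b # K @ L @ M @ [f])
         * bracket k (K @ c # L @ M @ [f, g])"
proof -
  let ?T = "\<lambda>x y z. bracket k ((K @ L @ M) @ [x, y, z])"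
  obtain r s t :: 'a where st: "(-1) ^ length K = r" "(-1) ^ length L = s" "(-1) ^ length M = t"
    and sq: "r * r = 1" "s * s = 1" "t * t = 1" by (simp flip: power_mult_distrib)
  have sq': "s * (t * (s * t)) = 1" "r * (s * (t * (r * (s * t)))) = 1"
    using sq by Groebner_Basis.algebra+
  note mv = bracket_move
  have 1: "bracket k (K @ L @ x # M @ [y, z]) = t * ?T x y z" for x y z
    using mv[of "K @ L" M "[y, z]" k x] len by (simp add: st)
  have 2: "bracket k (K @ x # L @ M @ [y, z]) = s * t * ?T x y z" for x y z
    using mv[of K "L @ M" "[y, z]" k x] len by (simp add: power_add st)
  have 3: "bracket k (x # K @ L @ M @ [y, z]) = r * s * t * ?T x y z" for x y z
    using mv[of "[]" "K @ L @ M" "[y, z]" k x] len by (simp add: power_add st)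
  have 4: "bracket k (K @ x # L @ y # M @ [z]) = s * ?T x y z" for x y z
    using mv[of "K @ x # L" M "[z]" k y] 2[of x y z] sq len by (simp add: st)
  have 5: "bracket k (x # K @ y # L @ M @ [z]) = r * ?T x y z" for x y z
    using mv[of "x # K" "L @ M" "[z]" k y] 3[of x y z] sq len by (simp add: power_add st sq')
  have 6: "bracket k (x # K @ y # L @ z # M) = r * t * ?T x y z" for x y z
    using mv[of "x # K @ y # L" M "[]" k z] 5[of x y z] len by (simp add: st)
  have 7: "bracket k (x # y # K @ L @ M @ [z]) = ?T x y z" for x y z
    using mv[of "[x]" K "L @ M @ [z]" k y] mv[of "x # K" "L @ M" "[z]" k y] 3[of x y z] sq len
    by (simp add: power_add st sq')
  have 8: "bracket k (x # y # K @ L @ z # M) = t * ?T x y z" for x y z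
    using mv[of "x # y # K @ L" M "[]" k z] 7[of x y z] len by (simp add: st)
  have 9: "bracket k (x # y # K @ z # L @ M) = s * t * ?T x y z" for x y z
    using mv[of "x # y # K" "L @ M" "[]" k z] 7[of x y z] len by (simp add: power_add st)
  have sw: "?T x y z = - ?T y x z" "?T x y z = - ?T x z y" for x y z
    using bracket_swap[of "K @ L @ M" "[z]" k x y] bracket_swap[of "K @ L @ M @ [x]" "[]" k y z] len
    by simp_all
  have "?T f b c * ?T f d g - ?T f b d * ?T f c g + ?T f b g * ?T f c d = 0"
    using plucker_relation[of "(K @ L @ M) @ [f]" k b c d g] len by (simp add: st)
  moreover have "?T f b c = ?T b c f" "?T f d g = - ?T d f g" "?T f b d = ?T b d f"
    "?T f c g = - ?T c f g" "?T f b g = - ?T b f g" "?T f c d = ?T c d f"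
    by (metis sw add.inverse_inverse)+
  ultimately have R1: "?T b c f * ?T d f g - ?T b d f * ?T c f g + ?T b f g * ?T c d f = 0"
    by Groebner_Basis.algebra
  have "?T b a c * ?T b d f - ?T b a d * ?T b c f + ?T b a f * ?T b c d = 0"
    using plucker_relation[of "(K @ L @ M) @ [b]" k a c d f] len by (simp add: st)
  moreover have "?T b a c = - ?T a b c" "?T b a d = - ?T a b d" "?T b a f = - ?T a b f"
    by (metis sw(1))+
  ultimately have R2: "?T a b c * ?T b d f - ?T a b d * ?T b c f + ?T a b f * ?T b c d = 0"
    by Groebner_Basis.algebra
  \<comment> \<open>The sum of \<open>R2\<close> times [c f g] and \<open>R1\<close> times [a b c],
    in which the terms [a b c][b d f][c f g] cancel.\<close>
  have "?T b c f * (?T a b d * ?T c f g - ?T a b c * ?T d f g)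
      = ?T c d f * ?T b f g * ?T a b c + ?T b c d * ?T a b f * ?T c f g"
    using R1 R2 by Groebner_Basis.algebra
  then show ?thesis unfolding 1 2 3 4 5 6 7 8 9 using sq by Groebner_Basis.algebra
qed

section \<open>Gaussian binomial coefficients and the quantum binomial theorem\<close>

text \<open>At \<open>s = k\<close> numerator and denominator are the same sines in opposite order,
  nonzero because \<open>k < p\<close>; so the exceptional values in \<open>eta\<close> agree with
  the general formula.\<close>

lemma eta_eq_prod:
  assumes "k < p" "s \<le> k"
  shows "eta k p s = (\<Prod>j = 1..s. sin (real (k + 1 - j) * pi / real p) / sin (real j * pi / real p))"
proof (cases "s = k")
  case True
  have pos: "sin (real m * pi / real p) > 0" if "1 \<le> m" "m \<le> k" for m :: nat
  proof (rule sin_gt_zero)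
    show "0 < real m * pi / real p" using that assms by simp
    have "real m * pi < real p * pi" using that assms by simp
    then show "real m * pi / real p < pi" using assms by (simp add: field_simps)
  qed
  have "(\<Prod>j = 1..k. sin (real (k + 1 - j) * pi / real p)) = (\<Prod>j = 1..k. sin (real j * pi / real p))"
    using prod.atLeastAtMost_rev[of "\<lambda>j. sin (real j * pi / real p)" 1 k] by (simp add: add.commute)
  moreover have "(\<Prod>j = 1..k. sin (real j * pi / real p)) \<noteq> 0" using pos by (auto simp: less_imp_neq) fastforce
  ultimately show ?thesis using True by (simp add: eta_def prod_dividef)
qed (use assms in \<open>auto simp: eta_def\<close>)

lemma eta_pascal:
  assumes "Suc k \<le> p" "1 \<le> s" "s \<le> k"
  shows "complex_of_real (eta (Suc k) p s) = cis (real s * (pi / real p)) * eta k p s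
           + cis (- (real (Suc k - s) * (pi / real p))) * eta k p (s - 1)"
proof -
  let ?\<theta> = "pi / real p"
  define S where "S = (\<lambda>m::nat. sin (real m * ?\<theta>))"
  have pos: "S m > 0" if "1 \<le> m" "m \<le> k" for m
    unfolding S_def
  proof (rule sin_gt_zero)
    show "0 < real m * ?\<theta>" using that assms by simp
    have "real m * pi < real p * pi" using that assms by simp
    then show "real m * ?\<theta> < pi" using assms by (simp add: field_simps)
  qed
  obtain t where t: "s = Suc t" using assms by (cases s) auto
  have E: "eta k p u = (\<Prod>j = 1..u. S (k + 1 - j) / S j)" if "u \<le> k" for u
    using eta_eq_prod[of k p u] that assms by (simp add: S_def)
  have e1: "eta k p s = eta k p t * (S (k - t) / S s)"
    using E[of s] E[of t] assms by (simp add: t)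
  have "eta (Suc k) p s = (\<Prod>j = 1..s. S (Suc k + 1 - j) / S j)"
    using assms by (simp add: eta_def S_def)
  also have "\<dots> = (\<Prod>j = 1..s. S (Suc k + 1 - j)) / (\<Prod>j = 1..s. S j)" by (rule prod_dividef)
  also have "(\<Prod>j = 1..s. S (Suc k + 1 - j)) = S (Suc k) * (\<Prod>j = 1..t. S (k + 1 - j))"
    unfolding t One_nat_def prod.atLeast1_atMost_eq prod.lessThan_Suc_shift by simp
  also have "(\<Prod>j = 1..s. S j) = S s * (\<Prod>j = 1..t. S j)" by (simp add: t mult.commute)
  also have "S (Suc k) * (\<Prod>j = 1..t. S (k + 1 - j)) / (S s * (\<Prod>j = 1..t. S j))
      = eta k p t * (S (Suc k) / S s)"
    using E[of t] assms by (simp add: t prod_dividef mult.commute)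
  finally have e2: "eta (Suc k) p s = eta k p t * (S (Suc k) / S s)" .
  have ks: "real (Suc k - s) = real k - real t" using assms t by simp
  have "real (Suc k) * ?\<theta> = real s * ?\<theta> + (real k - real t) * ?\<theta>"
    using t by (simp add: algebra_simps flip: add_divide_distrib)
  then have "complex_of_real (S (Suc k)) = cis (real s * ?\<theta>) * sin ((real k - real t) * ?\<theta>)
      + cis (- ((real k - real t) * ?\<theta>)) * sin (real s * ?\<theta>)"
    unfolding S_def by (simp only:) (simp add: complex_eq_iff sin_add)
  then have "complex_of_real (S (Suc k)) = cis (real s * ?\<theta>) * S (k - t) + cis (- (real (Suc k - s) * ?\<theta>)) * S s"
    using assms t unfolding S_def ks by (simp add: of_nat_diff)
  moreover have "S s \<noteq> 0" using pos[of s] assms by simp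
  ultimately show ?thesis unfolding e1 e2 using t by (simp add: field_simps)
qed

text \<open>Splitting off the last factor leaves the product for \<open>k\<close> with
  \<open>Y\<close> multiplied by \<open>q\<close>; comparing coefficients is then
  \<open>eta_pascal\<close>.\<close>

lemma prod_eta:
  fixes X Y :: complex
  assumes "k \<le> p"
  shows "(\<Prod>r<k. X + cis ((real k - 1 - 2 * real r) * (pi / real p)) * Y)
           = (\<Sum>s\<le>k. eta k p s * Y ^ s * X ^ (k - s))"
  using assms
proof (induction k arbitrary: X Y)
  case 0
  then show ?case by (simp add: eta_def)
next
  case (Suc k)
  define \<theta> where "\<theta> = pi / real p"
  \<comment> \<open>The square root of the parameter exp(2 pi i / p) of the Gaussian
    binomials.\<close>
  define q where "q = cis \<theta>"
  have "(\<Prod>r<Suc k. X + cis ((real (Suc k) - 1 - 2 * real r) * \<theta>) * Y)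
      = (\<Prod>r<k. X + cis ((real k - 1 - 2 * real r) * \<theta>) * (q * Y)) * (X + cis (- (real k * \<theta>)) * Y)"
  proof -
    have "cis ((real (Suc k) - 1 - 2 * real r) * \<theta>) = cis ((real k - 1 - 2 * real r) * \<theta>) * q" for r
      by (simp add: q_def cis_mult algebra_simps)
    then have "(\<Prod>r<k. X + cis ((real (Suc k) - 1 - 2 * real r) * \<theta>) * Y)
        = (\<Prod>r<k. X + cis ((real k - 1 - 2 * real r) * \<theta>) * (q * Y))"
      by (simp only: mult.assoc)
    moreover have "cis ((real (Suc k) - 1 - 2 * real k) * \<theta>) = cis (- (real k * \<theta>))"
      by (intro arg_cong[of _ _ cis]) (simp add: algebra_simps)
    ultimately show ?thesis unfolding prod.lessThan_Suc by simp
  qed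
  also have "\<dots> = (\<Sum>s\<le>k. eta k p s * (q * Y) ^ s * X ^ (k - s)) * (X + cis (- (real k * \<theta>)) * Y)"
    using Suc by (simp add: \<theta>_def)
  also have "\<dots> = (\<Sum>s\<le>k. eta k p s * cis (real s * \<theta>) * Y ^ s * X ^ (Suc k - s))
     + (\<Sum>s\<le>k. eta k p s * cis (real s * \<theta>) * cis (- (real k * \<theta>)) * Y ^ Suc s * X ^ (k - s))"
    unfolding distrib_left sum_distrib_right q_def power_mult_distrib Complex.DeMoivre
    by (intro arg_cong2[of _ _ _ _ "(+)"] sum.cong refl) (auto simp: Suc_diff_le)
  also have "(\<Sum>s\<le>k. eta k p s * cis (real s * \<theta>) * Y ^ s * X ^ (Suc k - s))
      = X ^ Suc k + (\<Sum>s = 1..k. eta k p s * cis (real s * \<theta>) * Y ^ s * X ^ (Suc k - s))"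
    by (simp add: sum.atMost_shift sum.atLeast1_atMost_eq eta_def)
  also have "(\<Sum>s\<le>k. eta k p s * cis (real s * \<theta>) * cis (- (real k * \<theta>)) * Y ^ Suc s * X ^ (k - s))
     = (\<Sum>s = 1..Suc k. eta k p (s - 1) * cis (- (real (Suc k - s) * \<theta>)) * Y ^ s * X ^ (Suc k - s))"
  proof -
    have e: "cis (real s * \<theta>) * (cis (- (real k * \<theta>)) * z) = cis (- (real (k - s) * \<theta>)) * z"
      if "s \<le> k" for s z
      using that by (simp add: mult.assoc[symmetric] cis_mult of_nat_diff left_diff_distrib)
    then show ?thesis
      unfolding atMost_atLeast0 sum.atLeast_Suc_atMost_Suc_shift One_nat_def
      by (intro sum.cong refl) (simp only: e atLeastAtMost_iff mult.assoc o_def diff_Suc_1 diff_Suc_Suc minus_nat.diff_0)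
  qed
  also have "\<dots> = Y ^ Suc k + (\<Sum>s = 1..k. eta k p (s - 1) * cis (- (real (Suc k - s) * \<theta>)) * Y ^ s * X ^ (Suc k - s))"
    by (simp add: eta_def)
  also have "X ^ Suc k + (\<Sum>s = 1..k. eta k p s * cis (real s * \<theta>) * Y ^ s * X ^ (Suc k - s))
     + (Y ^ Suc k + (\<Sum>s = 1..k. eta k p (s - 1) * cis (- (real (Suc k - s) * \<theta>)) * Y ^ s * X ^ (Suc k - s)))
     = X ^ Suc k + Y ^ Suc k + (\<Sum>s = 1..k. eta (Suc k) p s * Y ^ s * X ^ (Suc k - s))"
  proof -
    have "eta (Suc k) p s * Y ^ s * X ^ (Suc k - s) = eta k p s * cis (real s * \<theta>) * Y ^ s * X ^ (Suc k - s)
        + eta k p (s - 1) * cis (- (real (Suc k - s) * \<theta>)) * Y ^ s * X ^ (Suc k - s)"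
      if "s \<in> {1..k}" for s
    proof -
      have "eta (Suc k) p s = cis (real s * \<theta>) * eta k p s + cis (- (real (Suc k - s) * \<theta>)) * eta k p (s - 1)"
        unfolding \<theta>_def by (rule eta_pascal) (use that Suc.prems in auto)
      then show ?thesis by (simp only: distrib_right) (simp only: mult_ac)
    qed
    then have "(\<Sum>s = 1..k. eta (Suc k) p s * Y ^ s * X ^ (Suc k - s))
        = (\<Sum>s = 1..k. eta k p s * cis (real s * \<theta>) * Y ^ s * X ^ (Suc k - s))
          + (\<Sum>s = 1..k. eta k p (s - 1) * cis (- (real (Suc k - s) * \<theta>)) * Y ^ s * X ^ (Suc k - s))"
      by (subst sum.distrib[symmetric]) (rule sum.cong[OF refl])
    then show ?thesis by (simp only: add_ac)
  qed
  also have "\<dots> = (\<Sum>s\<le>Suc k. eta (Suc k) p s * Y ^ s * X ^ (Suc k - s))"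
    by (simp add: sum.atMost_shift sum.atLeast1_atMost_eq eta_def)
  finally show ?case unfolding \<theta>_def .
qed

section \<open>Vandermonde determinants, minors as Pluecker coordinates, Cauchy-Binet\<close>

text \<open>As a function of the last node the determinant is a polynomial of degree at most
  \<open>k\<close> whose coefficient at \<open>k\<close> is the smaller determinant. Subtracting
  that multiple of the product of the \<open>x - z i\<close> leaves degree below \<open>k\<close>
  with \<open>k\<close> distinct roots, hence zero.\<close>

lemma det_vandermonde:
  fixes z :: "nat \<Rightarrow> 'a::field"
  assumes "inj_on z {..<k}"
  shows "Determinant.det (mat k k (\<lambda>(i, j). z i ^ j)) = (\<Prod>i<k. \<Prod>j<i. z i - z j)"
  using assms
proof (induction k)
  case (Suc k)
  define A where "A = (\<lambda>x. mat (Suc k) (Suc k) (\<lambda>(i, j). (if i = k then x else z i) ^ j))"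
  define P where "P = (\<Sum>j<Suc k. monom (cofactor (A 0) k j) j)"
  have det_A: "Determinant.det (A x) = poly P x" for x
  proof -
    have "mat_delete (A x) k j = mat_delete (A 0) k j" for j
      unfolding A_def by (intro eq_matI) (auto simp: mat_delete_def)
    then have "Determinant.det (A x) = (\<Sum>j<Suc k. A x $$ (k, j) * cofactor (A 0) k j)"
      by (subst laplace_expansion_row[of _ "Suc k" k]) (auto simp: A_def cofactor_def)
    also have "\<dots> = poly P x" by (simp add: P_def poly_sum poly_monom A_def mult.commute)
    finally show ?thesis .
  qed
  define V where "V = Determinant.det (mat k k (\<lambda>(i, j). z i ^ j))"
  define Q where "Q = (\<Prod>i<k. [:- z i, 1:])"
  have "mat_delete (A 0) k k = mat k k (\<lambda>(i, j). z i ^ j)"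
    unfolding A_def by (intro eq_matI) (auto simp: mat_delete_def)
  then have "coeff P k = V"
    by (simp add: P_def coeff_sum cofactor_def V_def)
  moreover have Q: "degree Q = k" "coeff Q k = 1"
    using degree_prod_eq_sum_degree[of "{..<k}" "\<lambda>i. [:- z i, 1:]"]
      lead_coeff_prod[of "\<lambda>i. [:- z i, 1:]" "{..<k}"] by (auto simp: Q_def)
  moreover have "degree P \<le> k"
    unfolding P_def by (rule degree_sum_le) (auto intro: order_trans[OF degree_monom_le])
  ultimately have R: "degree (P - Polynomial.smult V Q) \<le> k" "coeff (P - Polynomial.smult V Q) k = 0"
    by (auto intro: degree_diff_le order_trans[OF degree_smult_le])
  have "poly (P - Polynomial.smult V Q) (z i) = 0" if "i < k" for i
  proof -
    have "Determinant.det (A (z i)) = 0"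
      by (rule det_identical_rows[of _ "Suc k" i k]) (use that in \<open>auto simp: A_def intro!: eq_vecI\<close>)
    moreover have "poly Q (z i) = 0" using that by (auto simp: Q_def poly_prod)
    ultimately show ?thesis using det_A by simp
  qed
  then have sub: "z ` {..<k} \<subseteq> {x. poly (P - Polynomial.smult V Q) x = 0}" by auto
  have "P - Polynomial.smult V Q = 0"
  proof (rule ccontr)
    assume nz: "P - Polynomial.smult V Q \<noteq> 0"
    have "k = card (z ` {..<k})" using Suc.prems by (subst card_image) (auto intro: inj_on_subset)
    also have "\<dots> \<le> degree (P - Polynomial.smult V Q)"
      using card_mono[OF poly_roots_finite[OF nz] sub] card_poly_roots_bound[OF nz] by linarith
    finally have "degree (P - Polynomial.smult V Q) = k" using R by simp
    with R nz show False by (metis leading_coeff_0_iff)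
  qed
  then have "poly P (z k) = V * (\<Prod>j<k. z k - z j)" by (simp add: Q_def poly_prod)
  moreover have "A (z k) = mat (Suc k) (Suc k) (\<lambda>(i, j). z i ^ j)"
    unfolding A_def by (intro eq_matI) auto
  moreover have "V = (\<Prod>i<k. \<Prod>j<i. z i - z j)"
    using Suc unfolding V_def by (simp add: inj_on_subset)
  ultimately show ?case using det_A[of "z k"] by simp
qed simp

text \<open>\<open>submatrix\<close> chooses columns through \<open>pick\<close>, which lists a set
  in increasing order, so any increasing enumeration gives the same matrix.\<close>

lemma plucker_strict_mono:
  assumes A: "A \<in> carrier_mat k n" and f: "strict_mono_on {..<k} f" "\<And>i. i < k \<Longrightarrow> f i < n"
  shows "plucker A (Suc ` f ` {..<k}) = Determinant.det (mat k k (\<lambda>(r, i). A $$ (r, f i)))"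
proof -
  define J where "J = f ` {..<k}"
  have J: "{j. Suc j \<in> Suc ` f ` {..<k}} = J" by (auto simp: J_def)
  have inj: "inj_on f {..<k}" using f(1) by (rule strict_mono_on_imp_inj_on)
  have cardJ: "card {j. j < n \<and> j \<in> J} = k"
  proof -
    have "{j. j < n \<and> j \<in> J} = J" using f(2) by (auto simp: J_def)
    then show ?thesis using inj by (simp add: J_def card_image)
  qed
  have pick: "pick J i = f i" if "i < k" for i
  proof -
    have "{a \<in> J. a < f i} = f ` {..<i}"
      using that f(1) by (auto simp: J_def strict_mono_on_less)
    moreover have "card (f ` {..<i}) = i"
      using inj that by (subst card_image) (auto intro: inj_on_subset)
    ultimately show ?thesis using pick_card_in_set[of "f i" J] that by (auto simp: J_def)
  qed
  have "submatrix A UNIV J = mat k k (\<lambda>(r, i). A $$ (r, f i))"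
  proof (rule eq_matI)
    show "dim_row (submatrix A UNIV J) = dim_row (mat k k (\<lambda>(r, i). A $$ (r, f i)))"
      and "dim_col (submatrix A UNIV J) = dim_col (mat k k (\<lambda>(r, i). A $$ (r, f i)))"
      using A cardJ by (auto simp: dim_submatrix)
    fix r i assume "r < dim_row (mat k k (\<lambda>(r, i). A $$ (r, f i)))" "i < dim_col (mat k k (\<lambda>(r, i). A $$ (r, f i)))"
    then show "submatrix A UNIV J $$ (r, i) = mat k k (\<lambda>(r, i). A $$ (r, f i)) $$ (r, i)"
      using A cardJ pick by (subst submatrix_index) (auto simp: pick_UNIV)
  qed
  then show ?thesis unfolding plucker_def J by simp
qed

text \<open>Sorting the columns costs a sign and a repetition gives 0. The sign and the index set
  depend on the column list alone, so one pair serves all matrices.\<close>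

lemma det_columns_eq_plucker:
  assumes f: "\<And>i. i < k \<Longrightarrow> f i < n" and "k \<le> n"
  obtains \<epsilon> I where "I \<subseteq> {1..n}" "card I = k" "\<epsilon> \<in> {-1, 0, 1::complex}"
    "\<And>A. A \<in> carrier_mat k n \<Longrightarrow> Determinant.det (mat k k (\<lambda>(r, i). A $$ (r, f i))) = \<epsilon> * plucker A I"
proof (cases "inj_on f {..<k}")
  case False
  then obtain i j where ij: "i < k" "j < k" "i \<noteq> j" "f i = f j" by (auto simp: inj_on_def)
  show ?thesis
  \<comment> \<open>With factor 0 the index set is arbitrary; \<open>k \<le> n\<close> provides
    one.\<close>
  proof (rule that[of "{1..k}" 0])
    fix A :: "complex mat"
    show "Determinant.det (mat k k (\<lambda>(r, i). A $$ (r, f i))) = 0 * plucker A {1..k}"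
      using ij by (subst det_identical_columns[of _ k i j]) (auto intro!: eq_vecI)
  qed (use \<open>k \<le> n\<close> in auto)
next
  case True
  define xs where "xs = sorted_list_of_set (f ` {..<k})"
  define g where "g = (\<lambda>i. xs ! i)"
  have len: "length xs = k" and set: "set xs = f ` {..<k}" and "sorted_wrt (<) xs"
    using True by (simp_all add: xs_def card_image)
  have g: "strict_mono_on {..<k} g"
    using \<open>sorted_wrt (<) xs\<close> len by (intro strict_mono_onI) (simp add: g_def sorted_wrt_nth_less)
  have gim: "g ` {..<k} = f ` {..<k}" unfolding set[symmetric] set_conv_nth g_def len by auto
  have b1: "bij_betw f {..<k} (f ` {..<k})" using True by (simp add: bij_betw_def)
  have b2: "bij_betw g {..<k} (f ` {..<k})"
    using strict_mono_on_imp_inj_on[OF g] gim by (simp add: bij_betw_def)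
  have bij: "bij_betw (inv_into {..<k} g \<circ> f) {..<k} {..<k}"
    by (rule bij_betw_trans[OF b1 bij_betw_inv_into[OF b2]])
  \<comment> \<open>Sends a position in \<open>f\<close> to the position of the same column in the
    sorted list.\<close>
  define \<pi> where "\<pi> = (\<lambda>i. if i < k then (inv_into {..<k} g \<circ> f) i else i)"
  have "bij_betw \<pi> {..<k} {..<k}" 
    using bij bij_betw_cong[of "{..<k}" \<pi> "inv_into {..<k} g \<circ> f"] by (simp add: \<pi>_def)
  then have "\<pi> permutes {..<k}" by (rule bij_imp_permutes) (simp add: \<pi>_def)
  then have \<pi>: "\<pi> permutes {0..<k}" by (simp add: atLeast0LessThan)
  have g\<pi>: "g (\<pi> i) = f i" if "i < k" for i
  proof -
    have "f i \<in> g ` {..<k}" unfolding gim using that by simp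
    then show ?thesis using that by (simp add: \<pi>_def f_inv_into_f)
  qed
  have \<pi>_lt: "\<pi> i < k" if "i < k" for i using that \<pi> permutes_in_image[OF \<pi>] by auto
  have gn: "g i < n" if "i < k" for i
  proof -
    have "g i \<in> f ` {..<k}" unfolding gim[symmetric] using that by simp
    then show ?thesis using f by auto
  qed
  show ?thesis
  proof (rule that[of "Suc ` g ` {..<k}" "signof \<pi>"])
    show "Suc ` g ` {..<k} \<subseteq> {1..n}" using gn by (auto simp: Suc_le_eq)
    show "card (Suc ` g ` {..<k}) = k" using True gim by (simp add: card_image)
    show "signof \<pi> \<in> {-1, 0, 1::complex}" by (simp add: sign_def)
    fix A :: "complex mat" assume A: "A \<in> carrier_mat k n"
    let ?B = "mat k k (\<lambda>(i, r). A $$ (r, g i))"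
    have "Determinant.det (mat k k (\<lambda>(r, i). A $$ (r, f i)))
        = Determinant.det (transpose_mat (mat k k (\<lambda>(i, r). ?B $$ (\<pi> i, r))))"
      using g\<pi> \<pi>_lt by (intro arg_cong[of _ _ Determinant.det] eq_matI) auto
    also have "\<dots> = Determinant.det (mat k k (\<lambda>(i, r). ?B $$ (\<pi> i, r)))"
      by (rule det_transpose) auto
    also have "\<dots> = signof \<pi> * Determinant.det ?B"
      by (rule det_permute_rows) (use \<pi> in auto)
    also have "Determinant.det ?B = Determinant.det (transpose_mat ?B)"
      by (rule det_transpose[symmetric]) auto
    also have "transpose_mat ?B = mat k k (\<lambda>(r, i). A $$ (r, g i))" by (intro eq_matI) auto
    also have "Determinant.det \<dots> = plucker A (Suc ` g ` {..<k})"
      using A g gn by (simp add: plucker_strict_mono)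
    finally show "Determinant.det (mat k k (\<lambda>(r, i). A $$ (r, f i))) = signof \<pi> * plucker A (Suc ` g ` {..<k})" .
  qed
qed


text \<open>The sum runs over all maps instead of the increasing ones, which explains the factorial.
  After both determinants are expanded, each \<open>\<tau>\<close> contributes a row-permuted copy
  of the right-hand determinant, and its sign occurs twice.\<close>

lemma cauchy_binet:
  fixes a b :: "nat \<Rightarrow> nat \<Rightarrow> 'a::field_char_0"
  shows "(\<Sum>f\<in>{..<k} \<rightarrow>\<^sub>E {..<n}. Determinant.det (mat k k (\<lambda>(r, i). a r (f i)))
              * Determinant.det (mat k k (\<lambda>(r, i). b r (f i))))
       = fact k * Determinant.det (mat k k (\<lambda>(r, s). \<Sum>c<n. a r c * b s c))"
proof -
  let ?P = "{\<sigma>. \<sigma> permutes {0..<k}}"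
  let ?C = "mat k k (\<lambda>(r, s). \<Sum>c<n. a r c * b s c)"
  have det: "Determinant.det (mat k k (\<lambda>(r, i). m r i)) = (\<Sum>\<sigma>\<in>?P. signof \<sigma> * (\<Prod>i<k. m (\<sigma> i) i))" for m :: "nat \<Rightarrow> nat \<Rightarrow> 'a"
  proof -
    have "Determinant.det (mat k k (\<lambda>(r, i). m r i)) = (\<Sum>\<sigma>\<in>?P. signof \<sigma> * (\<Prod>i<k. mat k k (\<lambda>(r, i). m r i) $$ (\<sigma> i, i)))"
      by (rule det_col) auto
    also have "\<dots> = (\<Sum>\<sigma>\<in>?P. signof \<sigma> * (\<Prod>i<k. m (\<sigma> i) i))"
    proof (intro sum.cong refl arg_cong2[of _ _ _ _ "(*)"])
      fix \<sigma> assume "\<sigma> \<in> ?P"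
      then show "(\<Prod>i<k. mat k k (\<lambda>(r, i). m r i) $$ (\<sigma> i, i)) = (\<Prod>i<k. m (\<sigma> i) i)"
        by (intro prod.cong) (auto dest: permutes_in_image)
    qed
    finally show ?thesis .
  qed
  have fin: "finite ?P" by (simp add: finite_permutations)
  have "(\<Sum>f\<in>{..<k} \<rightarrow>\<^sub>E {..<n}. Determinant.det (mat k k (\<lambda>(r, i). a r (f i)))
              * Determinant.det (mat k k (\<lambda>(r, i). b r (f i))))
     = (\<Sum>f\<in>{..<k} \<rightarrow>\<^sub>E {..<n}. \<Sum>\<sigma>\<in>?P. \<Sum>\<tau>\<in>?P. signof \<sigma> * signof \<tau> * (\<Prod>i<k. a (\<sigma> i) (f i) * b (\<tau> i) (f i)))"
    unfolding det sum_product by (simp add: prod.distrib mult_ac)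
  also have "\<dots> = (\<Sum>\<sigma>\<in>?P. \<Sum>\<tau>\<in>?P. \<Sum>f\<in>{..<k} \<rightarrow>\<^sub>E {..<n}. signof \<sigma> * signof \<tau> * (\<Prod>i<k. a (\<sigma> i) (f i) * b (\<tau> i) (f i)))"
    by (rule trans[OF sum.swap], rule sum.cong[OF refl], rule sum.swap)
  also have "\<dots> = (\<Sum>\<sigma>\<in>?P. \<Sum>\<tau>\<in>?P. signof \<sigma> * signof \<tau> * (\<Prod>i<k. \<Sum>c<n. a (\<sigma> i) c * b (\<tau> i) c))"
    by (subst prod_sum_PiE) (auto simp: sum_distrib_left)
  also have "\<dots> = (\<Sum>\<tau>\<in>?P. Determinant.det ?C)"
  proof (subst sum.swap, rule sum.cong[OF refl])
    fix \<tau> assume \<tau>: "\<tau> \<in> ?P"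
    have "signof \<tau> * Determinant.det (transpose_mat ?C) = Determinant.det (mat k k (\<lambda>(i, j). transpose_mat ?C $$ (\<tau> i, j)))"
      using \<tau> by (subst det_permute_rows) auto
    also have "\<dots> = Determinant.det (transpose_mat (mat k k (\<lambda>(r, i). \<Sum>c<n. a r c * b (\<tau> i) c)))"
      using \<tau> by (intro arg_cong[of _ _ Determinant.det] eq_matI) (auto simp: permutes_in_image)
    also have "\<dots> = (\<Sum>\<sigma>\<in>?P. signof \<sigma> * (\<Prod>i<k. \<Sum>c<n. a (\<sigma> i) c * b (\<tau> i) c))"
      by (subst det_transpose[of _ k]) (auto simp: det)
    finally have "signof \<tau> * Determinant.det ?C = (\<Sum>\<sigma>\<in>?P. signof \<sigma> * (\<Prod>i<k. \<Sum>c<n. a (\<sigma> i) c * b (\<tau> i) c))"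
      by (simp add: det_transpose[of _ k])
    then have "signof \<tau> * (signof \<tau> * Determinant.det ?C) = (\<Sum>\<sigma>\<in>?P. signof \<sigma> * signof \<tau> * (\<Prod>i<k. \<Sum>c<n. a (\<sigma> i) c * b (\<tau> i) c))"
      by (simp add: sum_distrib_left mult_ac)
    then show "(\<Sum>\<sigma>\<in>?P. signof \<sigma> * signof \<tau> * (\<Prod>i<k. \<Sum>c<n. a (\<sigma> i) c * b (\<tau> i) c)) = Determinant.det ?C"
      by (simp add: sign_def split: if_splits)
  qed
  also have "\<dots> = fact k * Determinant.det ?C"
    using card_permutations[of "{0..<k}" k] by simp
  finally show ?thesis .
qed

section \<open>Minors of the quasi-periodic matrix and exchange relations\<close>

locale cyclic_setup =
  fixes k l n l' p :: nat
  assumes k2: "k \<ge> 2" and l2: "l \<ge> 2" and n2: "n \<ge> 2"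
    and l'_def: "l' = gcd l n" and l'2: "l' \<ge> 2"
    and p_def: "p = n div l'" and kp: "k \<le> p"
begin

text \<open>The exponents are symmetric about 0, so the product over \<open>r < k\<close> is 1;
  every p-th power is \<open>(-1) ^ (k - 1)\<close>, the sign of the n-th power of the shift; and
  \<open>k \<le> p\<close> keeps these numbers distinct.\<close>

definition zeta :: "nat \<Rightarrow> complex" where
  "zeta r = cis ((real k - 1 - 2 * real r) * (pi / real p))"

text \<open>The row \<open>u r\<close> is extended quasi-periodically, so that the shift by \<open>l'\<close> acts on it as \<open>zeta r\<close>.
  Columns are numbered from 0 here and in \<open>xcols\<close>, \<open>xlist\<close>.\<close>

definition col :: "(nat \<Rightarrow> nat \<Rightarrow> complex) \<Rightarrow> nat \<Rightarrow> nat \<Rightarrow> complex" where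
  "col u c = (\<lambda>r. zeta r ^ (c div l') * u r (c mod l'))"

definition minor :: "(nat \<Rightarrow> nat \<Rightarrow> complex) \<Rightarrow> nat list \<Rightarrow> complex" where
  "minor u cs = bracket k (map (col u) cs)"

lemma n_eq: "n = p * l'" using l'_def p_def by simp

lemma p_pos: "p > 0" using kp k2 by simp

lemma k_le_n: "k \<le> n"
proof -
  have "p \<le> p * l'" using l'2 by simp
  then show ?thesis using kp n_eq by linarith
qed

lemma zeta_nonzero [simp]: "zeta r \<noteq> 0" by (simp add: zeta_def)

lemma prod_zeta: "(\<Prod>r<k. zeta r) = 1"
proof -
  \<comment> \<open>The first \<open>m\<close> of the exponents \<open>k - 1 - 2 * r\<close> add up
    to \<open>m * (k - m)\<close>, which vanishes at \<open>m = k\<close>.\<close>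
  have "(\<Prod>r<m. cis ((real k - 1 - 2 * real r) * x)) = cis ((real m * (real k - real m)) * x)" for m x
    by (induction m) (simp_all add: cis_mult algebra_simps)
  from this[where m = k and x = "pi / real p"] show ?thesis by (simp only: zeta_def) simp
qed

lemma zeta_pow_p: "zeta r ^ p = (-1) ^ (k - 1)"
proof -
  have "zeta r ^ p = cis (real (k - 1) * pi - 2 * pi * real r)"
    using p_pos k2 by (simp add: zeta_def Complex.DeMoivre of_nat_diff algebra_simps)
  also have "\<dots> = cis (real (k - 1) * pi) / cis (real r * (2 * pi))"
    by (simp add: cis_divide mult_ac)
  also have "\<dots> = cis pi ^ (k - 1) / cis (2 * pi) ^ r"
    by (simp only: Complex.DeMoivre)
  finally show ?thesis by simp
qed

text \<open>Two of these numbers differ by a rotation through \<open>s - r\<close> steps of 2 pi /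
  p, and \<open>s - r < k \<le> p\<close> rules out a full turn.\<close>

lemma zeta_inj: "inj_on zeta {..<k}"
proof (rule inj_onI)
  have *: "r = s" if "r \<le> s" "s < k" "zeta r = zeta s" for r s
  proof -
    let ?t = "real (s - r) * (2 * pi / real p)"
    have "zeta s * cis ?t = cis ((real k - 1 - 2 * real s) * (pi / real p) + ?t)"
      by (simp add: zeta_def cis_mult)
    also have "(real k - 1 - 2 * real s) * (pi / real p) + ?t = (real k - 1 - 2 * real r) * (pi / real p)"
      using that by (simp add: of_nat_diff add_divide_distrib diff_divide_distrib ring_distribs)
    finally have "zeta s * cis ?t = zeta s" using that by (simp add: zeta_def)
    then have "cis ?t = 1" by simp
    then have "cos ?t = 1" by (simp add: complex_eq_iff)
    then obtain m :: int where m: "?t = real_of_int m * (2 * pi)" by (auto simp: cos_one_2pi_int)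
    then have "real (s - r) = real_of_int m * real p" using p_pos by (simp add: field_simps)
    then have "int (s - r) = m * int p" by (metis of_int_eq_iff of_int_mult of_int_of_nat_eq)
    moreover have "int (s - r) < int p" "int (s - r) \<ge> 0" using that kp by auto
    ultimately have "int (s - r) = 0"
      by (metis dvd_triv_right zdvd_imp_le not_le order_le_less)
    then show ?thesis using that by simp
  qed
  fix r s assume "r \<in> {..<k}" "s \<in> {..<k}" "zeta r = zeta s"
  then show "r = s" using *[of r s] *[of s r] by (cases r s rule: le_cases) auto
qed

lemma col_shift: "col u (c + l') = (\<lambda>r. zeta r * col u c r)"
  using l'2 by (auto simp: col_def fun_eq_iff)

lemma col_add_n: "col u (c + n) = (\<lambda>r. (-1) ^ (k - 1) * col u c r)"
proof -
  have "(c + n) div l' = c div l' + p" "(c + n) mod l' = c mod l'"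
    using l'2 by (simp_all add: n_eq)
  then show ?thesis by (auto simp: col_def fun_eq_iff power_add zeta_pow_p)
qed

text \<open>Moving every column by \<open>l'\<close> multiplies row \<open>r\<close> by
  \<open>zeta r\<close>, and the product of these factors is 1.\<close>

lemma minor_shift:
  assumes "length cs = k"
  shows "minor u (map (\<lambda>c. c + l') cs) = minor u cs"
proof -
  let ?c = "\<lambda>i. vec k (\<lambda>j. col u (cs ! j) i)"
  have "minor u (map (\<lambda>c. c + l') cs) = Determinant.det (mat\<^sub>r k k (\<lambda>i. zeta i \<cdot>\<^sub>v ?c i))"
    using assms unfolding minor_def bracket_def
    by (intro arg_cong[of _ _ Determinant.det] eq_matI) (auto simp: col_shift)
  also have "\<dots> = prod zeta {0..<k} * Determinant.det (mat\<^sub>r k k ?c)"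
    by (rule det_rows_mul) auto
  also have "mat\<^sub>r k k ?c = mat k k (\<lambda>(r, i). (map (col u) cs ! i) r)"
    using assms by (intro eq_matI) auto
  finally show ?thesis using prod_zeta by (simp add: minor_def bracket_def atLeast0LessThan)
qed

text \<open>The index set \<open>I_m\<close> for \<open>m = (j - 1) * (l' - 1) + i\<close>, also for \<open>j = k\<close> and \<open>i = l'\<close>: then
  \<open>xcols j l' = xcols (j + 1) 1\<close>, in accordance with the coincidence of the two values of \<open>m\<close>.\<close>

definition xcols :: "nat \<Rightarrow> nat \<Rightarrow> nat list" where
  "xcols j i = [(j - 1) * l' + i - j..<(j - 1) * l' + i] @ map (\<lambda>t. t * l') [j..<k]"

definition xlist :: "nat \<Rightarrow> nat list" where
  "xlist m = (if m \<le> num_mutable k l'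
     then let j = (m - 1) div (l' - 1) + 1 in [m - 1..<m - 1 + j] @ map (\<lambda>t. t * l') [j..<k]
     else [m - 1..<m - 1 + k])"

definition x :: "nat \<Rightarrow> (nat \<Rightarrow> nat \<Rightarrow> complex) \<Rightarrow> complex" where
  "x m u = minor u (xlist m)"

lemma j_le: "j \<le> (j - 1) * l' + i" if "1 \<le> i" "1 \<le> j"
proof -
  have "(j - 1) * 1 \<le> (j - 1) * l'" using l'2 by (intro mult_le_mono2) simp
  then show ?thesis using that by linarith
qed

lemma length_xcols: "1 \<le> j \<Longrightarrow> j \<le> k \<Longrightarrow> 1 \<le> i \<Longrightarrow> length (xcols j i) = k"
  using j_le[of i j] by (simp add: xcols_def)

lemma pos_eq: "(j - 1) * (l' - 1) + i - 1 = (j - 1) * l' + i - j" if "1 \<le> i" "1 \<le> j"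
  using that l'2 by (cases j; cases l') auto

text \<open>At \<open>i = l'\<close> the interval ends just before \<open>j * l'\<close>, the first
  of the multiples, which therefore prolongs it.\<close>

lemma xcols_last: "1 \<le> j \<Longrightarrow> j < k \<Longrightarrow> xcols j l' = xcols (j + 1) 1"
proof -
  assume "1 \<le> j" "j < k"
  then have "(j - 1) * l' + l' = j * l'" "j + 1 \<le> j * l' + 1" "[j..<k] = j # [Suc j..<k]"
    using j_le[of 1 "j + 1"] by (auto simp: upt_conv_Cons algebra_simps mult_eq_if)
  then show ?thesis by (simp add: xcols_def)
qed

lemma xlist_eq_mutable:
  assumes "1 \<le> j" "j < k" "1 \<le> i" "i < l'"
  shows "xlist ((j - 1) * (l' - 1) + i) = xcols j i"
proof -
  let ?m = "(j - 1) * (l' - 1) + i"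
  have "?m \<le> (j - 1) * (l' - 1) + (l' - 1)" using assms by simp
  also have "\<dots> = j * (l' - 1)" using assms by (cases j) auto
  also have "\<dots> \<le> num_mutable k l'" unfolding num_mutable_def using assms by (intro mult_right_mono) auto
  finally have m: "?m \<le> num_mutable k l'" .
  have "?m - 1 = (i - 1) + (j - 1) * (l' - 1)" and "i - 1 < l' - 1" using assms by auto
  then have "(?m - 1) div (l' - 1) = j - 1" by (simp only:) simp
  moreover have "?m - 1 + j = (j - 1) * l' + i" using pos_eq[of i j] j_le[of i j] assms by linarith
  ultimately show ?thesis using m assms pos_eq[of i j] j_le[of i j] by (simp add: xlist_def xcols_def Let_def)
qed

lemma xlist_eq:
  assumes "1 \<le> j" "j \<le> k" "1 \<le> i" "i \<le> l'"
  shows "xlist ((j - 1) * (l' - 1) + i) = xcols j i"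
proof -
  have top: "xlist ((k - 1) * (l' - 1) + i) = xcols k i" if "1 \<le> i" for i
  proof -
    have "(k - 1) * (l' - 1) + i - 1 + k = (k - 1) * l' + i" using pos_eq[of i k] j_le[of i k] that k2 by linarith
    then show ?thesis using that pos_eq[of i k] k2 j_le[of i k] by (simp add: xlist_def xcols_def num_mutable_def)
  qed
  consider "j = k" | "j < k" "i < l'" | "j < k" "i = l'" using assms by linarith
  then show ?thesis
  proof cases
    case 3
    have eq: "(j - 1) * (l' - 1) + i = (j + 1 - 1) * (l' - 1) + 1" using 3 assms l'2 by (cases j) auto
    show ?thesis
    proof (cases "j + 1 < k")
      case True
      then show ?thesis unfolding eq using 3 assms xlist_eq_mutable[of "j + 1" 1] xcols_last[of j] l'2 by simp
    next
      case False
      then have "j + 1 = k" using 3 by simp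
      then show ?thesis unfolding eq using top[of 1] xcols_last[of j] 3 assms by auto
    qed
  qed (use assms top xlist_eq_mutable in auto)
qed

definition X :: "nat \<Rightarrow> nat \<Rightarrow> (nat \<Rightarrow> nat \<Rightarrow> complex) \<Rightarrow> complex" where
  "X j i u = minor u (xcols j i)"

lemma x_eq_X: "1 \<le> j \<Longrightarrow> j \<le> k \<Longrightarrow> 1 \<le> i \<Longrightarrow> i \<le> l' \<Longrightarrow> x ((j - 1) * (l' - 1) + i) = X j i"
  using xlist_eq[of j i] by (auto simp: x_def X_def fun_eq_iff)

text \<open>The algebra of functions of \<open>u\<close> generated by the minors; columns beyond
  \<open>n\<close> are allowed. It will be identified with the coordinate ring, pulled back along
  the parametrisation.\<close>

inductive_set reg :: "((nat \<Rightarrow> nat \<Rightarrow> complex) \<Rightarrow> complex) set" where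
  reg_const: "(\<lambda>u. c) \<in> reg"
| reg_minor: "length cs = k \<Longrightarrow> (\<lambda>u. minor u cs) \<in> reg"
| reg_add: "f \<in> reg \<Longrightarrow> g \<in> reg \<Longrightarrow> (\<lambda>u. f u + g u) \<in> reg"
| reg_mult: "f \<in> reg \<Longrightarrow> g \<in> reg \<Longrightarrow> (\<lambda>u. f u * g u) \<in> reg"

lemma reg_diff: "f \<in> reg \<Longrightarrow> g \<in> reg \<Longrightarrow> (\<lambda>u. f u - g u) \<in> reg"
  using reg_add[OF _ reg_mult[OF reg_const[of "-1"]], of f g] by simp

lemma reg_sum: "(\<And>i. i \<in> A \<Longrightarrow> f i \<in> reg) \<Longrightarrow> (\<lambda>u. \<Sum>i\<in>A. f i u) \<in> reg"
proof (induction A rule: infinite_finite_induct)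
  case (insert a A)
  then show ?case using reg_add[of "f a" "\<lambda>u. \<Sum>i\<in>A. f i u"] by simp
qed (simp_all add: reg_const)

lemma reg_prod: "(\<And>i. i \<in> A \<Longrightarrow> f i \<in> reg) \<Longrightarrow> (\<lambda>u. \<Prod>i\<in>A. f i u) \<in> reg"
proof (induction A rule: infinite_finite_induct)
  case (insert a A)
  then show ?case using reg_mult[of "f a" "\<lambda>u. \<Prod>i\<in>A. f i u"] by simp
qed (simp_all add: reg_const)

section \<open>The generic exchange relations\<close>

lemma exchange2:
  assumes "length L + length M + 2 = k"
  shows "\<exists>y\<in>reg. \<forall>u. minor u (b # L @ M @ [f]) * y u
       = minor u (L @ d # M @ [f]) * minor u (a # b # L @ M)
       + minor u (b # L @ d # M) * minor u (a # L @ M @ [f])"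
  using bracket_block_identity2[of "map (col _) L" "map (col _) M" k "col _ b" "col _ f" "col _ a" "col _ d"] assms
  by (intro bexI[of _ "\<lambda>u. minor u (a # L @ d # M)"] reg_minor) (simp_all add: minor_def)

lemma exchange3:
  assumes "length K + length L + length M + 3 = k"
  shows "\<exists>y\<in>reg. \<forall>u. minor u (b # K @ c # L @ M @ [f]) * y u
       = minor u (K @ c # L @ d # M @ [f]) * minor u (b # K @ L @ M @ [f, g])
         * minor u (a # b # K @ c # L @ M)
       + minor u (b # K @ c # L @ d # M) * minor u (a # b # K @ L @ M @ [f])
         * minor u (K @ c # L @ M @ [f, g])"
  using bracket_block_identity3[of "map (col _) K" "map (col _) L" "map (col _) M" k "col _ b" "col _ c" "col _ f"
      "col _ a" "col _ d" "col _ g"] assms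
  by (intro bexI[of _ "\<lambda>u. minor u (a # b # K @ L @ d # M) * minor u (K @ c # L @ M @ [f, g])
            - minor u (a # b # K @ c # L @ M) * minor u (K @ L @ d # M @ [f, g])"]
       reg_diff reg_mult reg_minor) (simp_all add: minor_def)

lemma map_add_interval: "map (\<lambda>c. c + d) [a..<b] = [a + d..<b + (d::nat)]"
  by (induction b) auto

lemma map_mult_Suc: "map (\<lambda>c. c + l') (map (\<lambda>t. t * l') [a..<b]) = map (\<lambda>t. t * l') [a + 1..<b + 1]"
  by (simp add: map_Suc_upt[symmetric] add.commute del: upt_Suc)

text \<open>The variables of one exchange relation belong to different \<open>j\<close>, so their
  columns sit at different places. This lemma and \<open>X_down\<close> move them by
  \<open>l'\<close> until they share an interval and a list of multiples.\<close>

lemma X_up: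
  assumes "1 \<le> j" "j \<le> k" "1 \<le> i"
  shows "X j i u = minor u ([j * l' + i - j..<j * l' + i] @ map (\<lambda>t. t * l') [j + 1..<k + 1])"
proof -
  have "j \<le> (j - 1) * l' + i" using j_le assms by simp
  moreover have "(j - 1) * l' + i + l' = j * l' + i" using assms by (cases j) simp_all
  ultimately have A: "(j - 1) * l' + i - j + l' = j * l' + i - j" "(j - 1) * l' + i + l' = j * l' + i"
    by linarith+
  have "map (\<lambda>c. c + l') (xcols j i) = [j * l' + i - j..<j * l' + i] @ map (\<lambda>t. t * l') [j + 1..<k + 1]"
    unfolding xcols_def map_append map_mult_Suc map_add_interval by (simp only: A)
  then show ?thesis using minor_shift[of "xcols j i" u] length_xcols assms by (simp add: X_def)
qed

text \<open>The last hypothesis keeps the interval among the nonnegative columns after it has been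
  moved down by \<open>l'\<close>.\<close>

lemma X_down:
  assumes "1 \<le> j" "j < k" "1 \<le> i" "j + 1 \<le> (j - 1) * l' + i"
  shows "X (j + 1) i u = minor u ([(j - 1) * l' + i - (j + 1)..<(j - 1) * l' + i] @ map (\<lambda>t. t * l') [j..<k - 1])"
    (is "_ = minor u ?cs")
proof -
  have A: "(j - 1) * l' + i + l' = j * l' + i" using assms by (cases j) simp_all
  then have B: "(j - 1) * l' + i - (j + 1) + l' = j * l' + i - (j + 1)" using assms by linarith
  have "k - 1 + 1 = k" "j + 1 - 1 = j" using assms by auto
  then have "xcols (j + 1) i = map (\<lambda>c. c + l') ?cs"
    unfolding xcols_def map_append map_mult_Suc map_add_interval by (simp only: A B)
  moreover have "length ?cs = k" using assms by simp
  ultimately show ?thesis using minor_shift[of ?cs u] by (simp add: X_def)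
qed

lemma upt_split:
  assumes "j < (k::nat)"
  shows "[j..<k] = [j..<k - 1] @ [k - 1]" "[j..<k + 1] = [j..<k - 1] @ [k - 1, k]"
  using assms by (cases k; simp)+

text \<open>The intervals of the two six-column exchange relations, cut along a common middle block
  \<open>K\<close> so that the block identity applies literally.\<close>

lemma upt_blocks:
  fixes a w :: nat
  defines "K \<equiv> [a + 2..<a + w + 2]"
  shows "[a + 1..<a + w + 2] = (a + 1) # K" "[a..<a + w + 2] = a # (a + 1) # K"
    "[a + 2..<a + w + 3] = K @ [a + w + 2]" "[a + 1..<a + w + 3] = (a + 1) # K @ [a + w + 2]"
    "[a..<a + w + 3] = a # (a + 1) # K @ [a + w + 2]"
    "[a + 2..<a + w + 4] = K @ [a + w + 2, a + w + 3]"
    "[a + 1..<a + w + 4] = (a + 1) # K @ [a + w + 2, a + w + 3]"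
    "[a..<a + w + 4] = a # (a + 1) # K @ [a + w + 2, a + w + 3]"
    "[a + 2..<a + w + 5] = K @ [a + w + 2, a + w + 3, a + w + 4]"
    "[a + 1..<a + w + 5] = (a + 1) # K @ [a + w + 2, a + w + 3, a + w + 4]"
proof -
  have suc: "w + 3 = Suc (w + 2)" "w + 4 = Suc (Suc (w + 2))" "w + 5 = Suc (Suc (Suc (w + 2)))" for w :: nat
    by simp_all
  have K: "[a + 1..<a + w + 2] = (a + 1) # K" "[a..<a + w + 2] = a # (a + 1) # K"
    unfolding K_def by (simp_all add: upt_conv_Cons del: upt_Suc)
  show "[a + 1..<a + w + 2] = (a + 1) # K" "[a..<a + w + 2] = a # (a + 1) # K" by (fact K)+
  show "[a + 2..<a + w + 3] = K @ [a + w + 2]" "[a + 1..<a + w + 3] = (a + 1) # K @ [a + w + 2]"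
    "[a..<a + w + 3] = a # (a + 1) # K @ [a + w + 2]"
    "[a + 2..<a + w + 4] = K @ [a + w + 2, a + w + 3]"
    "[a + 1..<a + w + 4] = (a + 1) # K @ [a + w + 2, a + w + 3]"
    "[a..<a + w + 4] = a # (a + 1) # K @ [a + w + 2, a + w + 3]"
    "[a + 2..<a + w + 5] = K @ [a + w + 2, a + w + 3, a + w + 4]"
    "[a + 1..<a + w + 5] = (a + 1) # K @ [a + w + 2, a + w + 3, a + w + 4]"
    unfolding suc using K by (simp_all add: K_def)
qed

text \<open>In \<open>exchange3\<close> the columns \<open>b = a + 1\<close> and
  \<open>c = a + w + 2\<close> are the ends of the interval of \<open>X j i\<close>,
  \<open>a\<close> and \<open>d\<close> are its outer neighbours, \<open>f\<close> and
  \<open>g\<close> are the multiples \<open>(k - 1) * l'\<close> and \<open>k * l'\<close>, and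
  \<open>L\<close> is empty.\<close>

lemma exchange_inner:
  assumes "2 \<le> j" "j < k" "2 \<le> i" "i < l'"
  shows "\<exists>y\<in>reg. \<forall>u. X j i u * y u = X j (i + 1) u * X (j - 1) (i - 1) u * X (j + 1) i u
       + X (j + 1) (i + 1) u * X j (i - 1) u * X (j - 1) i u"
proof -
  define M where "M = map (\<lambda>t. t * l') [j..<k - 1]"
  define f g where "f = (k - 1) * l'" and "g = k * l'"
  obtain w where w: "j = w + 2" using assms(1) nat_le_iff_add by (metis add.commute)
  have "j + 1 \<le> (j - 1) * l' + i" using j_le[of "i - 1" j] assms by linarith
  then obtain a where "(j - 1) * l' + i = (j + 1) + a" unfolding nat_le_iff_add by blast
  then have e: "(j - 1) * l' + i = a + w + 3" using w by simp
  have tail: "map (\<lambda>t. t * l') [j..<k] = M @ [f]" "map (\<lambda>t. t * l') [j..<k + 1] = M @ [f, g]"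
    using assms by (simp_all only: upt_split M_def f_def g_def) simp_all
  define K where "K = [a + 2..<a + w + 2]"
  have len: "length K + length [] + length M + 3 = k" using assms w by (simp add: M_def K_def del: upt_Suc)
  note iv = upt_blocks[of a w, folded K_def]
  have e': "(j - 1) * l' + (i + 1) = a + w + 4" "(j - 1) * l' + (i - 1) = a + w + 2" "j - 1 + 1 = j"
    using assms e by auto
  have d: "a + w + 3 - j = a + 1" "a + w + 4 - j = a + 2" "a + w + 2 - (j - 1) = a + 1" "a + w + 3 - (j + 1) = a"
    "a + w + 4 - (j + 1) = a + 1" "a + w + 2 - j = a" "a + w + 3 - (j - 1) = a + 2"
    using w by simp_all
  have up: "1 \<le> j - 1" "j - 1 \<le> k" "1 \<le> i - 1" "1 \<le> i" using assms by auto
  have down: "1 \<le> j" "j < k" "1 \<le> i" "j + 1 \<le> (j - 1) * l' + i" "1 \<le> i + 1" "j + 1 \<le> (j - 1) * l' + (i + 1)"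
    using assms e w by auto
  have "X j i u = minor u ((a + 1) # K @ (a + w + 2) # [] @ M @ [f])"
    "X j (i + 1) u = minor u (K @ (a + w + 2) # [] @ (a + w + 3) # M @ [f])"
    "X (j - 1) (i - 1) u = minor u ((a + 1) # K @ [] @ M @ [f, g])"
    "X (j + 1) i u = minor u (a # (a + 1) # K @ (a + w + 2) # [] @ M)"
    "X (j + 1) (i + 1) u = minor u ((a + 1) # K @ (a + w + 2) # [] @ (a + w + 3) # M)"
    "X j (i - 1) u = minor u (a # (a + 1) # K @ [] @ M @ [f])"
    "X (j - 1) i u = minor u (K @ (a + w + 2) # [] @ M @ [f, g])" for u
    unfolding X_up[OF up(1,2,3)] X_up[OF up(1,2,4)] X_down[OF down(1-4)] X_down[OF down(1,2,5,6)]
    unfolding X_def xcols_def e e' d iv tail M_def[symmetric]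
    by (simp_all only: append.simps append_assoc)
  then show ?thesis using exchange3[OF len] by simp
qed

text \<open>For \<open>i = 1\<close> the preceding index lies in the row below, at position
  \<open>l' - 1\<close>. The column \<open>(j - 1) * l'\<close> is both the right end of the
  interval of \<open>X j 1\<close> and one of the multiples listed for smaller \<open>j\<close>;
  being common to all seven lists, it forms the block \<open>L\<close>.\<close>

lemma exchange_first:
  assumes "3 \<le> j" "j < k"
  shows "\<exists>y\<in>reg. \<forall>u. X j 1 u * y u = X j 2 u * X (j - 2) (l' - 1) u * X (j + 1) 1 u
       + X (j + 1) 2 u * X (j - 1) (l' - 1) u * X (j - 1) 1 u"
proof -
  define M where "M = map (\<lambda>t. t * l') [j..<k - 1]"
  define f g where "f = (k - 1) * l'" and "g = k * l'"
  obtain w where w: "j = w + 3" using assms(1) nat_le_iff_add by (metis add.commute)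
  have "(j - 1) * 2 \<le> (j - 1) * l'" using l'2 by (intro mult_le_mono2)
  then have "j + 1 \<le> (j - 1) * l' + 1" using assms by linarith
  then obtain a where "(j - 1) * l' + 1 = (j + 1) + a" unfolding nat_le_iff_add by blast
  then have e: "(j - 1) * l' + 1 = a + w + 4" using w by simp
  have tail: "map (\<lambda>t. t * l') [j..<k] = M @ [f]" "map (\<lambda>t. t * l') [j..<k + 1] = M @ [f, g]"
    using assms by (simp_all only: upt_split M_def f_def g_def) simp_all
  \<comment> \<open>Exhibits the common column \<open>a + w + 3 = (j - 1) * l'\<close> at the head
    of the longer lists of multiples.\<close>
  have "map (\<lambda>t. t * l') [j - 1..<m] = (a + w + 3) # map (\<lambda>t. t * l') [j..<m]" if "j \<le> m" for m
  proof -
    have "[j - 1..<m] = (j - 1) # [Suc (j - 1)..<m]" using that assms by (intro upt_conv_Cons) linarith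
    moreover have "Suc (j - 1) = j" "(j - 1) * l' = a + w + 3" using e assms by linarith+
    ultimately show ?thesis by (simp only: list.map)
  qed
  then have tail': "map (\<lambda>t. t * l') [j - 1..<k] = (a + w + 3) # M @ [f]"
    "map (\<lambda>t. t * l') [j - 1..<k + 1] = (a + w + 3) # M @ [f, g]"
    using assms tail by simp_all
  define K where "K = [a + 2..<a + w + 2]"
  have len: "length K + length [a + w + 3] + length M + 3 = k" using assms w by (simp add: M_def K_def del: upt_Suc)
  note iv = upt_blocks[of a w, folded K_def]
  have "(j - 2) * l' + l' = (j - 1) * l'" using w by (simp add: algebra_simps)
  then have e': "(j - 1) * l' + 2 = a + w + 5" "(j - 2) * l' + (l' - 1) = a + w + 2" "j - 1 - 1 = j - 2"
    "j - 2 + 1 = j - 1" "j - 1 + 1 = j"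
    using assms(1) e l'2 by linarith+
  have d: "a + w + 4 - j = a + 1" "a + w + 5 - j = a + 2" "a + w + 2 - (j - 2) = a + 1" "a + w + 4 - (j + 1) = a"
    "a + w + 5 - (j + 1) = a + 1" "a + w + 2 - (j - 1) = a" "a + w + 4 - (j - 1) = a + 2"
    using w by simp_all
  have up: "1 \<le> j - 2" "j - 2 \<le> k" "1 \<le> l' - 1" "1 \<le> j - 1" "j - 1 \<le> k" "1 \<le> (1::nat)" using assms l'2 by linarith+
  have down: "1 \<le> j" "j < k" "1 \<le> (1::nat)" "j + 1 \<le> (j - 1) * l' + 1" "1 \<le> (2::nat)" "j + 1 \<le> (j - 1) * l' + 2"
    using assms e w by linarith+
  have "X j 1 u = minor u ((a + 1) # K @ (a + w + 2) # [a + w + 3] @ M @ [f])"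
    "X j 2 u = minor u (K @ (a + w + 2) # [a + w + 3] @ (a + w + 4) # M @ [f])"
    "X (j - 2) (l' - 1) u = minor u ((a + 1) # K @ [a + w + 3] @ M @ [f, g])"
    "X (j + 1) 1 u = minor u (a # (a + 1) # K @ (a + w + 2) # [a + w + 3] @ M)"
    "X (j + 1) 2 u = minor u ((a + 1) # K @ (a + w + 2) # [a + w + 3] @ (a + w + 4) # M)"
    "X (j - 1) (l' - 1) u = minor u (a # (a + 1) # K @ [a + w + 3] @ M @ [f])"
    "X (j - 1) 1 u = minor u (K @ (a + w + 2) # [a + w + 3] @ M @ [f, g])" for u
    unfolding X_up[OF up(1,2,3)] X_up[OF up(4,5,6)] X_down[OF down(1-4)] X_down[OF down(1,2,5,6)]
    unfolding X_def xcols_def e e' d iv tail tail' M_def[symmetric]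
    by (simp_all only: append.simps append_assoc)
  then show ?thesis using exchange3[OF len] by simp
qed

text \<open>For \<open>j = 1\<close> the interval is a single column, and the three-term relation
  suffices.\<close>

lemma exchange_bottom:
  assumes "2 \<le> i" "i < l'"
  shows "\<exists>y\<in>reg. \<forall>u. X 1 i u * y u = X 1 (i + 1) u * X 2 i u + X 2 (i + 1) u * X 1 (i - 1) u"
proof -
  define M where "M = map (\<lambda>t. t * l') [1..<k - 1]"
  define f where "f = (k - 1) * l'"
  obtain a where a: "i = a + 2" using assms nat_le_iff_add by (metis add.commute)
  have tail: "map (\<lambda>t. t * l') [1..<k] = M @ [f]"
    using k2 by (simp only: upt_split M_def f_def) simp
  have 1: "X 1 i u = minor u ((a + 1) # [] @ M @ [f])"
    and 2: "X 1 (i + 1) u = minor u ([] @ (a + 2) # M @ [f])"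
    and 6: "X 1 (i - 1) u = minor u (a # [] @ M @ [f])" for u
    unfolding X_def xcols_def tail by (simp_all add: a upt_conv_Cons)
  have 4: "X 2 i u = minor u (a # (a + 1) # [] @ M)"
    and 5: "X 2 (i + 1) u = minor u ((a + 1) # [] @ (a + 2) # M)" for u
    using k2 X_down[of 1 i u] X_down[of 1 "i + 1" u] unfolding M_def[symmetric]
    by (simp_all add: a upt_conv_Cons numeral_2_eq_2 numeral_3_eq_3)
  show ?thesis unfolding 1 2 4 5 6
    by (rule exchange2) (use k2 in \<open>simp add: M_def\<close>)
qed

text \<open>This is the index \<open>m = l'\<close>. All lists contain the column \<open>l'\<close>,
  which plays the role of \<open>L\<close>, and again three terms suffice.\<close>

lemma exchange_corner:
  assumes "2 < k"
  shows "\<exists>y\<in>reg. \<forall>u. X 2 1 u * y u = X 2 2 u * X 3 1 u + X 3 2 u * X 1 (l' - 1) u"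
proof -
  define M where "M = map (\<lambda>t. t * l') [2..<k - 1]"
  define f where "f = (k - 1) * l'"
  obtain a where a: "l' = a + 2" using l'2 nat_le_iff_add by (metis add.commute)
  have tail: "map (\<lambda>t. t * l') [2..<k] = M @ [f]"
    using assms by (simp only: upt_split M_def f_def) simp
  then have tail': "map (\<lambda>t. t * l') [1..<k] = (a + 2) # M @ [f]"
    using assms a upt_conv_Cons[of 1 k] by (simp add: numeral_2_eq_2)
  have 1: "X 2 1 u = minor u ((a + 1) # [a + 2] @ M @ [f])"
    and 2: "X 2 2 u = minor u ([a + 2] @ (a + 3) # M @ [f])" for u
    unfolding X_def xcols_def tail by (simp_all add: a upt_conv_Cons numeral_2_eq_2 numeral_3_eq_3)
  have 6: "X 1 (l' - 1) u = minor u (a # [a + 2] @ M @ [f])" for u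
    unfolding X_def xcols_def tail' by (simp_all add: a upt_conv_Cons)
  have 4: "X 3 1 u = minor u (a # (a + 1) # [a + 2] @ M)"
    and 5: "X 3 2 u = minor u ((a + 1) # [a + 2] @ (a + 3) # M)" for u
    using assms X_down[of 2 1 u] X_down[of 2 2 u] unfolding M_def[symmetric]
    by (simp_all add: a upt_conv_Cons numeral_2_eq_2 numeral_3_eq_3)
  show ?thesis unfolding 1 2 4 5 6
    by (rule exchange2) (use assms in \<open>simp add: M_def\<close>)
qed

lemma position_cases:
  assumes "1 \<le> m" "m \<le> num_mutable k l'"
  obtains j i where "m = (j - 1) * (l' - 1) + i" "1 \<le> j" "j < k" "1 \<le> i" "i < l'"
proof -
  define q r where "q = (m - 1) div (l' - 1)" and "r = (m - 1) mod (l' - 1)"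
  have "m - 1 = q * (l' - 1) + r" by (simp only: q_def r_def div_mult_mod_eq)
  moreover have "r < l' - 1" using l'2 by (simp add: r_def)
  moreover have "q < k - 1"
    unfolding q_def using assms l'2 by (subst div_less_iff_less_mult) (auto simp: num_mutable_def)
  ultimately show ?thesis using assms by (intro that[of "q + 1" "r + 1"]) auto
qed

text \<open>A step in \<open>i\<close> changes the index by 1, a step in \<open>j\<close> by
  \<open>l' - 1\<close>. The factors guarded by \<open>l' < m\<close> come from the quiver triangle
  numbered \<open>m - l'\<close>, which exists only then.\<close>

lemma exchange:
  assumes "2 \<le> m" "m \<le> num_mutable k l'"
  shows "\<exists>y\<in>reg. \<forall>u. x m u * y u = x (m + 1) u * x (m + l' - 1) u * (if l' < m then x (m - l') u else 1)
       + x (m + l') u * x (m - 1) u * (if l' < m then x (m - l' + 1) u else 1)"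
proof -
  obtain j i where m: "m = (j - 1) * (l' - 1) + i" and ji: "1 \<le> j" "j < k" "1 \<le> i" "i < l'"
    using position_cases[of m] assms by auto
  obtain j' where j': "j = j' + 1" using ji(1) nat_le_iff_add by (metis add.commute)
  obtain h where h: "l' = h + 1" "1 \<le> h" using l'2 by (intro that[of "l' - 1"]) auto
  have xX: "x ((j - 1) * (l' - 1) + i) = X j i" if "1 \<le> j" "j \<le> k" "1 \<le> i" "i \<le> l'" for i j
    using x_eq_X that by simp
  have pos: "m + 1 = (j - 1) * (l' - 1) + (i + 1)" "m + l' - 1 = (j + 1 - 1) * (l' - 1) + i"
    "m + l' = (j + 1 - 1) * (l' - 1) + (i + 1)"
    unfolding m by (simp_all add: j' h)
  have 1: "x m = X j i" "x (m + 1) = X j (i + 1)" "x (m + l' - 1) = X (j + 1) i" "x (m + l') = X (j + 1) (i + 1)"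
    by (subst m, rule xX; use ji in force) (subst pos, rule xX; use ji in force)+
  consider "j = 1" "2 \<le> i" | "j = 2" "i = 1" | "3 \<le> j" "i = 1" | "2 \<le> j" "2 \<le> i"
    using ji(1,3) m assms(1) by (cases "j = 1"; cases "i = 1"; cases "j = 2") auto
  then show ?thesis
  proof cases
    case c1: 1
    then have mi: "m = i" using m by simp
    have "x (m - 1) = X 1 (i - 1)" using xX[of 1 "i - 1"] ji c1 by (simp add: mi)
    moreover obtain y where "y \<in> reg" "\<forall>u. X 1 i u * y u = X 1 (i + 1) u * X 2 i u + X 2 (i + 1) u * X 1 (i - 1) u"
      using exchange_bottom[of i] ji c1 by blast
    ultimately show ?thesis using ji c1 unfolding 1 by (intro bexI[of _ y]) (simp_all add: mi numeral_2_eq_2)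
  next
    case 2
    then have ml: "m = l'" using m l'2 by simp
    have "x (l' - 1) = X 1 (l' - 1)" using xX[of 1 "l' - 1"] l'2 k2 by simp
    moreover obtain y where "y \<in> reg" "\<forall>u. X 2 1 u * y u = X 2 2 u * X 3 1 u + X 3 2 u * X 1 (l' - 1) u"
      using exchange_corner ji 2 by blast
    ultimately show ?thesis using 2 unfolding 1 by (intro bexI[of _ y]) (simp_all add: ml numeral_2_eq_2 numeral_3_eq_3)
  next
    case 3
    obtain t where t: "j = t + 3" using 3(1) nat_le_iff_add by (metis add.commute)
    have pos': "m - 1 = (j - 1 - 1) * (l' - 1) + (l' - 1)" "m - l' + 1 = (j - 1 - 1) * (l' - 1) + 1"
      "m - l' = (j - 2 - 1) * (l' - 1) + (l' - 1)" "l' < m"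
      unfolding m 3(2) using h(2) by (simp_all add: t h(1))
    have 2: "x (m - 1) = X (j - 1) (l' - 1)" "x (m - l' + 1) = X (j - 1) 1" "x (m - l') = X (j - 2) (l' - 1)"
      by (subst pos', rule xX; use ji 3 l'2 in force)+
    obtain y where "y \<in> reg" "\<forall>u. X j 1 u * y u = X j 2 u * X (j - 2) (l' - 1) u * X (j + 1) 1 u
       + X (j + 1) 2 u * X (j - 1) (l' - 1) u * X (j - 1) 1 u"
      using exchange_first[of j] ji 3 by blast
    then show ?thesis using pos'(4) unfolding 1 2 3(2) one_add_one by (intro bexI[of _ y]) (simp_all add: mult_ac)
  next
    case 4
    obtain t where t: "j = t + 2" using 4(1) nat_le_iff_add by (metis add.commute)
    have pos': "m - 1 = (j - 1) * (l' - 1) + (i - 1)" "m - l' + 1 = (j - 1 - 1) * (l' - 1) + i"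
      "m - l' = (j - 1 - 1) * (l' - 1) + (i - 1)" "l' < m"
      unfolding m using 4(2) by (simp_all add: t h(1))
    have 2: "x (m - 1) = X j (i - 1)" "x (m - l' + 1) = X (j - 1) i" "x (m - l') = X (j - 1) (i - 1)"
      by (subst pos', rule xX; use ji 4 in force)+
    obtain y where "y \<in> reg" "\<forall>u. X j i u * y u = X j (i + 1) u * X (j - 1) (i - 1) u * X (j + 1) i u
       + X (j + 1) (i + 1) u * X j (i - 1) u * X (j - 1) i u"
      using exchange_inner[of j i] ji 4 by blast
    then show ?thesis using pos'(4) unfolding 1 2 by (intro bexI[of _ y]) (simp_all add: mult_ac)
  qed
qed

end

section \<open>Monomials as regular functions and the first exchange relation\<close>

lemma bracket_expand:
  "bracket k xs = (\<Sum>\<sigma> | \<sigma> permutes {..<k}. signof \<sigma> * (\<Prod>i<k. (xs ! i) (\<sigma> i)))"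
proof -
  have "bracket k xs = (\<Sum>\<sigma> | \<sigma> permutes {..<k}. signof \<sigma> * (\<Prod>i<k. mat k k (\<lambda>(r, i). (xs ! i) r) $$ (\<sigma> i, i)))"
    unfolding bracket_def lessThan_atLeast0 by (subst det_col[of _ k]) (auto simp: lessThan_atLeast0)
  also have "\<dots> = (\<Sum>\<sigma> | \<sigma> permutes {..<k}. signof \<sigma> * (\<Prod>i<k. (xs ! i) (\<sigma> i)))"
  proof (intro sum.cong refl arg_cong2[of _ _ _ _ "(*)"] prod.cong)
    fix \<sigma> i assume "\<sigma> \<in> {\<sigma>. \<sigma> permutes {..<k}}" "i \<in> {..<k}"
    then have "\<sigma> i < k" "i < k" using permutes_in_image[of \<sigma> "{..<k}" i] by simp_all
    then show "mat k k (\<lambda>(r, i). (xs ! i) r) $$ (\<sigma> i, i) = (xs ! i) (\<sigma> i)" by simp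
  qed
  finally show ?thesis .
qed

context cyclic_setup
begin

text \<open>All \<open>zeta r\<close> have the same p-th power, so the ratio is a p-th root of
  unity, different from 1 unless \<open>s = r\<close>.\<close>

lemma sum_zeta_ratio:
  assumes "r < k" "s < k"
  shows "(\<Sum>t<p. (zeta s / zeta r) ^ t) = (if s = r then of_nat p else 0)"
proof (cases "s = r")
  case False
  then have "zeta s / zeta r \<noteq> 1" using assms zeta_inj by (auto simp: inj_on_def)
  then have "(\<Sum>t<p. (zeta s / zeta r) ^ t) = ((zeta s / zeta r) ^ p - 1) / (zeta s / zeta r - 1)"
    by (rule geometric_sum)
  also have "(zeta s / zeta r) ^ p = 1" by (simp add: power_divide zeta_pow_p)
  finally show ?thesis using False by simp
qed simp

text \<open>Fourier inversion on the cyclic group of order \<open>p\<close>, applied to each row separately, isolates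
  the diagonal term of the determinant.\<close>

lemma reg_multilinear:
  assumes a: "\<And>r. r < k \<Longrightarrow> a r < l'"
  shows "(\<lambda>u. \<Prod>r<k. u r (a r)) \<in> reg"
proof -
  let ?T = "{..<k} \<rightarrow>\<^sub>E {..<p}"
  let ?S = "{\<sigma>. \<sigma> permutes {..<k}}"
  let ?cs = "\<lambda>t. map (\<lambda>i. a i + t i * l') [0..<k]"
  have "(\<Sum>t\<in>?T. (\<Prod>i<k. (1 / zeta i) ^ t i) * minor u (?cs t)) = of_nat p ^ k * (\<Prod>r<k. u r (a r))" for u
  proof -
    have m: "minor u (?cs t) = (\<Sum>\<sigma>\<in>?S. signof \<sigma> * (\<Prod>i<k. zeta (\<sigma> i) ^ t i * u (\<sigma> i) (a i)))" for t
      unfolding minor_def bracket_expand using a l'2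
      by (intro sum.cong refl arg_cong2[of _ _ _ _ "(*)"] prod.cong) (auto simp: col_def)
    have "(\<Sum>t\<in>?T. (\<Prod>i<k. (1 / zeta i) ^ t i) * minor u (?cs t))
        = (\<Sum>t\<in>?T. \<Sum>\<sigma>\<in>?S. signof \<sigma> * (\<Prod>i<k. (zeta (\<sigma> i) / zeta i) ^ t i * u (\<sigma> i) (a i)))"
      unfolding m sum_distrib_left
      by (intro sum.cong refl) (simp add: prod.distrib prod_dividef power_divide)
    also have "\<dots> = (\<Sum>\<sigma>\<in>?S. signof \<sigma> * (\<Sum>t\<in>?T. \<Prod>i<k. (zeta (\<sigma> i) / zeta i) ^ t i * u (\<sigma> i) (a i)))"
      unfolding sum_distrib_left by (rule sum.swap)
    also have "\<dots> = (\<Sum>\<sigma>\<in>?S. signof \<sigma> * (\<Prod>i<k. \<Sum>t<p. (zeta (\<sigma> i) / zeta i) ^ t * u (\<sigma> i) (a i)))"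
      by (subst prod_sum_PiE) auto
    also have "\<dots> = (\<Sum>\<sigma>\<in>?S. if \<sigma> = id then of_nat p ^ k * (\<Prod>r<k. u r (a r)) else 0)"
    proof (rule sum.cong[OF refl])
      fix \<sigma> assume \<sigma>: "\<sigma> \<in> ?S"
      have \<sigma>k: "\<sigma> i < k" if "i < k" for i using \<sigma> that permutes_in_image[of \<sigma> "{..<k}" i] by simp
      have "(\<Prod>i<k. \<Sum>t<p. (zeta (\<sigma> i) / zeta i) ^ t * u (\<sigma> i) (a i))
          = (\<Prod>i<k. (if \<sigma> i = i then of_nat p else 0) * u (\<sigma> i) (a i))"
        using \<sigma>k by (intro prod.cong refl) (simp add: sum_zeta_ratio flip: sum_distrib_right)
      also have "\<dots> = (if \<sigma> = id then of_nat p ^ k * (\<Prod>r<k. u r (a r)) else 0)"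
      proof (cases "\<sigma> = id")
        case False
        then obtain i where "\<sigma> i \<noteq> i" by (auto simp: fun_eq_iff)
        moreover from this have "i < k" using \<sigma> by (auto simp: permutes_def)
        ultimately have "\<exists>i\<in>{..<k}. (if \<sigma> i = i then of_nat p else 0) * u (\<sigma> i) (a i) = 0" by auto
        then have "(\<Prod>i<k. (if \<sigma> i = i then of_nat p else 0) * u (\<sigma> i) (a i)) = 0"
          by (intro prod_zero) auto
        then show ?thesis using False by simp
      qed (simp add: prod.distrib)
      finally have "(\<Prod>i<k. \<Sum>t<p. (zeta (\<sigma> i) / zeta i) ^ t * u (\<sigma> i) (a i))
        = (if \<sigma> = id then of_nat p ^ k * (\<Prod>r<k. u r (a r)) else 0)" .
      then show "signof \<sigma> * (\<Prod>i<k. \<Sum>t<p. (zeta (\<sigma> i) / zeta i) ^ t * u (\<sigma> i) (a i))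
          = (if \<sigma> = id then of_nat p ^ k * (\<Prod>r<k. u r (a r)) else 0)"
        by simp
    qed
    also have "\<dots> = of_nat p ^ k * (\<Prod>r<k. u r (a r))"
      by (simp add: finite_permutations permutes_id)
    finally show ?thesis .
  qed
  then have "(\<lambda>u. \<Prod>r<k. u r (a r)) = (\<lambda>u. (1 / of_nat p ^ k) *
      (\<Sum>t\<in>?T. (\<Prod>i<k. (1 / zeta i) ^ t i) * minor u (?cs t)))"
    using p_pos by (simp add: fun_eq_iff)
  also have "\<dots> \<in> reg" by (intro reg_mult reg_sum reg_const reg_minor) simp
  finally show ?thesis .
qed

text \<open>Equal degree \<open>D\<close> in all rows allows a splitting into \<open>D\<close>
  multilinear monomials: factor \<open>i\<close> takes entry 1 in exactly those rows
  \<open>s\<close> with \<open>i < c s\<close>, and entry 0 in the others.\<close>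

lemma reg_monomial:
  assumes "\<And>s. s < k \<Longrightarrow> c s \<le> D"
  shows "(\<lambda>u. \<Prod>s<k. u s 1 ^ c s * u s 0 ^ (D - c s)) \<in> reg"
proof -
  have pow: "(\<Prod>i<D. if i < e then A else B) = A ^ e * B ^ (D - e)" if "e \<le> D" for A B :: complex and e
  proof -
    have "{..<D} \<inter> {i. i < e} = {..<e}" "{..<D} \<inter> - {i. i < e} = {e..<D}" using that by auto
    then show ?thesis by (simp add: prod.If_cases)
  qed
  have "(\<lambda>u :: nat \<Rightarrow> nat \<Rightarrow> complex. \<Prod>s<k. u s 1 ^ c s * u s 0 ^ (D - c s)) = (\<lambda>u. \<Prod>i<D. \<Prod>s<k. u s (if i < c s then 1 else 0))"
  proof
    fix u :: "nat \<Rightarrow> nat \<Rightarrow> complex"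
    have "(\<Prod>s<k. u s 1 ^ c s * u s 0 ^ (D - c s)) = (\<Prod>s<k. \<Prod>i<D. if i < c s then u s 1 else u s 0)"
      using assms by (intro prod.cong refl) (simp add: pow)
    also have "\<dots> = (\<Prod>i<D. \<Prod>s<k. u s (if i < c s then 1 else 0))"
      by (subst prod.swap) (simp add: if_distrib)
    finally show "(\<Prod>s<k. u s 1 ^ c s * u s 0 ^ (D - c s)) = (\<Prod>i<D. \<Prod>s<k. u s (if i < c s then 1 else 0))" .
  qed
  also have "\<dots> \<in> reg" using l'2 by (intro reg_prod reg_multilinear) auto
  finally show ?thesis .
qed

text \<open>The cofactor of the entry in row \<open>j\<close> and column 0 of the Vandermonde matrix
  of the \<open>zeta r\<close>.\<close>

definition alpha :: "nat \<Rightarrow> complex" where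
  "alpha j = (\<Sum>\<sigma> | \<sigma> permutes {..<k} \<and> \<sigma> 0 = j. signof \<sigma> * (\<Prod>i = 1..<k. zeta (\<sigma> i) ^ i))"

text \<open>Every row except the one that the first column selects contributes its factor
  \<open>u s 0\<close>, and a Vandermonde cofactor is left.\<close>

lemma bracket_alpha:
  "bracket k (g # map (\<lambda>i r. zeta r ^ i * u r 0) [1..<k])
     = (\<Sum>j<k. alpha j * g j * (\<Prod>s\<in>{..<k} - {j}. u s (0::nat)))"
proof -
  let ?S = "{\<sigma>. \<sigma> permutes {..<k}}"
  let ?h = "\<lambda>\<sigma>. signof \<sigma> * (\<Prod>i = 1..<k. zeta (\<sigma> i) ^ i) * g (\<sigma> 0) * (\<Prod>s\<in>{..<k} - {\<sigma> 0}. u s 0)"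
  have "bracket k (g # map (\<lambda>i r. zeta r ^ i * u r 0) [1..<k]) = (\<Sum>\<sigma>\<in>?S. ?h \<sigma>)"
    unfolding bracket_expand
  proof (rule sum.cong[OF refl])
    fix \<sigma> assume "\<sigma> \<in> ?S"
    then have \<sigma>: "\<sigma> permutes {..<k}" by simp
    let ?xs = "g # map (\<lambda>i r. zeta r ^ i * u r 0) [1..<k]"
    have "{..<k} = insert 0 {1..<k}" using k2 by auto
    then have "(\<Prod>i<k. (?xs ! i) (\<sigma> i)) = g (\<sigma> 0) * (\<Prod>i = 1..<k. (?xs ! i) (\<sigma> i))" by simp
    also have "(\<Prod>i = 1..<k. (?xs ! i) (\<sigma> i)) = (\<Prod>i = 1..<k. zeta (\<sigma> i) ^ i * u (\<sigma> i) 0)"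
      by (intro prod.cong refl) (auto simp: nth_Cons')
    also have "\<dots> = (\<Prod>i = 1..<k. zeta (\<sigma> i) ^ i) * (\<Prod>i = 1..<k. u (\<sigma> i) 0)" by (rule prod.distrib)
    also have "(\<Prod>i = 1..<k. u (\<sigma> i) 0) = (\<Prod>s\<in>{..<k} - {\<sigma> 0}. u s 0)"
    proof (rule prod.reindex_bij_betw)
      have "\<sigma> ` {1..<k} = \<sigma> ` ({..<k} - {0})" by (intro arg_cong2[of _ _ _ _ image]) auto
      also have "\<dots> = {..<k} - {\<sigma> 0}"
        using permutes_image[OF \<sigma>] permutes_inj[OF \<sigma>] by (simp add: image_set_diff)
      finally show "bij_betw \<sigma> {1..<k} ({..<k} - {\<sigma> 0})"
        using permutes_inj[OF \<sigma>] by (auto simp: bij_betw_def intro: inj_on_subset)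
    qed
    finally show "signof \<sigma> * (\<Prod>i<k. (?xs ! i) (\<sigma> i)) = ?h \<sigma>" by (simp add: mult_ac)
  qed
  also have "\<dots> = (\<Sum>j<k. \<Sum>\<sigma> | \<sigma> \<in> ?S \<and> \<sigma> 0 = j. ?h \<sigma>)"
    using k2 permutes_in_image[of _ "{..<k}" 0]
    by (intro sum.group[symmetric]) (auto simp: finite_permutations)
  also have "\<dots> = (\<Sum>j<k. alpha j * g j * (\<Prod>s\<in>{..<k} - {j}. u s 0))"
    unfolding alpha_def by (intro sum.cong refl) (simp add: sum_distrib_right)
  finally show ?thesis .
qed

lemma col_mult [simp]: "col u (t * l') = (\<lambda>r. zeta r ^ t * u r 0)"
  using l'2 by (simp add: col_def)

lemma x_1: "x 1 u = (\<Sum>j<k. alpha j) * (\<Prod>s<k. u s 0)"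
proof -
  have "x 1 = X 1 1" using x_eq_X[of 1 1] k2 l'2 by simp
  then have "x 1 u = bracket k ((\<lambda>r. u r 0) # map (\<lambda>i r. zeta r ^ i * u r 0) [1..<k])"
    using col_mult[of u 0] by (simp add: X_def xcols_def minor_def comp_def)
  also have "\<dots> = (\<Sum>j<k. alpha j * (u j 0 * (\<Prod>s\<in>{..<k} - {j}. u s 0)))"
    using bracket_alpha[of "\<lambda>r. u r 0" u] by (simp add: mult.assoc)
  also have "\<dots> = (\<Sum>j<k. alpha j * (\<Prod>s<k. u s 0))"
  proof (rule sum.cong[OF refl])
    fix j assume "j \<in> {..<k}"
    then show "alpha j * (u j 0 * (\<Prod>s\<in>{..<k} - {j}. u s 0)) = alpha j * (\<Prod>s<k. u s 0)"
      by (subst prod.remove[of "{..<k}" j "\<lambda>s. u s 0"]) auto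
  qed
  finally show ?thesis by (simp add: sum_distrib_right)
qed

lemma x_2: "x 2 u = (\<Sum>j<k. alpha j * u j 1 * (\<Prod>s\<in>{..<k} - {j}. u s 0))"
proof -
  have "x 2 = X 1 2" using x_eq_X[of 1 2] k2 l'2 by (simp add: numeral_2_eq_2)
  moreover have "xcols 1 2 = 1 # map (\<lambda>t. t * l') [1..<k]" by (simp add: xcols_def numeral_2_eq_2)
  moreover have "col u 1 = (\<lambda>r. u r 1)" using l'2 by (simp add: col_def)
  ultimately have "x 2 u = bracket k ((\<lambda>r. u r 1) # map (\<lambda>i r. zeta r ^ i * u r 0) [1..<k])"
    by (simp add: X_def minor_def comp_def)
  then show ?thesis using bracket_alpha[of "\<lambda>r. u r 1" u] by simp
qed

text \<open>The list begins with the columns \<open>l'\<close> and \<open>l' + 1\<close>; bringing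
  the second to the front produces the sign and leaves the same remaining columns as for
  \<open>x 1\<close> and \<open>x 2\<close>.\<close>

lemma x_l'1: "x (l' + 1) u = - (\<Sum>j<k. alpha j * (zeta j * u j 1) * (\<Prod>s\<in>{..<k} - {j}. u s 0))"
proof -
  have "l' + 1 = (2 - 1) * (l' - 1) + 2" using l'2 by simp
  then have "x (l' + 1) = X 2 2" using x_eq_X[of 2 2] k2 l'2 by (simp only:)
  moreover have "xcols 2 2 = [1 * l', l' + 1] @ map (\<lambda>t. t * l') [2..<k]" by (simp add: xcols_def)
  moreover have "col u (l' + 1) = (\<lambda>r. zeta r * u r 1)"
    using l'2 col_shift[of u 1] by (simp add: col_def[of u "Suc 0"] add.commute)
  moreover have "[1..<k] = 1 # [2..<k]" using k2 by (simp add: upt_conv_Cons numeral_2_eq_2)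
  ultimately have "x (l' + 1) u = bracket k ([] @ (\<lambda>r. zeta r ^ 1 * u r 0) # (\<lambda>r. zeta r * u r 1)
        # map (\<lambda>i r. zeta r ^ i * u r 0) [2..<k])"
    using col_mult[of u 1] by (simp add: X_def minor_def comp_def)
  also have "\<dots> = - bracket k ([] @ (\<lambda>r. zeta r * u r 1) # (\<lambda>r. zeta r ^ 1 * u r 0)
        # map (\<lambda>i r. zeta r ^ i * u r 0) [2..<k])"
    using k2 by (intro bracket_swap) simp
  also have "\<dots> = - bracket k ((\<lambda>r. zeta r * u r 1) # map (\<lambda>i r. zeta r ^ i * u r 0) [1..<k])"
    using \<open>[1..<k] = 1 # [2..<k]\<close> by simp
  finally show ?thesis using bracket_alpha[of "\<lambda>r. zeta r * u r 1" u] by simp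
qed

lemma sum_alpha_nonzero: "(\<Sum>j<k. alpha j) \<noteq> 0"
proof -
  let ?u = "\<lambda>_ _. 1 :: complex"
  have "(\<Sum>j<k. alpha j) = bracket k ((\<lambda>_. 1) # map (\<lambda>i r. zeta r ^ i * ?u r (0::nat)) [1..<k])"
    using bracket_alpha[of "\<lambda>_. 1" ?u] by simp
  also have "\<dots> = Determinant.det (mat k k (\<lambda>(i, j). zeta i ^ j))"
    unfolding bracket_def by (intro arg_cong[of _ _ Determinant.det] eq_matI) (auto simp: nth_Cons')
  also have "\<dots> \<noteq> 0"
    using zeta_inj by (auto simp: det_vandermonde dest!: inj_onD[OF zeta_inj])
  finally show ?thesis .
qed

text \<open>The factors are counted by row \<open>s\<close> instead of by \<open>r\<close>: an
  \<open>r\<close> with \<open>J r = s\<close> gives \<open>u s 1\<close>, \<open>r = s\<close>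
  gives nothing, and any other \<open>r\<close> gives \<open>u s 0\<close>. So every row has degree
  \<open>k - 1\<close>, whatever \<open>J\<close> is.\<close>

lemma prod_offdiagonal:
  fixes u :: "nat \<Rightarrow> nat \<Rightarrow> complex"
  assumes J: "\<And>r. r < k \<Longrightarrow> J r < k \<and> J r \<noteq> r"
  shows "(\<Prod>r<k. u (J r) 1 * (\<Prod>s\<in>{..<k} - {J r, r}. u s 0))
    = (\<Prod>s<k. u s 1 ^ card {r. r < k \<and> J r = s} * u s 0 ^ (k - 1 - card {r. r < k \<and> J r = s}))"
proof -
  let ?w = "\<lambda>r s. if s = J r then u s 1 else if s = r then 1 else u s 0"
  have "u (J r) 1 * (\<Prod>s\<in>{..<k} - {J r, r}. u s 0) = (\<Prod>s<k. ?w r s)" if "r < k" for r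
  proof -
    have "(\<Prod>s<k. ?w r s) = ?w r (J r) * (?w r r * (\<Prod>s\<in>{..<k} - {J r} - {r}. ?w r s))"
      using that J[OF that] by (simp add: prod.remove[of _ "J r"] prod.remove[of _ r])
    also have "(\<Prod>s\<in>{..<k} - {J r} - {r}. ?w r s) = (\<Prod>s\<in>{..<k} - {J r, r}. u s 0)"
      by (rule prod.cong) auto
    finally show ?thesis using J[OF that] by auto
  qed
  then have "(\<Prod>r<k. u (J r) 1 * (\<Prod>s\<in>{..<k} - {J r, r}. u s 0)) = (\<Prod>r<k. \<Prod>s<k. ?w r s)"
    by simp
  also have "\<dots> = (\<Prod>s<k. \<Prod>r<k. ?w r s)" by (rule prod.swap)
  also have "\<dots> = (\<Prod>s<k. u s 1 ^ card {r. r < k \<and> J r = s} * u s 0 ^ (k - 1 - card {r. r < k \<and> J r = s}))"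
  proof (rule prod.cong[OF refl])
    fix s assume s: "s \<in> {..<k}"
    let ?A = "{r. r < k \<and> J r = s}"
    let ?B = "{..<k} - {s} - ?A"
    have Js: "J s \<noteq> s" using s J by simp
    have AB: "{..<k} = insert s (?A \<union> ?B)" using s by auto
    have "(\<Prod>r<k. ?w r s) = (\<Prod>r\<in>insert s (?A \<union> ?B). ?w r s)" by (rule prod.cong[OF AB refl])
    also have "\<dots> = ?w s s * (\<Prod>r\<in>?A \<union> ?B. ?w r s)"
      by (rule prod.insert) (use Js in auto)
    also have "(\<Prod>r\<in>?A \<union> ?B. ?w r s) = (\<Prod>r\<in>?A. ?w r s) * (\<Prod>r\<in>?B. ?w r s)"
      by (rule prod.union_disjoint) auto
    also have "?w s s = 1" using Js by simp
    also have "(\<Prod>r\<in>?A. ?w r s) = (\<Prod>r\<in>?A. u s 1)" by (rule prod.cong) auto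
    also have "(\<Prod>r\<in>?B. ?w r s) = (\<Prod>r\<in>?B. u s 0)" by (rule prod.cong) auto
    also have "card ?B = k - 1 - card ?A"
      using s Js by (subst card_Diff_subset) auto
    then have "(\<Prod>r\<in>?B. u s 0) = u s 0 ^ (k - 1 - card ?A)" by simp
    finally show "(\<Prod>r<k. ?w r s) = u s 1 ^ card ?A * u s 0 ^ (k - 1 - card ?A)" by simp
  qed
  finally show ?thesis .
qed

text \<open>In \<open>x (l' + 1) + zeta r * x 2\<close> the term with \<open>j = r\<close> cancels
  and \<open>u r 0\<close> divides the others, with quotient \<open>L r\<close>. A single
  \<open>L r\<close> has degree 0 in row \<open>r\<close> and 1 elsewhere; only the product over
  \<open>r\<close> has equal degrees in all rows, as \<open>reg_monomial\<close> requires.\<close>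

lemma exchange_initial:
  "\<exists>y\<in>reg. \<forall>u. x 1 u * y u = (\<Sum>s\<le>k. eta k p s * x 2 u ^ s * x (l' + 1) u ^ (k - s))"
proof -
  let ?D = "\<lambda>r. {..<k} - {r}"
  define L where "L = (\<lambda>r u. \<Sum>j\<in>?D r. alpha j * (zeta r - zeta j) * (u j 1 * (\<Prod>s\<in>{..<k} - {j, r}. u s (0::nat))))"
  have L: "x (l' + 1) u + zeta r * x 2 u = u r 0 * L r u" if "r < k" for r u
  proof -
    have "x (l' + 1) u + zeta r * x 2 u
        = (\<Sum>j<k. alpha j * (zeta r - zeta j) * (u j 1 * (\<Prod>s\<in>{..<k} - {j}. u s 0)))"
    proof -
      have "x (l' + 1) u + zeta r * x 2 u = (\<Sum>j<k. zeta r * (alpha j * u j 1 * (\<Prod>s\<in>{..<k} - {j}. u s 0))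
          - alpha j * (zeta j * u j 1) * (\<Prod>s\<in>{..<k} - {j}. u s 0))"
        unfolding x_2 x_l'1 sum_distrib_left sum_subtractf by simp
      then show ?thesis by (simp add: algebra_simps)
    qed
    also have "\<dots> = (\<Sum>j\<in>?D r. alpha j * (zeta r - zeta j) * (u j 1 * (\<Prod>s\<in>{..<k} - {j}. u s 0)))"
      using that by (simp add: sum.remove[of _ r])
    also have "\<dots> = u r 0 * L r u"
      unfolding L_def sum_distrib_left
    proof (rule sum.cong[OF refl])
      fix j assume "j \<in> ?D r"
      then have "(\<Prod>s\<in>{..<k} - {j}. u s 0) = u r 0 * (\<Prod>s\<in>{..<k} - {j} - {r}. u s 0)"
        using that by (intro prod.remove) auto
      also have "{..<k} - {j} - {r} = {..<k} - {j, r}" by auto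
      finally show "alpha j * (zeta r - zeta j) * (u j 1 * (\<Prod>s\<in>{..<k} - {j}. u s 0))
          = u r 0 * (alpha j * (zeta r - zeta j) * (u j 1 * (\<Prod>s\<in>{..<k} - {j, r}. u s 0)))"
        by simp
    qed
    finally show ?thesis .
  qed
  let ?V = "\<Sum>j<k. alpha j"
  \<comment> \<open>The factor \<open>1 / ?V\<close> compensates for the constant in
    \<open>x_1\<close>.\<close>
  define y where "y = (\<lambda>u. (1 / ?V) * (\<Prod>r<k. L r u))"
  have "(\<lambda>u. \<Prod>r<k. L r u) \<in> reg"
  proof -
    have "(\<lambda>u. \<Prod>r<k. L r u) = (\<lambda>u. \<Sum>J\<in>PiE {..<k} ?D. (\<Prod>r<k. alpha (J r) * (zeta r - zeta (J r))) *
        (\<Prod>s<k. u s 1 ^ card {r. r < k \<and> J r = s} * u s 0 ^ (k - 1 - card {r. r < k \<and> J r = s})))"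
    proof
      fix u :: "nat \<Rightarrow> nat \<Rightarrow> complex"
      have "(\<Prod>r<k. L r u) = (\<Sum>J\<in>PiE {..<k} ?D. \<Prod>r<k. alpha (J r) * (zeta r - zeta (J r)) *
          (u (J r) 1 * (\<Prod>s\<in>{..<k} - {J r, r}. u s 0)))"
        unfolding L_def by (rule prod_sum_PiE) auto
      also have "\<dots> = (\<Sum>J\<in>PiE {..<k} ?D. (\<Prod>r<k. alpha (J r) * (zeta r - zeta (J r))) *
        (\<Prod>s<k. u s 1 ^ card {r. r < k \<and> J r = s} * u s 0 ^ (k - 1 - card {r. r < k \<and> J r = s})))"
      proof (rule sum.cong[OF refl])
        fix J assume J: "J \<in> PiE {..<k} ?D"
        have "\<And>r. r < k \<Longrightarrow> J r < k \<and> J r \<noteq> r" using PiE_mem[OF J] by simp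
        from prod_offdiagonal[OF this] show "(\<Prod>r<k. alpha (J r) * (zeta r - zeta (J r)) *
          (u (J r) 1 * (\<Prod>s\<in>{..<k} - {J r, r}. u s 0))) = (\<Prod>r<k. alpha (J r) * (zeta r - zeta (J r))) *
        (\<Prod>s<k. u s 1 ^ card {r. r < k \<and> J r = s} * u s 0 ^ (k - 1 - card {r. r < k \<and> J r = s}))"
          by (simp only: prod.distrib)
      qed
      finally show "(\<Prod>r<k. L r u) = \<dots>" .
    qed
    also have "\<dots> \<in> reg"
    proof (rule reg_sum, rule reg_mult[OF reg_const], rule reg_monomial)
      fix J s assume J: "J \<in> PiE {..<k} ?D" and s: "s < k"
      have "J s \<noteq> s" using PiE_mem[OF J, of s] s by simp
      then have "{r. r < k \<and> J r = s} \<subseteq> {..<k} - {s}" by blast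
      then have "card {r. r < k \<and> J r = s} \<le> card ({..<k} - {s})" by (intro card_mono) auto
      then show "card {r. r < k \<and> J r = s} \<le> k - 1" using s by simp
    qed
    finally show ?thesis .
  qed
  then have "y \<in> reg" unfolding y_def by (rule reg_mult[OF reg_const])
  moreover have "x 1 u * y u = (\<Sum>s\<le>k. eta k p s * x 2 u ^ s * x (l' + 1) u ^ (k - s))" for u
  proof -
    have "x 1 u * y u = (\<Prod>r<k. u r 0) * (\<Prod>r<k. L r u)"
      unfolding x_1 y_def using sum_alpha_nonzero by simp
    also have "\<dots> = (\<Prod>r<k. u r 0 * L r u)" by (rule prod.distrib[symmetric])
    also have "\<dots> = (\<Prod>r<k. x (l' + 1) u + zeta r * x 2 u)" by (intro prod.cong refl) (simp only: L lessThan_iff)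
    also have "\<dots> = (\<Sum>s\<le>k. eta k p s * x 2 u ^ s * x (l' + 1) u ^ (k - s))"
      unfolding zeta_def by (rule prod_eta[OF kp])
    finally show ?thesis .
  qed
  ultimately show ?thesis by (intro bexI[of _ y]) auto
qed

end

section \<open>Row spans and eigenvectors of the shift\<close>

text \<open>Hermitian, so that a single determinant, continuous in the entries, detects full rank;
  Cauchy-Binet also relates it to the maximal minors.\<close>

definition gram :: "nat \<Rightarrow> nat \<Rightarrow> complex mat \<Rightarrow> complex mat" where
  "gram k n A = mat k k (\<lambda>(r, s). \<Sum>c<n. A $$ (r, c) * cnj (A $$ (s, c)))"

lemma transpose_mult_vec_index:
  assumes "A \<in> carrier_mat k n" "y \<in> carrier_vec k" "c < n"
  shows "(A\<^sup>T *\<^sub>v y) $ c = (\<Sum>r<k. A $$ (r, c) * y $ r)"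
  using assms by (simp add: scalar_prod_def lessThan_atLeast0)

lemma row_span_eq:
  assumes "A \<in> carrier_mat k n"
  shows "row_span n A = (\<lambda>y. A\<^sup>T *\<^sub>v y) ` carrier_vec k"
proof -
  have "A\<^sup>T *\<^sub>v y \<in> carrier_vec n" if "y \<in> carrier_vec k" for y using assms that by simp
  then show ?thesis unfolding vec_space.row_space_eq[OF assms] carrier_matD[OF assms] by blast
qed

lemma gram_mult_vec_index:
  assumes A: "A \<in> carrier_mat k n" and y: "y \<in> carrier_vec k" and s: "s < k"
  shows "((gram k n A)\<^sup>T *\<^sub>v y) $ s = (\<Sum>c<n. cnj (A $$ (s, c)) * (A\<^sup>T *\<^sub>v y) $ c)"
proof -
  have "((gram k n A)\<^sup>T *\<^sub>v y) $ s = (\<Sum>r<k. (\<Sum>c<n. A $$ (r, c) * cnj (A $$ (s, c))) * y $ r)"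
    using y s by (subst transpose_mult_vec_index[of _ k k]) (auto simp: gram_def)
  also have "\<dots> = (\<Sum>c<n. \<Sum>r<k. cnj (A $$ (s, c)) * (A $$ (r, c) * y $ r))"
    unfolding sum_distrib_right by (subst sum.swap) (simp add: mult_ac)
  also have "\<dots> = (\<Sum>c<n. cnj (A $$ (s, c)) * (A\<^sup>T *\<^sub>v y) $ c)"
    unfolding sum_distrib_left[symmetric] using A y
    by (intro sum.cong refl) (subst transpose_mult_vec_index[of _ k n], auto)
  finally show ?thesis .
qed

text \<open>Pairing the image of \<open>y\<close> under the transposed Gram matrix with the
  conjugate of \<open>y\<close> gives the squared norm of the combination of rows with coefficients
  \<open>y\<close>.\<close>

lemma gram_kernel:
  assumes A: "A \<in> carrier_mat k n" and y: "y \<in> carrier_vec k"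
  shows "(gram k n A)\<^sup>T *\<^sub>v y = 0\<^sub>v k \<longleftrightarrow> A\<^sup>T *\<^sub>v y = 0\<^sub>v n"
proof
  let ?w = "A\<^sup>T *\<^sub>v y"
  assume 0: "(gram k n A)\<^sup>T *\<^sub>v y = 0\<^sub>v k"
  have "(\<Sum>c<n. complex_of_real ((cmod (?w $ c))\<^sup>2)) = (\<Sum>c<n. cnj (?w $ c) * ?w $ c)"
    by (simp only: complex_norm_square mult.commute)
  also have "\<dots> = (\<Sum>c<n. \<Sum>s<k. cnj (y $ s) * (cnj (A $$ (s, c)) * ?w $ c))"
  proof (rule sum.cong[OF refl])
    fix c assume "c \<in> {..<n}"
    then have "?w $ c = (\<Sum>r<k. A $$ (r, c) * y $ r)" using transpose_mult_vec_index[OF A y] by simp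
    then have "cnj (?w $ c) = (\<Sum>s<k. cnj (y $ s) * cnj (A $$ (s, c)))" by (simp add: mult.commute)
    then show "cnj (?w $ c) * ?w $ c = (\<Sum>s<k. cnj (y $ s) * (cnj (A $$ (s, c)) * ?w $ c))"
      by (simp only: sum_distrib_right mult.assoc)
  qed
  also have "\<dots> = (\<Sum>s<k. cnj (y $ s) * ((gram k n A)\<^sup>T *\<^sub>v y) $ s)"
    by (subst sum.swap) (simp add: gram_mult_vec_index[OF A y] sum_distrib_left)
  also have "\<dots> = 0" unfolding 0 by simp
  finally have "complex_of_real (\<Sum>c<n. (cmod (?w $ c))\<^sup>2) = 0" by (simp only: of_real_sum)
  then have "(\<Sum>c<n. (cmod (?w $ c))\<^sup>2) = 0" by (simp only: of_real_eq_0_iff)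
  then have "\<forall>c<n. ?w $ c = 0" by (simp add: sum_nonneg_eq_0_iff)
  then show "?w = 0\<^sub>v n" using A by (intro eq_vecI) auto
next
  assume 0: "A\<^sup>T *\<^sub>v y = 0\<^sub>v n"
  have "((gram k n A)\<^sup>T *\<^sub>v y) $ s = 0" if "s < k" for s
    unfolding gram_mult_vec_index[OF A y that] 0 by simp
  then show "(gram k n A)\<^sup>T *\<^sub>v y = 0\<^sub>v k" by (intro eq_vecI) (auto simp: gram_def)
qed

lemma det_gram_nonzero_iff:
  assumes A: "A \<in> carrier_mat k n"
  shows "Determinant.det (gram k n A) \<noteq> 0 \<longleftrightarrow> (\<forall>y\<in>carrier_vec k. A\<^sup>T *\<^sub>v y = 0\<^sub>v n \<longrightarrow> y = 0\<^sub>v k)"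
proof -
  have G: "gram k n A \<in> carrier_mat k k" "(gram k n A)\<^sup>T \<in> carrier_mat k k" by (simp_all add: gram_def)
  have "Determinant.det (gram k n A) = Determinant.det ((gram k n A)\<^sup>T)"
    by (rule det_transpose[OF G(1), symmetric])
  then show ?thesis
    using det_0_iff_vec_prod_zero_field[OF G(2)] gram_kernel[OF A] by auto
qed

lemma det_nonzero_right_inverse:
  fixes M :: "'a::field mat"
  assumes M: "M \<in> carrier_mat k k" and det: "Determinant.det M \<noteq> 0"
  obtains G where "G \<in> carrier_mat k k" "M * G = 1\<^sub>m k"
proof -
  have "M \<in> Units (ring_mat TYPE('a) k ())" by (rule det_non_zero_imp_unit[OF M det])
  then show ?thesis using that by (auto simp: Units_def ring_mat_def)
qed

text \<open>If the rank is \<open>k\<close>, then \<open>k\<close> independent columns form an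
  invertible matrix, and a vector orthogonal to all columns is zero. Conversely the Gram matrix is
  \<open>A\<close> times its conjugate transpose, so its right inverse shows that the columns of
  \<open>A\<close> span.\<close>

lemma full_rank_iff_det_gram:
  assumes A: "A \<in> carrier_mat k n"
  shows "A \<in> full_rank_mats k n \<longleftrightarrow> Determinant.det (gram k n A) \<noteq> 0"
proof
  interpret V: vec_space "TYPE(complex)" k .
  assume "A \<in> full_rank_mats k n"
  then have rk: "V.rank A = k" by (simp add: full_rank_mats_def)
  obtain S where S: "maximal S (\<lambda>T. T \<subseteq> set (cols A) \<and> V.lin_indpt T)"
    using maximal_exists_superset[of "set (cols A)" "\<lambda>T. T \<subseteq> set (cols A) \<and> V.lin_indpt T" "{}"]
    by (auto simp: V.lin_dep_def)
  have card: "card S = k" using V.rank_card_indpt[OF A S] rk by simp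
  have sub: "S \<subseteq> set (cols A)" "V.lin_indpt S" using S by (auto simp: maximal_def)
  then obtain xs where xs: "set xs = S" "distinct xs"
    using finite_distinct_list finite_subset by (metis finite_set)
  have len: "length xs = k" using xs card distinct_card by fastforce
  have cV: "set xs \<subseteq> carrier_vec k" using xs sub cols_dim[of A] A by auto
  let ?M = "mat_of_cols k xs"
  have M: "?M \<in> carrier_mat k k" "cols ?M = xs" using len cV by auto
  have "V.rank ?M = k" using V.lin_indpt_full_rank[OF M(1)] M xs sub by simp
  then have "Determinant.det ?M \<noteq> 0" using V.det_rank_iff[OF M(1)] by simp
  then have inv: "Determinant.det (?M\<^sup>T) \<noteq> 0" using det_transpose[OF M(1)] by simp
  show "Determinant.det (gram k n A) \<noteq> 0"
    unfolding det_gram_nonzero_iff[OF A]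
  proof (intro ballI impI)
    fix y :: "complex vec" assume y: "y \<in> carrier_vec k" and 0: "A\<^sup>T *\<^sub>v y = 0\<^sub>v n"
    have "?M\<^sup>T *\<^sub>v y = 0\<^sub>v k"
    proof (rule eq_vecI)
      fix i assume i: "i < dim_vec (0\<^sub>v k)"
      then have "xs ! i \<in> set (cols A)" using xs sub len by (metis index_zero_vec(2) nth_mem subsetD)
      then obtain c where c: "c < n" "xs ! i = Matrix.col A c"
        using A by (auto simp: cols_def)
      have "(?M\<^sup>T *\<^sub>v y) $ i = xs ! i \<bullet> y" using i len cV M by (simp add: subset_iff)
      also have "\<dots> = (A\<^sup>T *\<^sub>v y) $ c" using c A by simp
      finally show "(?M\<^sup>T *\<^sub>v y) $ i = 0\<^sub>v k $ i" using 0 c i by simp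
    qed (use len in simp)
    then show "y = 0\<^sub>v k"
      using det_0_iff_vec_prod_zero_field[of "?M\<^sup>T" k] inv y M by auto
  qed
next
  interpret V: vec_space "TYPE(complex)" k .
  assume det: "Determinant.det (gram k n A) \<noteq> 0"
  define H where "H = mat n k (\<lambda>(c, r). cnj (A $$ (r, c)))"
  have H: "H \<in> carrier_mat n k" by (simp add: H_def)
  have AH: "A * H = gram k n A"
    using A by (intro eq_matI) (auto simp: gram_def H_def scalar_prod_def lessThan_atLeast0)
  obtain G where G: "G \<in> carrier_mat k k" "gram k n A * G = 1\<^sub>m k"
    using det_nonzero_right_inverse[of "gram k n A" k] det by (auto simp: gram_def)
  have "carrier_vec k \<subseteq> V.col_space A"
  proof
    fix b :: "complex vec" assume b: "b \<in> carrier_vec k"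
    have AHk: "A * H \<in> carrier_mat k k" using A H by simp
    have "b = (A * H * G) *\<^sub>v b" unfolding AH G(2) using b by simp
    also have "\<dots> = (A * H) *\<^sub>v (G *\<^sub>v b)" by (rule assoc_mult_mat_vec[OF AHk G(1) b])
    also have "\<dots> = A *\<^sub>v (H *\<^sub>v (G *\<^sub>v b))"
      by (rule assoc_mult_mat_vec[OF A H]) (use G b in simp)
    finally have "b = A *\<^sub>v (H *\<^sub>v (G *\<^sub>v b))" .
    then have "A *\<^sub>v (H *\<^sub>v (G *\<^sub>v b)) = b" by (rule sym)
    moreover have "H *\<^sub>v (G *\<^sub>v b) \<in> carrier_vec n" using H G b by simp
    ultimately show "b \<in> V.col_space A"
      unfolding V.col_space_eq[OF A] using A b by auto
  qed
  then have "V.span (set (cols A)) = carrier_vec k"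
    using V.span_closed[of "set (cols A)"] cols_dim[of A] A unfolding V.col_space_def by auto
  then have "V.rank A = k"
    unfolding V.rank_def using V.dim_is_n by (simp add: module_vec_def)
  then show "A \<in> full_rank_mats k n" using A by (simp add: full_rank_mats_def)
qed

lemma full_rank_iff_kernel:
  assumes A: "A \<in> carrier_mat k n"
  shows "A \<in> full_rank_mats k n \<longleftrightarrow> (\<forall>y\<in>carrier_vec k. A\<^sup>T *\<^sub>v y = 0\<^sub>v n \<longrightarrow> y = 0\<^sub>v k)"
  unfolding full_rank_iff_det_gram[OF A] by (rule det_gram_nonzero_iff[OF A])

lemma row_in_row_span:
  assumes A: "A \<in> carrier_mat k n" and r: "r < k"
  shows "row A r \<in> row_span n A"
proof -
  have "row A r = A\<^sup>T *\<^sub>v unit_vec k r"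
    using A r by (intro eq_vecI) (auto simp: transpose_mult_vec_index[OF A])
  then show ?thesis using row_span_eq[OF A] by auto
qed

lemma row_span_subset_factor:
  assumes A: "A \<in> carrier_mat k n" and B: "B \<in> carrier_mat k n"
    and rows: "\<And>r. r < k \<Longrightarrow> row B r \<in> row_span n A"
  obtains g where "g \<in> carrier_mat k k" "B = g * A"
proof -
  have "\<exists>y\<in>carrier_vec k. row B r = A\<^sup>T *\<^sub>v y" if "r < k" for r
    using rows[OF that] row_span_eq[OF A] by auto
  then obtain y where y: "\<And>r. r < k \<Longrightarrow> y r \<in> carrier_vec k" "\<And>r. r < k \<Longrightarrow> row B r = A\<^sup>T *\<^sub>v y r"
    by metis
  define g where "g = mat k k (\<lambda>(r, s). y r $ s)"
  have "B = g * A"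
  proof (rule eq_matI)
    fix r c assume "r < dim_row (g * A)" "c < dim_col (g * A)"
    then have rc: "r < k" "c < n" using A by (auto simp: g_def)
    have "B $$ (r, c) = row B r $ c" using B rc by simp
    also have "\<dots> = (\<Sum>s<k. A $$ (s, c) * y r $ s)"
      using y rc by (simp add: transpose_mult_vec_index[OF A])
    also have "\<dots> = (g * A) $$ (r, c)"
      using A rc by (simp add: g_def scalar_prod_def lessThan_atLeast0 mult.commute)
    finally show "B $$ (r, c) = (g * A) $$ (r, c)" .
  qed (use A B in \<open>auto simp: g_def\<close>)
  then show ?thesis by (intro that[of g]) (simp_all add: g_def)
qed

lemma det_factor_nonzero:
  assumes A: "A \<in> carrier_mat k n" and g: "g \<in> carrier_mat k k" and "g * A \<in> full_rank_mats k n"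
  shows "Determinant.det g \<noteq> 0"
proof
  assume "Determinant.det g = 0"
  then have "Determinant.det (g\<^sup>T) = 0" using det_transpose[OF g] by simp
  then obtain y where y: "y \<in> carrier_vec k" "y \<noteq> 0\<^sub>v k" "g\<^sup>T *\<^sub>v y = 0\<^sub>v k"
    using det_0_iff_vec_prod_zero_field[of "g\<^sup>T" k] g by auto
  have "(g * A)\<^sup>T *\<^sub>v y = A\<^sup>T *\<^sub>v (g\<^sup>T *\<^sub>v y)"
    using A g y by (subst transpose_mult[OF g A]) (rule assoc_mult_mat_vec[of _ n k _ k], auto)
  also have "\<dots> = 0\<^sub>v n" unfolding y(3) using A by (intro eq_vecI) auto
  finally show False using full_rank_iff_kernel[of "g * A" k n] assms y by auto
qed

lemma row_span_factor:
  assumes A: "A \<in> carrier_mat k n" and g: "g \<in> carrier_mat k k" "Determinant.det g \<noteq> 0"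
  shows "row_span n (g * A) = row_span n A"
proof -
  have gA: "g * A \<in> carrier_mat k n" using A g by simp
  have gT: "g\<^sup>T \<in> carrier_mat k k" "Determinant.det (g\<^sup>T) \<noteq> 0" using g det_transpose[OF g(1)] by auto
  obtain h where h: "h \<in> carrier_mat k k" "g\<^sup>T * h = 1\<^sub>m k"
    using det_nonzero_right_inverse[OF gT] by auto
  have eq: "(g * A)\<^sup>T *\<^sub>v y = A\<^sup>T *\<^sub>v (g\<^sup>T *\<^sub>v y)" if "y \<in> carrier_vec k" for y
    using A g that by (subst transpose_mult[OF g(1) A]) (rule assoc_mult_mat_vec[of _ n k _ k], auto)
  show ?thesis
    unfolding row_span_eq[OF A] row_span_eq[OF gA]
  proof (intro equalityI subsetI)
    fix v assume "v \<in> (\<lambda>y. (g * A)\<^sup>T *\<^sub>v y) ` carrier_vec k"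
    then show "v \<in> (\<lambda>y. A\<^sup>T *\<^sub>v y) ` carrier_vec k" using eq gT by auto
  next
    fix v assume "v \<in> (\<lambda>y. A\<^sup>T *\<^sub>v y) ` carrier_vec k"
    then obtain y where y: "y \<in> carrier_vec k" "v = A\<^sup>T *\<^sub>v y" by auto
    have "g\<^sup>T *\<^sub>v (h *\<^sub>v y) = (g\<^sup>T * h) *\<^sub>v y"
      by (rule assoc_mult_mat_vec[symmetric, of _ k k _ k]) (use gT h y in auto)
    then have "g\<^sup>T *\<^sub>v (h *\<^sub>v y) = y" using h y by simp
    then have "v = (g * A)\<^sup>T *\<^sub>v (h *\<^sub>v y)" using eq[of "h *\<^sub>v y"] h y by simp
    then show "v \<in> (\<lambda>y. (g * A)\<^sup>T *\<^sub>v y) ` carrier_vec k" using h y by auto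
  qed
qed

lemma row_span_eqE:
  assumes A: "A \<in> full_rank_mats k n" and B: "B \<in> carrier_mat k n" and eq: "row_span n A = row_span n B"
  obtains g where "g \<in> carrier_mat k k" "Determinant.det g \<noteq> 0" "A = g * B"
proof -
  have A': "A \<in> carrier_mat k n" using A by (simp add: full_rank_mats_def)
  obtain g where g: "g \<in> carrier_mat k k" "A = g * B"
    using row_span_subset_factor[OF B A'] row_in_row_span[OF A'] eq by metis
  then show ?thesis using det_factor_nonzero[OF B g(1)] A by (intro that) auto
qed

lemma subspace_eqI:
  assumes A: "A \<in> full_rank_mats k n" and B: "B \<in> full_rank_mats k n"
    and "\<And>r. r < k \<Longrightarrow> row B r \<in> row_span n A"
  shows "row_span n A = row_span n B"
proof -
  have C: "A \<in> carrier_mat k n" "B \<in> carrier_mat k n" using A B by (simp_all add: full_rank_mats_def)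
  obtain g where g: "g \<in> carrier_mat k k" "B = g * A" using row_span_subset_factor[OF C] assms(3) by metis
  then have "Determinant.det g \<noteq> 0" using det_factor_nonzero[OF C(1) g(1)] B by simp
  then show ?thesis using row_span_factor[OF C(1) g(1)] g by simp
qed

section \<open>Pluecker coordinates under row operations; powers of the shift\<close>

lemma strict_mono_enumeration:
  assumes I: "I \<subseteq> {1..n}" "card I = k"
  obtains f where "strict_mono_on {..<k} f" "\<And>i. i < k \<Longrightarrow> f i < n" "Suc ` f ` {..<k} = I"
proof -
  have Suc_pred: "Suc (j - 1) = j" if "j \<in> I" for j using I(1) that by auto
  have inj: "inj_on (\<lambda>j. j - 1) I"
  proof (rule inj_onI)
    fix i j assume "i \<in> I" "j \<in> I" "i - 1 = j - 1"
    then show "i = j" using Suc_pred[of i] Suc_pred[of j] by simp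
  qed
  have fin: "finite I" using I(1) finite_subset by auto
  have "card ((\<lambda>j. j - 1) ` I) = k" using inj I(2) by (simp only: card_image)
  then obtain xs where xs: "length xs = k" "set xs = (\<lambda>j. j - 1) ` I" "sorted_wrt (<) xs"
    using fin by (intro that[of "sorted_list_of_set ((\<lambda>j. j - 1) ` I)"]) auto
  have im: "(!) xs ` {..<k} = set xs" unfolding set_conv_nth xs(1) by auto
  show ?thesis
  proof (rule that[of "(!) xs"])
    show "strict_mono_on {..<k} ((!) xs)"
      using sorted_wrt_nth_less[OF xs(3)] xs(1) by (intro strict_mono_onI) simp
    show "Suc ` (!) xs ` {..<k} = I"
      unfolding im xs(2) image_image using Suc_pred by (simp cong: image_cong)
    fix i assume "i < k"
    then have "xs ! i \<in> (\<lambda>j. j - 1) ` I" unfolding xs(2)[symmetric] using xs(1) by simp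
    then obtain j where "xs ! i = j - 1" "j \<in> I" by blast
    moreover from this have "1 \<le> j" "j \<le> n" using I(1) by auto
    ultimately show "xs ! i < n" by linarith
  qed
qed

lemma plucker_mult:
  assumes A: "A \<in> carrier_mat k n" and g: "g \<in> carrier_mat k k" and I: "I \<subseteq> {1..n}" "card I = k"
  shows "plucker (g * A) I = Determinant.det g * plucker A I"
proof -
  obtain f where f: "strict_mono_on {..<k} f" "\<And>i. i < k \<Longrightarrow> f i < n" "Suc ` f ` {..<k} = I"
    using strict_mono_enumeration[OF I] by metis
  have gA: "g * A \<in> carrier_mat k n" using A g by simp
  let ?m = "\<lambda>A. mat k k (\<lambda>(r, i). A $$ (r, f i))"
  have "?m (g * A) = g * ?m A"
    using A g f(2) by (intro eq_matI) (auto simp: scalar_prod_def)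
  then have "Determinant.det (?m (g * A)) = Determinant.det g * Determinant.det (?m A)"
    using det_mult[OF g, of "?m A"] by simp
  then show ?thesis
    using plucker_strict_mono[OF A f(1,2)] plucker_strict_mono[OF gA f(1,2)] f(3) by simp
qed

lemma row_span_closed:
  assumes A: "A \<in> carrier_mat k n" and v: "v \<in> row_span n A" and w: "w \<in> row_span n A"
  shows "v \<in> carrier_vec n" "v + w \<in> row_span n A" "a \<cdot>\<^sub>v v \<in> row_span n A" "0\<^sub>v n \<in> row_span n A"
proof -
  obtain y z where y: "y \<in> carrier_vec k" "v = A\<^sup>T *\<^sub>v y" and z: "z \<in> carrier_vec k" "w = A\<^sup>T *\<^sub>v z"
    using v w row_span_eq[OF A] by auto
  have AT: "A\<^sup>T \<in> carrier_mat n k" using A by simp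
  show "v \<in> carrier_vec n" using y A by simp
  have "v + w = A\<^sup>T *\<^sub>v (y + z)" using y z mult_add_distrib_mat_vec[OF AT] by simp
  then show "v + w \<in> row_span n A" using y z row_span_eq[OF A] by auto
  have "a \<cdot>\<^sub>v v = A\<^sup>T *\<^sub>v (a \<cdot>\<^sub>v y)" using y mult_mat_vec[OF AT] by simp
  then show "a \<cdot>\<^sub>v v \<in> row_span n A" using y row_span_eq[OF A] by auto
  have "0\<^sub>v n = A\<^sup>T *\<^sub>v (0\<^sub>v k)" using A by (intro eq_vecI) auto
  then show "0\<^sub>v n \<in> row_span n A" using row_span_eq[OF A] by auto
qed

lemma dim_cyclic_shift [simp]: "dim_vec (cyclic_shift k n v) = n"
  by (simp add: cyclic_shift_def)

lemma cyclic_shift_carrier [simp]: "cyclic_shift k n v \<in> carrier_vec n"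
  by (rule carrier_vecI) simp

lemma shift_pow_carrier:
  assumes "v \<in> carrier_vec n"
  shows "(cyclic_shift k n ^^ m) v \<in> carrier_vec n"
  using assms by (cases m) auto

text \<open>The bound \<open>m \<le> n\<close> allows at most one wrap-around, hence at most one
  sign.\<close>

lemma shift_pow_index:
  assumes v: "v \<in> carrier_vec n" and "c < n" "m \<le> n"
  shows "(cyclic_shift k n ^^ m) v $ c = (if c + m < n then v $ (c + m) else (-1) ^ (k - 1) * v $ (c + m - n))"
  using assms(2,3)
proof (induction m arbitrary: c)
  case (Suc m)
  have "(cyclic_shift k n ^^ Suc m) v $ c = (if Suc c < n then (cyclic_shift k n ^^ m) v $ Suc c
      else (-1) ^ (k - 1) * (cyclic_shift k n ^^ m) v $ 0)"
    using Suc.prems by (simp add: cyclic_shift_def)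
  also have "\<dots> = (if c + Suc m < n then v $ (c + Suc m) else (-1) ^ (k - 1) * v $ (c + Suc m - n))"
  proof (cases "Suc c < n")
    case True
    then show ?thesis using Suc.IH[of "Suc c"] Suc.prems by simp
  next
    case False
    then have "c + Suc m - n = m" "\<not> c + Suc m < n" using Suc.prems by auto
    then show ?thesis using False Suc.IH[of 0] Suc.prems by (simp only: if_False) simp
  qed
  finally show ?case .
qed simp

lemma shift_pow_add:
  assumes v: "v \<in> carrier_vec n" and w: "w \<in> carrier_vec n"
  shows "(cyclic_shift k n ^^ m) (v + w) = (cyclic_shift k n ^^ m) v + (cyclic_shift k n ^^ m) w"
proof (induction m)
  case (Suc m)
  let ?f = "cyclic_shift k n"
  have c: "(?f ^^ m) v \<in> carrier_vec n" "(?f ^^ m) w \<in> carrier_vec n"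
    using shift_pow_carrier v w by blast+
  have "?f (a + b) = ?f a + ?f b" if "a \<in> carrier_vec n" "b \<in> carrier_vec n" for a b
    using that by (intro eq_vecI) (auto simp: cyclic_shift_def algebra_simps)
  then show ?case using Suc c by simp
qed simp

lemma shift_pow_smult:
  assumes v: "v \<in> carrier_vec n"
  shows "(cyclic_shift k n ^^ m) (a \<cdot>\<^sub>v v) = a \<cdot>\<^sub>v (cyclic_shift k n ^^ m) v"
proof (induction m)
  case (Suc m)
  let ?f = "cyclic_shift k n"
  have c: "(?f ^^ m) v \<in> carrier_vec n" using shift_pow_carrier v by blast
  have "?f (a \<cdot>\<^sub>v b) = a \<cdot>\<^sub>v ?f b" if "b \<in> carrier_vec n" for b
    using that by (intro eq_vecI) (auto simp: cyclic_shift_def algebra_simps)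
  then show ?case using Suc c by simp
qed simp

lemma shift_pow_n:
  assumes v: "v \<in> carrier_vec n"
  shows "(cyclic_shift k n ^^ n) v = (-1) ^ (k - 1) \<cdot>\<^sub>v v"
  using assms shift_pow_carrier[OF v, where k = k and m = n] by (intro eq_vecI) (auto simp: shift_pow_index[OF v])

lemma shift_pow_zero: "(cyclic_shift k n ^^ m) (0\<^sub>v n) = 0\<^sub>v n"
proof -
  let ?w = "(cyclic_shift k n ^^ m) (0\<^sub>v n)"
  have w: "?w \<in> carrier_vec n" by (rule shift_pow_carrier) simp
  have "?w = (cyclic_shift k n ^^ m) (0 \<cdot>\<^sub>v 0\<^sub>v n)"
    by (rule arg_cong[where f = "cyclic_shift k n ^^ m"]) (intro eq_vecI, auto)
  also have "\<dots> = 0 \<cdot>\<^sub>v ?w" by (rule shift_pow_smult) simp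
  also have "\<dots> = 0\<^sub>v n" using w by (intro eq_vecI) auto
  finally show ?thesis .
qed

lemma rho_pow: "(rho k n ^^ m) V = (cyclic_shift k n ^^ m) ` V"
  by (induction m) (simp_all add: rho_def image_comp)

lemma shift_pow_fixed:
  assumes "f ` V = V"
  shows "(f ^^ m) ` V = V"
proof (induction m)
  case (Suc m)
  have "(f ^^ Suc m) ` V = f ` ((f ^^ m) ` V)" by (simp add: image_image)
  then show ?case using Suc assms by simp
qed simp

context cyclic_setup
begin

section \<open>Eigenvectors of the l'-th power of the shift\<close>

abbreviation T :: "nat \<Rightarrow> complex vec \<Rightarrow> complex vec" where
  "T m \<equiv> cyclic_shift k n ^^ m"

definition B :: "(nat \<Rightarrow> nat \<Rightarrow> complex) \<Rightarrow> complex mat" where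
  "B u = mat k n (\<lambda>(r, c). col u c r)"

definition good :: "(nat \<Rightarrow> nat \<Rightarrow> complex) \<Rightarrow> bool" where
  "good u \<longleftrightarrow> (\<forall>r<k. \<exists>a<l'. u r a \<noteq> 0)"

lemma B_carrier [simp]: "B u \<in> carrier_mat k n"
  by (simp add: B_def)

lemma l'_le_n: "l' \<le> n"
  using n_eq p_pos by simp

lemma T_pow_index:
  assumes v: "v \<in> carrier_vec n" and "c < n"
  shows "T l' v $ c = (if c + l' < n then v $ (c + l') else (-1) ^ (k - 1) * v $ (c + l' - n))"
  using shift_pow_index[OF v \<open>c < n\<close> l'_le_n] .

lemma T_mult: "T (l' * t) v = (T l' ^^ t) v"
  by (simp add: funpow_mult mult.commute)

text \<open>Past the last column the shift wraps around with the sign \<open>(-1) ^ (k - 1)\<close>;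
  the quasi-periodic extension has the same sign over \<open>n\<close> columns, by
  \<open>col_add_n\<close>.\<close>

lemma T_row_B:
  assumes "r < k"
  shows "T l' (row (B u) r) = zeta r \<cdot>\<^sub>v row (B u) r"
proof -
  have R: "row (B u) r \<in> carrier_vec n" using assms by (simp add: B_def)
  show ?thesis
  proof (rule eq_vecI)
  fix c assume "c < dim_vec (zeta r \<cdot>\<^sub>v row (B u) r)"
  then have c: "c < n" by (simp add: B_def)
  have "col u (c + l') r = zeta r * col u c r" by (simp add: col_shift)
  moreover have "col u (c + l') r = (-1) ^ (k - 1) * col u (c + l' - n) r" if "\<not> c + l' < n"
    using that col_add_n[of u "c + l' - n"] by simp
  ultimately show "T l' (row (B u) r) $ c = (zeta r \<cdot>\<^sub>v row (B u) r) $ c"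
    using c assms l'_le_n unfolding T_pow_index[OF R c] by (auto simp: B_def)
next
  show "dim_vec (T l' (row (B u) r)) = dim_vec (zeta r \<cdot>\<^sub>v row (B u) r)"
    using carrier_vecD[OF shift_pow_carrier[OF R]] carrier_vecD[OF R] by simp
  qed
qed

lemma eigenvector_eq_row:
  assumes v: "v \<in> carrier_vec n" and T: "T l' v = zeta r \<cdot>\<^sub>v v" and c: "c < n"
  shows "v $ c = zeta r ^ (c div l') * v $ (c mod l')"
  using c
proof (induction c rule: less_induct)
  case (less c)
  show ?case
  proof (cases "c < l'")
    case False
    then have "T l' v $ (c - l') = v $ c" using T_pow_index[OF v, of "c - l'"] less.prems by simp
    moreover have "T l' v $ (c - l') = zeta r * v $ (c - l')" using T v less.prems by simp
    moreover have "v $ (c - l') = zeta r ^ ((c - l') div l') * v $ ((c - l') mod l')"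
      using less.IH[of "c - l'"] less.prems False l'2 by simp
    moreover have "c div l' = Suc ((c - l') div l')" "c mod l' = (c - l') mod l'"
      using False l'2 by (simp_all add: le_div_geq le_mod_geq)
    ultimately show ?thesis by (simp add: mult.assoc)
  qed simp
qed

lemma eigenvector_nonzero_entry:
  assumes v: "v \<in> carrier_vec n" and T: "T l' v = zeta r \<cdot>\<^sub>v v" and nz: "v \<noteq> 0\<^sub>v n"
  shows "\<exists>a<l'. v $ a \<noteq> 0"
proof (rule ccontr)
  assume "\<not> ?thesis"
  then have "v $ c = 0" if "c < n" for c
    using eigenvector_eq_row[OF v T that] l'2 by simp
  then show False using v nz by (auto intro: eq_vecI)
qed

text \<open>The rows are eigenvectors with distinct eigenvalues. Independence is made explicit: the
  entries of a vanishing combination in the columns \<open>a + t * l'\<close>, weighted by the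
  inverse powers of \<open>zeta j\<close> and summed over \<open>t < p\<close>, isolate the
  coefficient \<open>y $ j\<close>.\<close>

lemma good_full_rank:
  assumes "good u"
  shows "B u \<in> full_rank_mats k n"
  unfolding full_rank_iff_kernel[OF B_carrier]
proof (intro ballI impI)
  fix y :: "complex vec" assume y: "y \<in> carrier_vec k" and 0: "(B u)\<^sup>T *\<^sub>v y = 0\<^sub>v n"
  have "y $ j = 0" if j: "j < k" for j
  proof -
    obtain a where a: "a < l'" "u j a \<noteq> 0" using assms j by (auto simp: good_def)
    have lt: "a + t * l' < n" if "t < p" for t
    proof -
      have "a + t * l' < (t + 1) * l'" using a by simp
      also have "\<dots> \<le> p * l'" using that by (intro mult_le_mono1) simp
      finally show ?thesis by (simp add: n_eq)
    qed
    have "(\<Sum>r<k. zeta r ^ t * u r a * y $ r) = 0" if "t < p" for t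
    proof -
      have "((B u)\<^sup>T *\<^sub>v y) $ (a + t * l') = (\<Sum>r<k. col u (a + t * l') r * y $ r)"
        using y lt[OF that] by (subst transpose_mult_vec_index[OF B_carrier]) (auto simp: B_def)
      then show ?thesis using 0 lt[OF that] a by (simp add: col_def)
    qed
    then have "0 = (\<Sum>t<p. (1 / zeta j) ^ t * (\<Sum>r<k. zeta r ^ t * u r a * y $ r))" by simp
    also have "\<dots> = (\<Sum>r<k. \<Sum>t<p. (zeta r / zeta j) ^ t * (u r a * y $ r))"
      unfolding sum_distrib_left by (subst sum.swap) (simp add: power_divide mult_ac)
    also have "\<dots> = (\<Sum>r<k. (if r = j then of_nat p else 0) * (u r a * y $ r))"
      unfolding sum_distrib_right[symmetric] by (intro sum.cong refl) (simp add: sum_zeta_ratio j)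
    also have "\<dots> = of_nat p * (u j a * y $ j)" using j by (simp add: if_distrib[of "\<lambda>x. x * _"] cong: if_cong)
    finally show ?thesis using a p_pos by simp
  qed
  then show "y = 0\<^sub>v k" using y by (intro eq_vecI) auto
qed

definition spans :: "complex vec set set" where
  "spans = {row_span n (B u) | u. good u}"

lemma GrE:
  assumes "V \<in> Gr k n"
  obtains A where "A \<in> full_rank_mats k n" "A \<in> carrier_mat k n" "V = row_span n A"
  using assms by (auto simp: Gr_def full_rank_mats_def)

text \<open>By Bezout \<open>l * a = n * b + l'\<close>, and the n-th power of the shift is a sign,
  so up to sign the l'-th power is a power of the l-th.\<close>

lemma fixed_locus_T_closed:
  assumes V: "V \<in> fixed_locus k l n" and v: "v \<in> V"
  shows "T l' v \<in> V"
proof -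
  have Gr: "V \<in> Gr k n" and fix_l: "T l ` V = V" using V by (simp_all add: fixed_locus_def rho_pow)
  obtain A where A: "A \<in> carrier_mat k n" "V = row_span n A" using GrE[OF Gr] by metis
  note closed = row_span_closed[OF A(1), folded A(2)]
  have vc: "v \<in> carrier_vec n" using closed(1) v by blast
  obtain a b where ab: "l * a = n * b + l'"
    using bezout_nat[of l n] l2 unfolding l'_def by auto
  have "(T l ^^ a) ` V = V" using shift_pow_fixed[OF fix_l] .
  then have "T (l * a) v \<in> V" using v by (auto simp: funpow_mult mult.commute)
  moreover have "T (l * a) v = (T n ^^ b) (T l' v)"
    unfolding ab by (simp add: funpow_add funpow_mult mult.commute)
  moreover have "(T n ^^ b) w = ((-1) ^ (k - 1)) ^ b \<cdot>\<^sub>v w" if "w \<in> carrier_vec n" for w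
  proof (induction b)
    case (Suc b)
    then show ?case using shift_pow_n[of "((-1) ^ (k - 1)) ^ b \<cdot>\<^sub>v w" n k] that
      by (simp add: smult_smult_assoc)
  qed (use that in simp)
  ultimately have "((-1) ^ (k - 1)) ^ b \<cdot>\<^sub>v T l' v \<in> V" using shift_pow_carrier[OF vc] by simp
  \<comment> \<open>Scaling by the sign once more cancels it.\<close>
  then have "((-1) ^ (k - 1)) ^ b \<cdot>\<^sub>v (((-1) ^ (k - 1)) ^ b \<cdot>\<^sub>v T l' v) \<in> V" by (rule closed(3)[OF _ v])
  moreover have "((-1) ^ (k - 1)) ^ b * ((-1) ^ (k - 1)) ^ b = (1::complex)"
    by (simp flip: power_mult_distrib)
  ultimately show ?thesis by (simp add: smult_smult_assoc)
qed

text \<open>Since \<open>l\<close> is a multiple of \<open>l'\<close>, the l-th power multiplies the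
  coordinates with respect to the rows by powers of the \<open>zeta r\<close>. These are invertible,
  which gives equality of the image with the subspace and not just inclusion.\<close>

lemma spans_subset_fixed_locus: "spans \<subseteq> fixed_locus k l n"
proof
  fix V assume "V \<in> spans"
  then obtain u where u: "good u" "V = row_span n (B u)" by (auto simp: spans_def)
  obtain q where q: "l = l' * q" unfolding l'_def by (metis dvdE gcd_dvd1)
  have T: "T l (row (B u) r) = zeta r ^ q \<cdot>\<^sub>v row (B u) r" if "r < k" for r
  proof -
    have R: "row (B u) r \<in> carrier_vec n" using that by (simp add: B_def)
    have "(T l' ^^ q) (row (B u) r) = zeta r ^ q \<cdot>\<^sub>v row (B u) r"
    proof (induction q)
      case (Suc q)
      have "(T l' ^^ Suc q) (row (B u) r) = T l' (zeta r ^ q \<cdot>\<^sub>v row (B u) r)" using Suc by simp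
      also have "\<dots> = zeta r ^ q \<cdot>\<^sub>v (zeta r \<cdot>\<^sub>v row (B u) r)"
        by (simp only: shift_pow_smult[OF R] T_row_B[OF that])
      finally show ?case by (simp add: smult_smult_assoc mult.commute)
    qed simp
    then show ?thesis by (simp only: q T_mult)
  qed
  have lin: "T l ((B u)\<^sup>T *\<^sub>v y) = (B u)\<^sup>T *\<^sub>v vec k (\<lambda>r. zeta r ^ q * y $ r)" if y: "y \<in> carrier_vec k" for y
  proof -
    \<comment> \<open>The sum over the first \<open>m\<close> rows, so that additivity of the shift
      can be used one row at a time.\<close>
    define part where "part = (\<lambda>m z. vec n (\<lambda>c. \<Sum>r<m. B u $$ (r, c) * z $ r))"
    have part: "(B u)\<^sup>T *\<^sub>v z = part k z" if "z \<in> carrier_vec k" for z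
      using that by (intro eq_vecI) (auto simp: part_def transpose_mult_vec_index[OF B_carrier] carrier_matD[OF B_carrier]
          simp del: index_mult_mat_vec)
    have "T l (part m y) = part m (vec k (\<lambda>r. zeta r ^ q * y $ r))" if "m \<le> k" for m
      using that
    proof (induction m)
      case 0
      have "part 0 z = 0\<^sub>v n" for z by (intro eq_vecI) (auto simp: part_def)
      then show ?case by (simp add: shift_pow_zero)
    next
      case (Suc m)
      have R: "row (B u) m \<in> carrier_vec n" using Suc.prems by (simp add: B_def)
      have S: "part (Suc m) z = part m z + z $ m \<cdot>\<^sub>v row (B u) m" for z
        using Suc.prems by (intro eq_vecI) (auto simp: part_def B_def)
      have P: "part m z \<in> carrier_vec n" for z by (simp add: part_def)
      have "T l (part (Suc m) y) = T l (part m y) + y $ m \<cdot>\<^sub>v T l (row (B u) m)"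
        unfolding S using shift_pow_add[OF P] shift_pow_smult[OF R] R by simp
      then show ?case using Suc T[of m] by (simp add: S smult_smult_assoc mult.commute)
    qed
    then show ?thesis using part y by simp
  qed
  have V: "V = (\<lambda>y. (B u)\<^sup>T *\<^sub>v y) ` carrier_vec k" unfolding u(2) by (rule row_span_eq[OF B_carrier])
  have "T l ` V = V"
  proof (intro equalityI subsetI)
    fix v assume "v \<in> T l ` V"
    then obtain y where "y \<in> carrier_vec k" "v = T l ((B u)\<^sup>T *\<^sub>v y)" unfolding V by blast
    then have "v = (B u)\<^sup>T *\<^sub>v vec k (\<lambda>r. zeta r ^ q * y $ r)" by (simp only: lin)
    then show "v \<in> V" unfolding V using vec_carrier by blast
  next
    fix v assume "v \<in> V"
    then obtain y where y: "y \<in> carrier_vec k" "v = (B u)\<^sup>T *\<^sub>v y" unfolding V by blast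
    define z where "z = vec k (\<lambda>r. y $ r / zeta r ^ q)"
    have z: "z \<in> carrier_vec k" by (simp add: z_def)
    have "vec k (\<lambda>r. zeta r ^ q * z $ r) = y" using y(1) by (intro eq_vecI) (auto simp: z_def)
    then have "v = T l ((B u)\<^sup>T *\<^sub>v z)" unfolding lin[OF z] y(2) by simp
    then show "v \<in> T l ` V" unfolding V using z by blast
  qed
  moreover have "V \<in> Gr k n" using u good_full_rank by (auto simp: Gr_def)
  ultimately show "V \<in> fixed_locus k l n" by (simp add: fixed_locus_def rho_pow)
qed

text \<open>The first \<open>l'\<close> entries of the eigenvectors serve as \<open>u\<close>; the
  eigenvectors are then the rows of \<open>B u\<close>, and a subspace of dimension \<open>k\<close>
  inside \<open>V\<close> is all of \<open>V\<close>.\<close>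

lemma spansI:
  assumes V: "V \<in> Gr k n" and ev: "\<And>j. j < k \<Longrightarrow> \<exists>v\<in>V. v \<noteq> 0\<^sub>v n \<and> T l' v = zeta j \<cdot>\<^sub>v v"
  shows "V \<in> spans"
proof -
  obtain A where A: "A \<in> full_rank_mats k n" "A \<in> carrier_mat k n" "V = row_span n A" using GrE[OF V] by metis
  obtain v where v: "\<And>j. j < k \<Longrightarrow> v j \<in> V" "\<And>j. j < k \<Longrightarrow> v j \<noteq> 0\<^sub>v n" "\<And>j. j < k \<Longrightarrow> T l' (v j) = zeta j \<cdot>\<^sub>v v j"
    using ev by metis
  have vc: "v j \<in> carrier_vec n" if "j < k" for j using row_span_closed(1)[OF A(2)] v(1) that A(3) by blast
  define u where "u = (\<lambda>r a. v r $ a)"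
  have "good u" unfolding good_def u_def using eigenvector_nonzero_entry[OF vc v(3) v(2)] by blast
  moreover have "row (B u) j = v j" if "j < k" for j
    using that vc[OF that] eigenvector_eq_row[OF vc v(3)] by (intro eq_vecI) (auto simp: B_def col_def u_def)
  then have "V = row_span n (B u)"
    unfolding A(3) using v(1) A(3) good_full_rank[OF \<open>good u\<close>] by (intro subspace_eqI[OF A(1)]) auto
  ultimately show ?thesis by (auto simp: spans_def)
qed

text \<open>Up to the factor \<open>p\<close>, \<open>proj j p\<close> is the projection onto the eigenspace of \<open>zeta j\<close>.\<close>

primrec proj :: "nat \<Rightarrow> nat \<Rightarrow> complex vec \<Rightarrow> complex vec" where
  "proj j 0 v = 0\<^sub>v n"
| "proj j (Suc m) v = proj j m v + (1 / zeta j) ^ m \<cdot>\<^sub>v (T l' ^^ m) v"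

lemma T_l'_pow_carrier: "v \<in> carrier_vec n \<Longrightarrow> (T l' ^^ m) v \<in> carrier_vec n"
  using shift_pow_carrier[of v n, where k = k and m = "l' * m"] by (simp add: T_mult)

lemma proj_carrier: "v \<in> carrier_vec n \<Longrightarrow> proj j m v \<in> carrier_vec n"
  by (induction m) (auto simp: T_l'_pow_carrier)

lemma proj_in:
  assumes "V \<in> fixed_locus k l n" "v \<in> V"
  shows "proj j m v \<in> V"
proof -
  have "V \<in> Gr k n" using assms by (simp add: fixed_locus_def)
  then obtain A where A: "A \<in> carrier_mat k n" "V = row_span n A" using GrE by metis
  note closed = row_span_closed[OF A(1), folded A(2)]
  have "(T l' ^^ m) v \<in> V" for m using assms fixed_locus_T_closed by (induction m) auto
  then show ?thesis using closed assms(2) by (induction m) auto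
qed

lemma proj_eigenvector:
  assumes v: "v \<in> carrier_vec n"
  shows "T l' (proj j p v) = zeta j \<cdot>\<^sub>v proj j p v"
proof -
  \<comment> \<open>Applying the shift moves the partial sum on by one term. At \<open>m = p\<close>
    the term that enters equals \<open>v\<close>, the one that has left, so the full sum is an
    eigenvector.\<close>
  have *: "T l' (proj j m v) + zeta j \<cdot>\<^sub>v v = zeta j \<cdot>\<^sub>v proj j (Suc m) v" for m
  proof (induction m)
    case 0
    then show ?case using v by (simp add: shift_pow_zero)
  next
    case (Suc m)
    let ?w = "(T l' ^^ m) v"
    have c: "proj j m v \<in> carrier_vec n" "?w \<in> carrier_vec n" "T l' (proj j m v) \<in> carrier_vec n" "T l' ?w \<in> carrier_vec n"
      "proj j (Suc m) v \<in> carrier_vec n"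
      using proj_carrier[OF v] T_l'_pow_carrier[OF v] shift_pow_carrier by blast+
    have "T l' (proj j (Suc m) v) = T l' (proj j m v) + (1 / zeta j) ^ m \<cdot>\<^sub>v T l' ?w"
      using c by (simp add: shift_pow_add shift_pow_smult)
    then have "T l' (proj j (Suc m) v) + zeta j \<cdot>\<^sub>v v
        = (T l' (proj j m v) + zeta j \<cdot>\<^sub>v v) + (1 / zeta j) ^ m \<cdot>\<^sub>v T l' ?w"
      using c v by (intro eq_vecI) auto
    also have "\<dots> = zeta j \<cdot>\<^sub>v proj j (Suc m) v + (zeta j * (1 / zeta j) ^ Suc m) \<cdot>\<^sub>v T l' ?w"
      unfolding Suc by simp
    also have "\<dots> = zeta j \<cdot>\<^sub>v proj j (Suc (Suc m)) v"
      using c by (subst proj.simps(2)[of j "Suc m"]) (simp add: smult_add_distrib_vec smult_smult_assoc)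
    finally show ?case .
  qed
  have "(T l' ^^ p) v = (-1) ^ (k - 1) \<cdot>\<^sub>v v"
    using shift_pow_n[OF v] T_mult[of p v] n_eq by (simp add: mult.commute)
  then have "proj j (Suc p) v = proj j p v + v"
    using v by (simp add: smult_smult_assoc power_divide zeta_pow_p)
  with *[of p] have "T l' (proj j p v) + zeta j \<cdot>\<^sub>v v = zeta j \<cdot>\<^sub>v (proj j p v + v)"
    by simp
  also have "\<dots> = zeta j \<cdot>\<^sub>v proj j p v + zeta j \<cdot>\<^sub>v v"
    by (rule smult_add_distrib_vec[OF proj_carrier[OF v] v])
  finally have "T l' (proj j p v) + zeta j \<cdot>\<^sub>v v = zeta j \<cdot>\<^sub>v proj j p v + zeta j \<cdot>\<^sub>v v" .
  then have eq: "(T l' (proj j p v) + zeta j \<cdot>\<^sub>v v) $ c = (zeta j \<cdot>\<^sub>v proj j p v + zeta j \<cdot>\<^sub>v v) $ c" for c by simp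
  have "T l' (proj j p v) $ c = (zeta j \<cdot>\<^sub>v proj j p v) $ c" if "c < n" for c
    using eq[of c] that v proj_carrier[OF v, of j p] shift_pow_carrier[OF proj_carrier[OF v, of j p], where k = k and m = l'] by simp
  then show ?thesis
    using proj_carrier[OF v, of j p] shift_pow_carrier[OF proj_carrier[OF v, of j p], where k = k and m = l'] by (intro eq_vecI) auto
qed

lemma proj_of_eigenvector:
  assumes v: "v \<in> carrier_vec n" and T: "T l' v = zeta j \<cdot>\<^sub>v v"
  shows "proj j m v = of_nat m \<cdot>\<^sub>v v"
proof -
  have "(T l' ^^ m) v = zeta j ^ m \<cdot>\<^sub>v v" for m
  proof (induction m)
    case (Suc m)
    then show ?case using shift_pow_smult[OF v] T by (simp add: smult_smult_assoc mult.commute)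
  qed (use v in simp)
  then show ?thesis
  proof (induction m)
    case 0
    then show ?case using v by (intro eq_vecI) auto
  next
    case (Suc m)
    then show ?case using v by (intro eq_vecI) (auto simp: power_divide algebra_simps)
  qed
qed

lemma proj_index:
  assumes v: "v \<in> carrier_vec n" and "c < n"
  shows "proj j m v $ c = (\<Sum>t<m. (1 / zeta j) ^ t * T (l' * t) v $ c)"
  using assms
proof (induction m)
  case (Suc m)
  then show ?case using proj_carrier[OF v, of j m] T_l'_pow_carrier[OF v, of m] by (simp add: T_mult)
qed simp

end

section \<open>The totally positive point and the nonnegative points\<close>

lemma det_mat_expand:
  "Determinant.det (mat k k (\<lambda>(r, i). m r i)) = (\<Sum>\<sigma> | \<sigma> permutes {..<k}. signof \<sigma> * (\<Prod>i<k. m (\<sigma> i) i :: 'a::field))"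
proof -
  have "Determinant.det (mat k k (\<lambda>(r, i). m r i)) = bracket k (map (\<lambda>i r. m r i) [0..<k])"
    unfolding bracket_def by (intro arg_cong[of _ _ Determinant.det] eq_matI) auto
  also have "\<dots> = (\<Sum>\<sigma> | \<sigma> permutes {..<k}. signof \<sigma> * (\<Prod>i<k. m (\<sigma> i) i))"
    unfolding bracket_expand by (intro sum.cong refl arg_cong2[of _ _ _ _ "(*)"] prod.cong) auto
  finally show ?thesis .
qed

lemma det_scale_columns:
  "Determinant.det (mat k k (\<lambda>(r, i). d i * m r i :: 'a::field)) = (\<Prod>i<k. d i) * Determinant.det (mat k k (\<lambda>(r, i). m r i))"
  unfolding det_mat_expand sum_distrib_left by (intro sum.cong refl) (simp add: prod.distrib mult_ac)

lemma det_cnj: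
  "Determinant.det (mat k k (\<lambda>(r, i). cnj (m r i))) = cnj (Determinant.det (mat k k (\<lambda>(r, i). m r i)))"
  unfolding det_mat_expand by simp

text \<open>Each index below \<open>k\<close> occurs in \<open>k - 1\<close> of the pairs.\<close>

lemma prod_pairs: "(\<Prod>i<k. \<Prod>j<i. a i * a j) = (\<Prod>i<k. a i ^ (k - 1) :: 'a::comm_ring_1)"
proof (induction k)
  case (Suc k)
  show ?case
  proof (cases "k = 0")
    case False
    then have pow: "a i ^ (k - 1) * a i = a i ^ k" for i by (cases k) (simp_all add: mult.commute)
    have "(\<Prod>i<Suc k. \<Prod>j<i. a i * a j) = (\<Prod>i<k. a i ^ (k - 1)) * (\<Prod>j<k. a k * a j)"
      by (simp only: prod.lessThan_Suc Suc.IH)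
    also have "(\<Prod>j<k. a k * a j) = (\<Prod>j<k. a j) * a k ^ k"
      by (simp only: prod.distrib prod_constant card_lessThan mult.commute)
    also have "(\<Prod>i<k. a i ^ (k - 1)) * ((\<Prod>j<k. a j) * a k ^ k) = (\<Prod>i<k. a i ^ (k - 1) * a i) * a k ^ k"
      by (simp only: prod.distrib mult.assoc)
    finally show ?thesis by (simp only: pow prod.lessThan_Suc diff_Suc_1)
  qed simp
qed simp

context cyclic_setup
begin

text \<open>A root of \<open>zeta r\<close> of order \<open>l'\<close> whose n-th power is again
  \<open>(-1) ^ (k - 1)\<close>, and so an eigenvalue of the shift itself.\<close>

definition mu :: "nat \<Rightarrow> complex" where
  "mu r = cis ((real k - 1 - 2 * real r) * (pi / real n))"

text \<open>The span of the vectors \<open>(1, mu r, (mu r)\<^sup>2, \<dots>)\<close> is the totally positive point of the Grassmannian that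
  is fixed by the cyclic shift itself.\<close>

definition u0 :: "nat \<Rightarrow> nat \<Rightarrow> complex" where
  "u0 r a = mu r ^ a"

lemma mu_nonzero [simp]: "mu r \<noteq> 0" by (simp add: mu_def)

lemma mu_pow_l': "mu r ^ l' = zeta r"
proof -
  have "real l' * ((real k - 1 - 2 * real r) * (pi / real n)) = (real k - 1 - 2 * real r) * (pi / real p)"
    using n_eq l'2 by simp
  then show ?thesis by (simp only: mu_def zeta_def Complex.DeMoivre)
qed

lemma mu_pow_n: "mu r ^ n = (-1) ^ (k - 1)"
proof -
  have "mu r ^ n = (mu r ^ l') ^ p" by (metis n_eq mult.commute power_mult)
  then show ?thesis by (simp only: mu_pow_l' zeta_pow_p)
qed

lemma good_u0: "good u0"
  using l'2 by (auto simp: good_def u0_def intro!: exI[of _ 0])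

lemma col_u0: "col u0 c r = mu r ^ c"
proof -
  have "mu r ^ c = mu r ^ (l' * (c div l') + c mod l')" by simp
  then show ?thesis unfolding power_add power_mult mu_pow_l' by (simp add: col_def u0_def)
qed

text \<open>With the phases taken out of the columns, a minor is a Vandermonde determinant in the
  numbers \<open>z i\<close>. Each difference is \<open>e i * e j\<close> times -2i times the sine
  of \<open>\<theta> * (g i - g j)\<close>, positive because \<open>0 < g i - g j < n\<close>. The
  phases cancel against those taken out, and one -2i per pair of columns remains, independent of
  \<open>I\<close>.\<close>

lemma plucker_u0_positive:
  "\<exists>\<kappa>. \<kappa> \<noteq> 0 \<and> (\<forall>I. I \<subseteq> {1..n} \<and> card I = k \<longrightarrow> (\<exists>\<rho>>0. plucker (B u0) I = \<kappa> * complex_of_real \<rho>))"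
proof (intro exI[of _ "\<Prod>i<k. \<Prod>j<i. - 2 * \<i>"] conjI allI impI)
  let ?\<kappa> = "\<Prod>i<k. \<Prod>j<i. - 2 * \<i>"
  show "?\<kappa> \<noteq> 0" by simp
  fix I assume I: "I \<subseteq> {1..n} \<and> card I = k"
  obtain g where g: "strict_mono_on {..<k} g" "\<And>i. i < k \<Longrightarrow> g i < n" "Suc ` g ` {..<k} = I"
    using strict_mono_enumeration[of I n k] I by metis
  define \<theta> where "\<theta> = pi / real n"
  define e where "e = (\<lambda>i. cis (- (\<theta> * real (g i))))"
  define z where "z = (\<lambda>i. cis (- (2 * \<theta> * real (g i))))"
  define s where "s = (\<lambda>i j. sin (\<theta> * (real (g i) - real (g j))))"
  have s_pos: "s i j > 0" if "i < k" "j < i" for i j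
  proof -
    have "g j < g i" using g(1) that by (auto simp: strict_mono_on_def)
    moreover have "g i < n" using g(2) that by simp
    moreover have "\<theta> > 0" using n2 by (simp add: \<theta>_def)
    ultimately have "0 < \<theta> * (real (g i) - real (g j))" "\<theta> * (real (g i) - real (g j)) < \<theta> * real n"
      using mult_strict_left_mono[of "real (g i) - real (g j)" "real n" \<theta>] by simp_all
    moreover have "\<theta> * real n = pi" using n2 by (simp add: \<theta>_def)
    ultimately show ?thesis unfolding s_def by (intro sin_gt_zero) auto
  qed
  have diff: "z i - z j = (e i * e j) * (- 2 * \<i> * s i j)" for i j
  proof -
    define a b where "a = \<theta> * real (g i)" and "b = \<theta> * real (g j)"
    have "cis (- x) - cis x = - 2 * \<i> * sin x" for x by (simp add: complex_eq_iff)
    from this[of "a - b"] have "cis (- a) * cis (- b) * (cis (- (a - b)) - cis (a - b)) = (e i * e j) * (- 2 * \<i> * s i j)"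
      by (simp add: e_def s_def a_def b_def right_diff_distrib)
    moreover have "cis (- a) * cis (- b) * (cis (- (a - b)) - cis (a - b)) = cis (- (2 * a)) - cis (- (2 * b))"
      unfolding right_diff_distrib cis_mult by (intro arg_cong2[of _ _ _ _ "(-)"] arg_cong[of _ _ cis]) simp_all
    ultimately show ?thesis by (simp add: z_def a_def b_def mult.assoc)
  qed
  have "plucker (B u0) I = Determinant.det (mat k k (\<lambda>(r, i). mu r ^ g i))"
  proof -
    have "mat k k (\<lambda>(r, i). B u0 $$ (r, g i)) = mat k k (\<lambda>(r, i). mu r ^ g i)"
      using g(2) by (intro eq_matI) (auto simp: B_def col_u0)
    then show ?thesis using plucker_strict_mono[OF B_carrier g(1,2), of u0] g(3) by simp
  qed
  also have "\<dots> = Determinant.det (mat k k (\<lambda>(r, i). (1 / e i) ^ (k - 1) * z i ^ r))"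
  proof -
    have "mu r ^ g i = (1 / e i) ^ (k - 1) * z i ^ r" for r i
    proof -
      have "1 / e i = cis (\<theta> * real (g i))" by (simp add: e_def cis_divide[of 0, simplified])
      then have "(1 / e i) ^ (k - 1) * z i ^ r = cis (real (k - 1) * (\<theta> * real (g i)) + real r * (- (2 * \<theta> * real (g i))))"
        by (simp only: z_def Complex.DeMoivre cis_mult)
      also have "real (k - 1) * (\<theta> * real (g i)) + real r * (- (2 * \<theta> * real (g i)))
          = real (g i) * ((real k - 1 - 2 * real r) * \<theta>)"
        using k2 by (simp add: of_nat_diff algebra_simps)
      also have "cis \<dots> = mu r ^ g i" by (simp only: mu_def Complex.DeMoivre \<theta>_def)
      finally show ?thesis by simp
    qed
    then show ?thesis by simp
  qed
  also have "\<dots> = (\<Prod>i<k. (1 / e i) ^ (k - 1)) * Determinant.det (mat k k (\<lambda>(r, i). z i ^ r))"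
    by (rule det_scale_columns)
  also have "Determinant.det (mat k k (\<lambda>(r, i). z i ^ r)) = (\<Prod>i<k. \<Prod>j<i. z i - z j)"
  proof -
    have "z i \<noteq> z j" if "i < k" "j < i" for i j
      using diff[of i j] s_pos[OF that] by (auto simp: e_def)
    then have "inj_on z {..<k}" by (intro inj_onI) (metis lessThan_iff linorder_neqE_nat)
    then have "(\<Prod>i<k. \<Prod>j<i. z i - z j) = Determinant.det (mat k k (\<lambda>(i, j). z i ^ j))"
      by (rule det_vandermonde[symmetric])
    also have "\<dots> = Determinant.det (transpose_mat (mat k k (\<lambda>(i, j). z i ^ j)))"
      by (rule det_transpose[of _ k, symmetric]) simp
    also have "transpose_mat (mat k k (\<lambda>(i, j). z i ^ j)) = mat k k (\<lambda>(r, i). z i ^ r)"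
      by (intro eq_matI) auto
    finally show ?thesis by simp
  qed
  also have "\<dots> = (\<Prod>i<k. e i ^ (k - 1)) * (?\<kappa> * of_real (\<Prod>i<k. \<Prod>j<i. s i j))"
    unfolding diff prod.distrib prod_pairs[of e k, unfolded prod.distrib] by simp
  also have "(\<Prod>i<k. (1 / e i) ^ (k - 1)) * ((\<Prod>i<k. e i ^ (k - 1)) * (?\<kappa> * of_real (\<Prod>i<k. \<Prod>j<i. s i j)))
      = ?\<kappa> * of_real (\<Prod>i<k. \<Prod>j<i. s i j)"
  proof -
    have "(\<Prod>i<k. (1 / e i) ^ (k - 1)) * (\<Prod>i<k. e i ^ (k - 1)) = 1"
      by (simp add: prod.distrib[symmetric] power_mult_distrib[symmetric] e_def)
    then show ?thesis by (simp only: mult.assoc[symmetric] mult_1_left)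
  qed
  finally have "plucker (B u0) I = ?\<kappa> * of_real (\<Prod>i<k. \<Prod>j<i. s i j)" .
  moreover have "(\<Prod>i<k. \<Prod>j<i. s i j) > 0" using s_pos by (intro prod_pos) auto
  ultimately show "\<exists>\<rho>>0. plucker (B u0) I = ?\<kappa> * complex_of_real \<rho>" by blast
qed

text \<open>Cauchy-Binet against the totally positive point gives a sum of products of minors. The
  sign from sorting \<open>f\<close> occurs in both factors, so each product times \<open>c\<close>
  is a nonnegative multiple of \<open>cnj \<kappa>\<close>. No cancellation is possible, and full
  rank supplies a nonzero term.\<close>

lemma nonneg_pairing:
  assumes A: "A \<in> full_rank_mats k n" and c: "c \<noteq> 0"
    and nonneg: "\<And>I. I \<subseteq> {1..n} \<Longrightarrow> card I = k \<Longrightarrow> c * plucker A I \<in> \<real>\<^sub>\<ge>\<^sub>0"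
  shows "Determinant.det (mat k k (\<lambda>(r, s). \<Sum>d<n. A $$ (r, d) * cnj (mu s ^ d))) \<noteq> 0"
proof -
  have A': "A \<in> carrier_mat k n" using A by (simp add: full_rank_mats_def)
  obtain \<kappa> where \<kappa>: "\<kappa> \<noteq> 0" "\<And>I. I \<subseteq> {1..n} \<Longrightarrow> card I = k \<Longrightarrow> \<exists>\<rho>>0. plucker (B u0) I = \<kappa> * complex_of_real \<rho>"
    using plucker_u0_positive by blast
  let ?P = "{..<k} \<rightarrow>\<^sub>E {..<n}"
  let ?a = "\<lambda>f. Determinant.det (mat k k (\<lambda>(r, i). A $$ (r, f i)))"
  let ?b = "\<lambda>f. Determinant.det (mat k k (\<lambda>(r, i). cnj (mu r ^ f i)))"
  have "\<exists>t\<ge>0. c * (?a f * ?b f) = cnj \<kappa> * complex_of_real t \<and> (?a f \<noteq> 0 \<longrightarrow> t > 0)" if f: "f \<in> ?P" for f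
  proof -
    have lt: "\<And>i. i < k \<Longrightarrow> f i < n" using f by auto
    obtain I \<epsilon> where I: "I \<subseteq> {1..n}" "card I = k" and \<epsilon>: "\<epsilon> \<in> {-1, 0, 1::complex}"
      and eq: "\<And>A. A \<in> carrier_mat k n \<Longrightarrow> Determinant.det (mat k k (\<lambda>(r, i). A $$ (r, f i))) = \<epsilon> * plucker A I"
      by (rule det_columns_eq_plucker[where f = f and k = k and n = n]) (rule lt, assumption, rule k_le_n, rule that)
    obtain \<rho> where \<rho>: "\<rho> > 0" "plucker (B u0) I = \<kappa> * complex_of_real \<rho>" using \<kappa>(2)[OF I] by blast
    obtain t where t: "c * plucker A I = complex_of_real t" "t \<ge> 0"
      using nonneg[OF I] by (rule nonneg_Reals_cases)
    have "mat k k (\<lambda>(r, i). B u0 $$ (r, f i)) = mat k k (\<lambda>(r, i). mu r ^ f i)"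
      using lt by (intro eq_matI) (auto simp: B_def col_u0)
    then have "?b f = cnj (\<epsilon> * plucker (B u0) I)" using eq[OF B_carrier, of u0] by (simp only: det_cnj)
    then have "c * (?a f * ?b f) = (\<epsilon> * cnj \<epsilon>) * ((c * plucker A I) * cnj \<kappa> * \<rho>)"
      using eq[OF A'] \<rho>(2) by simp
    also have "\<epsilon> * cnj \<epsilon> = complex_of_real ((cmod \<epsilon>)\<^sup>2)" by (simp only: complex_norm_square)
    finally have "c * (?a f * ?b f) = cnj \<kappa> * complex_of_real ((cmod \<epsilon>)\<^sup>2 * t * \<rho>)"
      unfolding t(1) by simp
    moreover have "(cmod \<epsilon>)\<^sup>2 * t * \<rho> \<ge> 0" using t \<rho> by simp
    moreover have "(cmod \<epsilon>)\<^sup>2 * t * \<rho> > 0" if "?a f \<noteq> 0"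
    proof -
      have "\<epsilon> \<noteq> 0" "plucker A I \<noteq> 0" using that eq[OF A'] by auto
      then have "t \<noteq> 0" using t(1) c by auto
      then show ?thesis using t(2) \<rho>(1) \<open>\<epsilon> \<noteq> 0\<close> by simp
    qed
    ultimately show ?thesis by blast
  qed
  then have "\<exists>t. \<forall>f\<in>?P. t f \<ge> 0 \<and> c * (?a f * ?b f) = cnj \<kappa> * complex_of_real (t f) \<and> (?a f \<noteq> 0 \<longrightarrow> t f > 0)"
    by (intro bchoice ballI)
  then obtain t where t: "\<And>f. f \<in> ?P \<Longrightarrow> t f \<ge> 0" "\<And>f. f \<in> ?P \<Longrightarrow> c * (?a f * ?b f) = cnj \<kappa> * complex_of_real (t f)"
    "\<And>f. f \<in> ?P \<Longrightarrow> ?a f \<noteq> 0 \<Longrightarrow> t f > 0"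
    by blast
  have fin: "finite ?P" by (intro finite_PiE) auto
  \<comment> \<open>If all minors vanished, Cauchy-Binet for \<open>A\<close> and its conjugate
    would make the Gram matrix singular.\<close>
  have "\<exists>f\<in>?P. ?a f \<noteq> 0"
  proof (rule ccontr)
    assume "\<not> ?thesis"
    then have "(\<Sum>f\<in>?P. ?a f * Determinant.det (mat k k (\<lambda>(r, i). cnj (A $$ (r, f i))))) = 0" by simp
    then have "fact k * Determinant.det (gram k n A) = 0"
      unfolding gram_def using cauchy_binet[where k = k and n = n and a = "\<lambda>r c. A $$ (r, c)" and b = "\<lambda>r c. cnj (A $$ (r, c))"] by simp
    then show False using A full_rank_iff_det_gram[OF A'] by simp
  qed
  then obtain f where f: "f \<in> ?P" "?a f \<noteq> 0" by blast
  have "(\<Sum>f\<in>?P. t f) > 0" by (rule sum_pos2[where i = f]) (fact fin, fact f(1), rule t(3)[OF f], rule t(1))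
  have "c * (fact k * Determinant.det (mat k k (\<lambda>(r, s). \<Sum>d<n. A $$ (r, d) * cnj (mu s ^ d))))
      = c * (\<Sum>f\<in>?P. ?a f * ?b f)"
    using cauchy_binet[where k = k and n = n and a = "\<lambda>r c. A $$ (r, c)" and b = "\<lambda>r c. cnj (mu r ^ c)"] by simp
  also have "\<dots> = cnj \<kappa> * complex_of_real (\<Sum>f\<in>?P. t f)"
    using t(2) by (simp add: sum_distrib_left)
  also have "\<dots> \<noteq> 0" using \<open>(\<Sum>f\<in>?P. t f) > 0\<close> \<kappa>(1) by (simp del: of_real_sum)
  finally show ?thesis by auto
qed

text \<open>The Hermitian pairing with row \<open>j\<close> of \<open>B u0\<close>.\<close>

definition pairing :: "nat \<Rightarrow> complex vec \<Rightarrow> complex" where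
  "pairing j v = (\<Sum>c<n. v $ c * cnj (mu j ^ c))"

text \<open>The shift is unitary and the vector of powers of \<open>mu j\<close> is an eigenvector
  of it; the wrapped entry fits because of \<open>mu_pow_n\<close>.\<close>

lemma pairing_shift:
  assumes v: "v \<in> carrier_vec n"
  shows "pairing j (T m v) = mu j ^ m * pairing j v"
proof (induction m)
  case (Suc m)
  have *: "pairing j (cyclic_shift k n w) = mu j * pairing j w" for w
  proof -
    obtain h where h: "n = Suc h" using n2 by (cases n) auto
    have split: "(\<Sum>c<n. f c) = (\<Sum>c<h. f c) + f h" for f :: "nat \<Rightarrow> complex"
      unfolding h by (rule sum.lessThan_Suc)
    have split': "(\<Sum>c<n. f c) = f 0 + (\<Sum>c<h. f (Suc c))" for f :: "nat \<Rightarrow> complex"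
      unfolding h by (rule sum.lessThan_Suc_shift)
    have idx: "cyclic_shift k n w $ c = w $ Suc c" if "c < h" for c
      using that h by (simp add: cyclic_shift_def)
    have idx': "cyclic_shift k n w $ h = (-1) ^ (k - 1) * w $ 0"
      using h by (simp add: cyclic_shift_def)
    have cnj: "mu j * cnj (mu j) = 1" by (simp add: mu_def cis_cnj cis_mult)
    have cnj': "mu j * (cnj (mu j) * z) = z" for z using cnj by (simp add: mult.assoc[symmetric])
    have "mu j ^ n = mu j * mu j ^ h" unfolding power_Suc[symmetric] h[symmetric] ..
    moreover have "mu j ^ h * cnj (mu j ^ h) = 1" by (simp add: cnj power_mult_distrib[symmetric])
    ultimately have "mu j ^ n * cnj (mu j ^ h) = mu j" by (simp only: mult.assoc mult_1_right)
    then have last: "(-1) ^ (k - 1) * cnj (mu j ^ h) = mu j" by (simp only: mu_pow_n)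
    have "pairing j (cyclic_shift k n w) = (\<Sum>c<h. w $ Suc c * cnj (mu j ^ c)) + ((-1) ^ (k - 1) * w $ 0) * cnj (mu j ^ h)"
      unfolding pairing_def split idx' by (simp add: idx)
    also have "((-1) ^ (k - 1) * w $ 0) * cnj (mu j ^ h) = ((-1) ^ (k - 1) * cnj (mu j ^ h)) * w $ 0"
      by (simp only: mult_ac)
    also have "\<dots> = mu j * w $ 0" by (simp only: last)
    also have "(\<Sum>c<h. w $ Suc c * cnj (mu j ^ c)) + mu j * w $ 0 = mu j * pairing j w"
    proof -
      have "mu j * pairing j w = mu j * (w $ 0 * cnj (mu j ^ 0)) + (\<Sum>c<h. mu j * (w $ Suc c * cnj (mu j ^ Suc c)))"
        unfolding pairing_def split' by (simp only: distrib_left sum_distrib_left)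
      also have "(\<Sum>c<h. mu j * (w $ Suc c * cnj (mu j ^ Suc c))) = (\<Sum>c<h. w $ Suc c * cnj (mu j ^ c))"
      proof (rule sum.cong[OF refl])
        fix c
        have "mu j * (w $ Suc c * cnj (mu j ^ Suc c)) = (mu j * cnj (mu j)) * (w $ Suc c * cnj (mu j ^ c))"
          by (simp only: power_Suc complex_cnj_mult mult_ac)
        then show "mu j * (w $ Suc c * cnj (mu j ^ Suc c)) = w $ Suc c * cnj (mu j ^ c)"
          by (simp only: cnj mult_1_left)
      qed
      finally show ?thesis by (simp add: add.commute)
    qed
    finally show ?thesis .
  qed
  show ?case using Suc *[of "T m v"] by simp
qed simp

text \<open>The weight of each summand undoes the factor that the shift contributes, since the l'-th
  power of \<open>mu j\<close> is \<open>zeta j\<close>; so all \<open>m\<close> summands pair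
  equally.\<close>

lemma pairing_proj:
  assumes v: "v \<in> carrier_vec n"
  shows "pairing j (proj j m v) = of_nat m * pairing j v"
proof -
  have "pairing j (proj j m v) = (\<Sum>c<n. \<Sum>t<m. (1 / zeta j) ^ t * (T (l' * t) v $ c * cnj (mu j ^ c)))"
    unfolding pairing_def using proj_index[OF v]
    by (intro sum.cong refl) (simp add: sum_distrib_right mult.assoc)
  also have "\<dots> = (\<Sum>t<m. (1 / zeta j) ^ t * pairing j (T (l' * t) v))"
    by (subst sum.swap) (simp add: pairing_def sum_distrib_left)
  also have "\<dots> = (\<Sum>t<m. pairing j v)"
    by (intro sum.cong refl) (simp add: pairing_shift[OF v] power_mult mu_pow_l' power_divide)
  finally show ?thesis by simp
qed

text \<open>A zero column \<open>j\<close> would make the pairing determinant vanish, so some row of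
  \<open>A\<close> pairs nontrivially with the powers of \<open>mu j\<close>. Its projection to the
  eigenspace of \<open>zeta j\<close> keeps a nonzero pairing and lies in \<open>V\<close>.\<close>

lemma nonneg_in_spans:
  assumes V: "V \<in> fixed_locus k l n" and nn: "plucker_nonneg k n V"
  shows "V \<in> spans"
proof (rule spansI)
  show "V \<in> Gr k n" using V by (simp add: fixed_locus_def)
  fix j assume j: "j < k"
  obtain A c where A: "A \<in> full_rank_mats k n" "row_span n A = V" and c: "c \<noteq> 0"
    and nonneg: "\<And>I. I \<subseteq> {1..n} \<Longrightarrow> card I = k \<Longrightarrow> c * plucker A I \<in> \<real>\<^sub>\<ge>\<^sub>0"
    using nn unfolding plucker_nonneg_def by blast
  have A': "A \<in> carrier_mat k n" using A by (simp add: full_rank_mats_def)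
  let ?h = "\<lambda>r s. \<Sum>d<n. A $$ (r, d) * cnj (mu s ^ d)"
  have "\<exists>r<k. ?h r j \<noteq> 0"
  proof (rule ccontr)
    assume "\<not> ?thesis"
    then have 0: "?h r j = 0" if "r < k" for r using that by blast
    have pz: "(\<Prod>i<k. ?h (\<sigma> i) i) = 0" if "\<sigma> permutes {..<k}" for \<sigma>
    proof (rule prod_zero)
      have "\<sigma> j < k" using permutes_in_image[OF that, of j] j by simp
      then show "\<exists>i\<in>{..<k}. ?h (\<sigma> i) i = 0" using 0 j by blast
    qed simp
    have "Determinant.det (mat k k (\<lambda>(r, s). ?h r s)) = 0"
      unfolding det_mat_expand by (intro sum.neutral ballI) (simp only: mem_Collect_eq pz mult_zero_right)
    then show False using nonneg_pairing[OF A(1) c nonneg] by simp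
  qed
  then obtain r where r: "r < k" "?h r j \<noteq> 0" by blast
  let ?v = "row A r"
  have v: "?v \<in> carrier_vec n" "?v \<in> V" using A' r row_in_row_span[OF A'] A(2) by auto
  have "pairing j ?v = ?h r j" unfolding pairing_def using A' r by (intro sum.cong refl) auto
  then have "pairing j (proj j p ?v) \<noteq> 0" using pairing_proj[OF v(1)] p_pos r(2) by simp
  then have "proj j p ?v \<noteq> 0\<^sub>v n" by (auto simp: pairing_def)
  then show "\<exists>v\<in>V. v \<noteq> 0\<^sub>v n \<and> T l' v = zeta j \<cdot>\<^sub>v v"
    using proj_in[OF V v(2)] proj_eigenvector[OF v(1)] by blast
qed

lemma u0_nonneg: "plucker_nonneg k n (row_span n (B u0))"
proof -
  obtain \<kappa> where \<kappa>: "\<kappa> \<noteq> 0" "\<And>I. I \<subseteq> {1..n} \<Longrightarrow> card I = k \<Longrightarrow> \<exists>\<rho>>0. plucker (B u0) I = \<kappa> * complex_of_real \<rho>"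
    using plucker_u0_positive by blast
  have "1 / \<kappa> * plucker (B u0) I \<in> \<real>\<^sub>\<ge>\<^sub>0" if I: "I \<subseteq> {1..n}" "card I = k" for I
  proof -
    obtain \<rho> where "\<rho> > 0" "plucker (B u0) I = \<kappa> * complex_of_real \<rho>" using \<kappa>(2)[OF I] by blast
    then show ?thesis using \<kappa>(1) by simp
  qed
  then show ?thesis
    unfolding plucker_nonneg_def using \<kappa>(1) good_full_rank[OF good_u0] by (intro bexI[of _ "B u0"] conjI exI[of _ "1 / \<kappa>"]) auto
qed

lemma plucker_u0_nonzero: "I \<subseteq> {1..n} \<Longrightarrow> card I = k \<Longrightarrow> plucker (B u0) I \<noteq> 0"
  using plucker_u0_positive by (metis mult_eq_0_iff of_real_eq_0_iff less_irrefl)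

end

section \<open>The distinguished component\<close>

text \<open>The map that defines \<open>full_rank_topology\<close>, named so that open sets can be
  given by continuous functions of the entries.\<close>

definition entries :: "nat \<Rightarrow> nat \<Rightarrow> complex mat \<Rightarrow> nat \<times> nat \<Rightarrow> complex" where
  "entries k n A = (\<lambda>(i, j). if i < k \<and> j < n then A $$ (i, j) else 0)"

lemma openin_full_rank_nonzero:
  assumes "continuous_on UNIV G"
  shows "openin (full_rank_topology k n) {A \<in> full_rank_mats k n. G (entries k n A) \<noteq> (0::complex)}"
proof -
  have "open {h. G h \<noteq> 0}"
    using assms by (intro open_Collect_neq continuous_on_const)
  moreover have "{A \<in> full_rank_mats k n. G (entries k n A) \<noteq> 0} = entries k n -` {h. G h \<noteq> 0} \<inter> full_rank_mats k n"
    by auto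
  moreover have "full_rank_topology k n = pullback_topology (full_rank_mats k n) (entries k n) euclidean"
  proof -
    have "(\<lambda>A (i, j). if i < k \<and> j < n then A $$ (i, j) else 0) = entries k n"
      by (simp add: fun_eq_iff entries_def)
    then show ?thesis by (simp add: full_rank_topology_def)
  qed
  ultimately show ?thesis by (auto simp: openin_pullback_topology)
qed

lemma connectedin_clopen_subset:
  assumes C: "connectedin X C" and T: "openin X T" "closedin X T" and x: "x \<in> C" "x \<in> T"
  shows "C \<subseteq> T"
proof -
  have CX: "C \<subseteq> topspace X" and conn: "connected_space (subtopology X C)"
    using C by (simp_all add: connectedin_def)
  have "openin (subtopology X C) (T \<inter> C)" "closedin (subtopology X C) (T \<inter> C)"
    using T by (auto simp: openin_subtopology closedin_subtopology)
  then have "T \<inter> C = {} \<or> T \<inter> C = topspace (subtopology X C)"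
    using conn unfolding connected_space_clopen_in by blast
  then show ?thesis using x CX by (auto simp: topspace_subtopology)
qed

text \<open>A line through two points of the complex plane that avoids finitely many other points can be
  bent to avoid them: only finitely many parabolas \<open>t + i c t (1 - t)\<close> hit one of them.\<close>

lemma path_avoiding_finite:
  fixes Z :: "complex set"
  assumes Z: "finite Z" "0 \<notin> Z" "1 \<notin> Z"
  obtains \<gamma> :: "real \<Rightarrow> complex" where "continuous_on {0..1} \<gamma>" "\<gamma> 0 = 0" "\<gamma> 1 = 1"
    "\<And>t. t \<in> {0..1} \<Longrightarrow> \<gamma> t \<notin> Z"
proof -
  obtain c :: real where c: "c \<notin> (\<lambda>z. Im z / (Re z * (1 - Re z))) ` Z"
    using ex_new_if_finite[OF infinite_UNIV_char_0] Z(1) by (metis finite_imageI)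
  define \<gamma> where "\<gamma> = (\<lambda>t. Complex t (c * (t * (1 - t))))"
  have "\<gamma> t \<notin> Z" if t: "t \<in> {0..1}" for t
  proof
    assume "\<gamma> t \<in> Z"
    then have "t \<noteq> 0" "t \<noteq> 1" using Z by (auto simp: \<gamma>_def complex_eq_iff zero_complex.code one_complex.code)
    then have "c = Im (\<gamma> t) / (Re (\<gamma> t) * (1 - Re (\<gamma> t)))" by (simp add: \<gamma>_def)
    then show False using c \<open>\<gamma> t \<in> Z\<close> by blast
  qed
  moreover have "continuous_on {0..1} \<gamma>"
    unfolding \<gamma>_def Complex_eq by (intro continuous_intros)
  ultimately show ?thesis
    by (intro that[of \<gamma>]) (auto simp: \<gamma>_def zero_complex.code one_complex.code)
qed

context cyclic_setup
begin

lemma gram_det_expand: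
  "Determinant.det (gram k n A) = (\<Sum>\<sigma> | \<sigma> permutes {..<k}. signof \<sigma> *
     (\<Prod>i<k. \<Sum>c<n. A $$ (\<sigma> i, c) * cnj (A $$ (i, c))))"
  unfolding gram_def by (rule det_mat_expand)

text \<open>An entry of a shifted row in terms of the entries of the matrix, which makes its
  continuity visible.\<close>

definition shift_entry :: "(nat \<times> nat \<Rightarrow> complex) \<Rightarrow> nat \<Rightarrow> nat \<Rightarrow> nat \<Rightarrow> complex" where
  "shift_entry h m r c = (if c + m < n then h (r, c + m) else (-1) ^ (k - 1) * h (r, c + m - n))"

lemma continuous_shift_entry [continuous_intros]:
  "continuous_on UNIV (\<lambda>h. shift_entry h m r c)"
  unfolding shift_entry_def by (cases "c + m < n") (auto intro!: continuous_intros)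

lemma T_row_index:
  assumes A: "A \<in> carrier_mat k n" and "r < k" "c < n" "m \<le> n"
  shows "T m (row A r) $ c = shift_entry (entries k n A) m r c"
proof -
  have "row A r \<in> carrier_vec n" using A \<open>r < k\<close> by simp
  then show ?thesis
    using assms by (subst shift_pow_index) (auto simp: shift_entry_def entries_def)
qed

lemma row_span_index:
  assumes A: "A \<in> carrier_mat k n" and y: "y \<in> carrier_vec k" and "c < n" "m \<le> n"
  shows "T m (A\<^sup>T *\<^sub>v y) $ c = (\<Sum>r<k. shift_entry (entries k n A) m r c * y $ r)"
proof -
  have "A\<^sup>T *\<^sub>v y \<in> carrier_vec n" using A y by simp
  then show ?thesis
    using assms(3,4)
  proof (subst shift_pow_index)
    have e: "(A\<^sup>T *\<^sub>v y) $ d = (\<Sum>r<k. entries k n A (r, d) * y $ r)" if "d < n" for d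
      unfolding transpose_mult_vec_index[OF A y that] by (intro sum.cong refl) (simp add: entries_def that)
    show "(if c + m < n then (A\<^sup>T *\<^sub>v y) $ (c + m) else (-1) ^ (k - 1) * (A\<^sup>T *\<^sub>v y) $ (c + m - n))
        = (\<Sum>r<k. shift_entry (entries k n A) m r c * y $ r)"
      using assms(3,4) e[of "c + m"] e[of "c + m - n"]
      by (simp add: shift_entry_def sum_distrib_left mult.assoc del: index_mult_mat_vec)
  qed
qed

lemma l't_le_n: "t < p \<Longrightarrow> l' * t \<le> n"
  unfolding n_eq by (simp add: mult.commute)

definition proj_entry :: "nat \<Rightarrow> (nat \<times> nat \<Rightarrow> complex) \<Rightarrow> nat \<Rightarrow> nat \<Rightarrow> complex" where
  "proj_entry j h r c = (\<Sum>t<p. (1 / zeta j) ^ t * shift_entry h (l' * t) r c)"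

lemma proj_row_span_index:
  assumes A: "A \<in> carrier_mat k n" and y: "y \<in> carrier_vec k" and c: "c < n"
  shows "proj j p (A\<^sup>T *\<^sub>v y) $ c = (\<Sum>r<k. proj_entry j (entries k n A) r c * y $ r)"
proof -
  have v: "A\<^sup>T *\<^sub>v y \<in> carrier_vec n" using A y by simp
  have "proj j p (A\<^sup>T *\<^sub>v y) $ c = (\<Sum>t<p. (1 / zeta j) ^ t * (\<Sum>r<k. shift_entry (entries k n A) (l' * t) r c * y $ r))"
    unfolding proj_index[OF v c] using row_span_index[OF A y c l't_le_n] by (intro sum.cong refl) simp
  also have "\<dots> = (\<Sum>r<k. proj_entry j (entries k n A) r c * y $ r)"
    unfolding proj_entry_def sum_distrib_left sum_distrib_right
    by (subst sum.swap) (simp only: mult.assoc)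
  finally show ?thesis .
qed

lemma proj_row_index:
  assumes A: "A \<in> carrier_mat k n" and r: "r < k" and c: "c < n"
  shows "proj j p (row A r) $ c = proj_entry j (entries k n A) r c"
proof -
  have v: "row A r \<in> carrier_vec n" using A r by simp
  show ?thesis
    unfolding proj_index[OF v c] proj_entry_def using T_row_index[OF A r c l't_le_n]
    by (intro sum.cong refl) simp
qed

text \<open>By linearity the projection is nonzero on a row span as soon as it is nonzero on one of
  the rows, that is, when one of finitely many continuous functions of the entries does not
  vanish.\<close>

lemma openin_proj_nonzero:
  "openin (Gr_topology k n) {V \<in> Gr k n. \<forall>j<k. \<exists>v\<in>V. proj j p v \<noteq> 0\<^sub>v n}" (is "openin _ ?U")
proof -
  have eq: "{A \<in> full_rank_mats k n. row_span n A \<in> ?U}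
    = (\<Inter>j\<in>{..<k}. \<Union>r\<in>{..<k}. \<Union>c\<in>{..<n}. {A \<in> full_rank_mats k n. proj_entry j (entries k n A) r c \<noteq> 0})
       \<inter> topspace (full_rank_topology k n)" (is "?L = ?R")
  proof -
    have "(\<exists>v\<in>row_span n A. proj j p v \<noteq> 0\<^sub>v n) \<longleftrightarrow> (\<exists>r\<in>{..<k}. \<exists>c\<in>{..<n}. proj_entry j (entries k n A) r c \<noteq> 0)"
      if "A \<in> full_rank_mats k n" "j < k" for A j
    proof
      have A: "A \<in> carrier_mat k n" using that by (simp add: full_rank_mats_def)
      {
        assume "\<exists>v\<in>row_span n A. proj j p v \<noteq> 0\<^sub>v n"
        then obtain y where y: "y \<in> carrier_vec k" "proj j p (A\<^sup>T *\<^sub>v y) \<noteq> 0\<^sub>v n"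
          using row_span_eq[OF A] by auto
        have "dim_vec (proj j p (A\<^sup>T *\<^sub>v y)) = n" using proj_carrier[of "A\<^sup>T *\<^sub>v y" j p] A y by simp
        then obtain c where c: "c < n" "proj j p (A\<^sup>T *\<^sub>v y) $ c \<noteq> 0"
          using y(2) by (metis eq_vecI index_zero_vec)
        then have "(\<Sum>r<k. proj_entry j (entries k n A) r c * y $ r) \<noteq> 0"
          using proj_row_span_index[OF A y(1) c(1)] by simp
        then obtain r where "r \<in> {..<k}" "proj_entry j (entries k n A) r c * y $ r \<noteq> 0"
          by (rule sum.not_neutral_contains_not_neutral)
        then show "\<exists>r\<in>{..<k}. \<exists>c\<in>{..<n}. proj_entry j (entries k n A) r c \<noteq> 0" using c by auto
      next
        assume "\<exists>r\<in>{..<k}. \<exists>c\<in>{..<n}. proj_entry j (entries k n A) r c \<noteq> 0"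
        then obtain r c where rc: "r < k" "c < n" "proj j p (row A r) $ c \<noteq> 0"
          using proj_row_index[OF A] by auto
        then have "proj j p (row A r) \<noteq> 0\<^sub>v n" by auto
        then show "\<exists>v\<in>row_span n A. proj j p v \<noteq> 0\<^sub>v n" using row_in_row_span[OF A rc(1)] by blast
      }
    qed
    moreover have "row_span n A \<in> Gr k n" if "A \<in> full_rank_mats k n" for A
      using that by (auto simp: Gr_def)
    ultimately show ?thesis unfolding topspace_full_rank_topology by auto
  qed
  have "openin (full_rank_topology k n) {A \<in> full_rank_mats k n. proj_entry j (entries k n A) r c \<noteq> 0}" for j r c
    by (rule openin_full_rank_nonzero) (auto simp: proj_entry_def intro!: continuous_intros)
  then have "openin (full_rank_topology k n) ?R" by (intro openin_INT openin_Union ballI) auto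
  then show ?thesis unfolding openin_Gr_topology eq by auto
qed

text \<open>Its rows are the images of the rows of \<open>A\<close> under \<open>zeta j\<close>
  minus the shift, so its transposed kernel describes the eigenvectors in the row span.\<close>

definition eigen_mat :: "nat \<Rightarrow> complex mat \<Rightarrow> complex mat" where
  "eigen_mat j A = mat k n (\<lambda>(r, c). zeta j * A $$ (r, c) - shift_entry (entries k n A) l' r c)"

lemma eigen_mat_kernel:
  assumes A: "A \<in> carrier_mat k n" and y: "y \<in> carrier_vec k"
  shows "(eigen_mat j A)\<^sup>T *\<^sub>v y = 0\<^sub>v n \<longleftrightarrow> T l' (A\<^sup>T *\<^sub>v y) = zeta j \<cdot>\<^sub>v (A\<^sup>T *\<^sub>v y)"
proof -
  have M: "eigen_mat j A \<in> carrier_mat k n" by (simp add: eigen_mat_def)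
  have v: "A\<^sup>T *\<^sub>v y \<in> carrier_vec n" using A y by simp
  have "((eigen_mat j A)\<^sup>T *\<^sub>v y) $ c = zeta j * (A\<^sup>T *\<^sub>v y) $ c - T l' (A\<^sup>T *\<^sub>v y) $ c" if "c < n" for c
  proof -
    have "((eigen_mat j A)\<^sup>T *\<^sub>v y) $ c
        = (\<Sum>r<k. (zeta j * A $$ (r, c) - shift_entry (entries k n A) l' r c) * y $ r)"
      unfolding transpose_mult_vec_index[OF M y that] using that by (intro sum.cong refl) (simp add: eigen_mat_def)
    then show ?thesis
      unfolding row_span_index[OF A y that l'_le_n] transpose_mult_vec_index[OF A y that]
      by (simp add: sum_distrib_left left_diff_distrib sum_subtractf mult.assoc)
  qed
  moreover have "dim_vec ((eigen_mat j A)\<^sup>T *\<^sub>v y) = n" "dim_vec (T l' (A\<^sup>T *\<^sub>v y)) = n" "dim_vec (A\<^sup>T *\<^sub>v y) = n"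
    using M A shift_pow_carrier[OF v, where k = k and m = l'] by auto
  ultimately show ?thesis by (auto simp: vec_eq_iff)
qed

text \<open>No eigenvector for \<open>zeta j\<close> means that \<open>eigen_mat j A\<close> has
  full rank, and the Gram determinant turns this into the nonvanishing of a continuous
  function.\<close>

lemma openin_no_eigenvector:
  "openin (Gr_topology k n) {V \<in> Gr k n. \<exists>j<k. \<forall>v\<in>V. T l' v = zeta j \<cdot>\<^sub>v v \<longrightarrow> v = 0\<^sub>v n}" (is "openin _ ?U")
proof -
  define G where "G = (\<lambda>j h. \<Sum>\<sigma> | \<sigma> permutes {..<k}. signof \<sigma> *
     (\<Prod>i<k. \<Sum>c<n. (zeta j * h (\<sigma> i, c) - shift_entry h l' (\<sigma> i) c) * cnj (zeta j * h (i, c) - shift_entry h l' i c)))"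
  have G: "Determinant.det (gram k n (eigen_mat j A)) = G j (entries k n A)" for j A
    unfolding gram_det_expand G_def
  proof (intro sum.cong refl arg_cong2[of _ _ _ _ "(*)"] prod.cong)
    fix \<sigma> i c assume "\<sigma> \<in> {\<sigma>. \<sigma> permutes {..<k}}" "i \<in> {..<k}" "c \<in> {..<n}"
    then have "\<sigma> i < k" "i < k" "c < n" using permutes_in_image[of \<sigma> "{..<k}" i] by simp_all
    then show "eigen_mat j A $$ (\<sigma> i, c) = zeta j * entries k n A (\<sigma> i, c) - shift_entry (entries k n A) l' (\<sigma> i) c"
      and "cnj (eigen_mat j A $$ (i, c)) = cnj (zeta j * entries k n A (i, c) - shift_entry (entries k n A) l' i c)"
      by (simp_all add: eigen_mat_def entries_def)
  qed
  have "continuous_on UNIV (G j)" for j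
    unfolding G_def by (intro continuous_intros continuous_on_product_coordinates)
  then have "openin (full_rank_topology k n) {A \<in> full_rank_mats k n. Determinant.det (gram k n (eigen_mat j A)) \<noteq> 0}" for j
    unfolding G by (rule openin_full_rank_nonzero)
  then have "openin (full_rank_topology k n)
      (\<Union>j\<in>{..<k}. {A \<in> full_rank_mats k n. Determinant.det (gram k n (eigen_mat j A)) \<noteq> 0})" by auto
  moreover have "(\<Union>j\<in>{..<k}. {A \<in> full_rank_mats k n. Determinant.det (gram k n (eigen_mat j A)) \<noteq> 0})
      = {A \<in> full_rank_mats k n. row_span n A \<in> ?U}"
  proof -
    have "Determinant.det (gram k n (eigen_mat j A)) \<noteq> 0
        \<longleftrightarrow> (\<forall>v\<in>row_span n A. T l' v = zeta j \<cdot>\<^sub>v v \<longrightarrow> v = 0\<^sub>v n)" if "A \<in> full_rank_mats k n" for A j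
    proof -
      have A: "A \<in> carrier_mat k n" using that by (simp add: full_rank_mats_def)
      have M: "eigen_mat j A \<in> carrier_mat k n" by (simp add: eigen_mat_def)
      have "(y = 0\<^sub>v k) = (A\<^sup>T *\<^sub>v y = 0\<^sub>v n)" if "y \<in> carrier_vec k" for y
        using full_rank_iff_kernel[OF A] \<open>A \<in> full_rank_mats k n\<close> that A by (auto intro!: eq_vecI)
      then show ?thesis
        unfolding det_gram_nonzero_iff[OF M] row_span_eq[OF A] using eigen_mat_kernel[OF A] by auto
    qed
    moreover have "row_span n A \<in> Gr k n" if "A \<in> full_rank_mats k n" for A
      using that by (auto simp: Gr_def)
    ultimately show ?thesis by auto
  qed
  ultimately show ?thesis unfolding openin_Gr_topology by auto
qed

abbreviation fixed_topology :: "complex vec set topology" where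
  "fixed_topology \<equiv> subtopology (Gr_topology k n) (fixed_locus k l n)"

lemma topspace_fixed_topology: "topspace fixed_topology = fixed_locus k l n"
  by (auto simp: topspace_subtopology topspace_Gr_topology fixed_locus_def)

lemma spans_eigenvector:
  assumes "V \<in> spans" "j < k"
  obtains v where "v \<in> V" "v \<in> carrier_vec n" "v \<noteq> 0\<^sub>v n" "T l' v = zeta j \<cdot>\<^sub>v v"
proof -
  obtain u where u: "good u" "V = row_span n (B u)" using assms by (auto simp: spans_def)
  obtain a where a: "a < l'" "u j a \<noteq> 0" using u \<open>j < k\<close> by (auto simp: good_def)
  let ?v = "row (B u) j"
  have "?v $ a = u j a" using a l'_le_n \<open>j < k\<close> by (simp add: B_def col_def)
  then have "?v \<noteq> 0\<^sub>v n" using a l'_le_n by auto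
  then show ?thesis
    using that[of ?v] row_in_row_span[OF B_carrier \<open>j < k\<close>] u T_row_B[OF \<open>j < k\<close>] \<open>j < k\<close> by (simp add: B_def)
qed

text \<open>On the fixed locus the projection stays inside \<open>V\<close>, so a nonzero value is
  an eigenvector in \<open>V\<close>; conversely an eigenvector is multiplied by \<open>p\<close>
  and thus not killed.\<close>

lemma openin_spans: "openin fixed_topology spans"
proof -
  have "spans = {V \<in> Gr k n. \<forall>j<k. \<exists>v\<in>V. proj j p v \<noteq> 0\<^sub>v n} \<inter> fixed_locus k l n"
  proof (intro equalityI subsetI IntI)
    fix V assume V: "V \<in> spans"
    then show "V \<in> fixed_locus k l n" using spans_subset_fixed_locus by blast
    then have "V \<in> Gr k n" by (simp add: fixed_locus_def)
    moreover have "\<exists>v\<in>V. proj j p v \<noteq> 0\<^sub>v n" if "j < k" for j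
    proof -
      obtain v where v: "v \<in> V" "v \<in> carrier_vec n" "v \<noteq> 0\<^sub>v n" "T l' v = zeta j \<cdot>\<^sub>v v"
        by (rule spans_eigenvector[OF V \<open>j < k\<close>])
      have "proj j p v = of_nat p \<cdot>\<^sub>v v" by (rule proj_of_eigenvector[OF v(2,4)])
      moreover have "of_nat p \<cdot>\<^sub>v v \<noteq> 0\<^sub>v n"
      proof
        assume 0: "of_nat p \<cdot>\<^sub>v v = 0\<^sub>v n"
        have "v $ c = 0" if "c < n" for c
        proof -
          have "of_nat p * v $ c = 0" using arg_cong[OF 0, of "\<lambda>w. w $ c"] that v(2) by simp
          then show ?thesis using p_pos by simp
        qed
        then show False using v(2,3) by (auto intro: eq_vecI)
      qed
      ultimately show ?thesis using v(1) by auto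
    qed
    ultimately show "V \<in> {V \<in> Gr k n. \<forall>j<k. \<exists>v\<in>V. proj j p v \<noteq> 0\<^sub>v n}" by blast
  next
    fix V assume "V \<in> {V \<in> Gr k n. \<forall>j<k. \<exists>v\<in>V. proj j p v \<noteq> 0\<^sub>v n} \<inter> fixed_locus k l n"
    then have V: "V \<in> Gr k n" "V \<in> fixed_locus k l n" and ne: "\<And>j. j < k \<Longrightarrow> \<exists>v\<in>V. proj j p v \<noteq> 0\<^sub>v n" by auto
    obtain A where A: "A \<in> carrier_mat k n" "V = row_span n A" using GrE[OF V(1)] by metis
    show "V \<in> spans"
    proof (rule spansI[OF V(1)])
      fix j assume "j < k"
      then obtain v where v: "v \<in> V" "proj j p v \<noteq> 0\<^sub>v n" using ne by blast
      have "v \<in> carrier_vec n" using row_span_closed(1)[OF A(1)] v(1) A(2) by blast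
      then show "\<exists>v\<in>V. v \<noteq> 0\<^sub>v n \<and> T l' v = zeta j \<cdot>\<^sub>v v"
        using proj_in[OF V(2) v(1)] proj_eigenvector v(2) by blast
    qed
  qed
  then show ?thesis using openin_proj_nonzero by (auto simp: openin_subtopology)
qed

lemma closedin_spans: "closedin fixed_topology spans"
proof -
  let ?U = "{V \<in> Gr k n. \<exists>j<k. \<forall>v\<in>V. T l' v = zeta j \<cdot>\<^sub>v v \<longrightarrow> v = 0\<^sub>v n}"
  have "fixed_locus k l n - spans = ?U \<inter> fixed_locus k l n"
  proof (intro equalityI subsetI)
    fix V assume V: "V \<in> fixed_locus k l n - spans"
    then have Gr: "V \<in> Gr k n" by (simp add: fixed_locus_def)
    have "\<exists>j<k. \<forall>v\<in>V. T l' v = zeta j \<cdot>\<^sub>v v \<longrightarrow> v = 0\<^sub>v n"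
      using spansI[OF Gr] V by blast
    then show "V \<in> ?U \<inter> fixed_locus k l n" using V Gr by blast
  next
    fix V assume V: "V \<in> ?U \<inter> fixed_locus k l n"
    then have "V \<notin> spans" using spans_eigenvector[of V] by blast
    then show "V \<in> fixed_locus k l n - spans" using V by blast
  qed
  then have "openin fixed_topology (fixed_locus k l n - spans)"
    using openin_no_eigenvector by (auto simp: openin_subtopology)
  then show ?thesis
    unfolding closedin_def topspace_fixed_topology using spans_subset_fixed_locus by blast
qed

text \<open>The line from \<open>u\<close> to \<open>u'\<close> may pass through a parameter with a
  zero row. Since row \<open>r\<close> of \<open>u\<close> is nonzero, this happens for at most one
  complex \<open>s\<close> per row, and a path in the plane of \<open>s\<close> goes around these
  values.\<close>

lemma spans_connected:
  assumes V: "V \<in> spans" and V': "V' \<in> spans"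
  shows "\<exists>C. connectedin fixed_topology C \<and> V \<in> C \<and> V' \<in> C"
proof -
  obtain u u' where u: "good u" "V = row_span n (B u)" and u': "good u'" "V' = row_span n (B u')"
    using V V' by (auto simp: spans_def)
  define w where "w = (\<lambda>s r a. u r a + s * (u' r a - u r a))"
  define Z where "Z = (\<lambda>r. {s. \<forall>a<l'. w s r a = 0})"
  have "finite (Z r)" if r: "r < k" for r
  proof -
    obtain a where a: "a < l'" "u r a \<noteq> 0" using u(1) r by (auto simp: good_def)
    have "Z r \<subseteq> {u r a / (u r a - u' r a)}"
    proof
      fix s assume "s \<in> Z r"
      then have 0: "u r a + s * (u' r a - u r a) = 0" using a(1) by (auto simp: Z_def w_def)
      then have "u r a - u' r a \<noteq> 0" using a(2) by auto
      then show "s \<in> {u r a / (u r a - u' r a)}" using 0 by (simp add: field_simps)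
    qed
    then show ?thesis by (rule finite_subset) simp
  qed
  then have fin: "finite (\<Union>r<k. Z r)" by blast
  have good_iff: "good (w s) \<longleftrightarrow> s \<notin> (\<Union>r<k. Z r)" for s by (auto simp: good_def Z_def)
  have w01: "w 0 = u" "w 1 = u'" by (simp_all add: w_def)
  obtain \<gamma> :: "real \<Rightarrow> complex" where \<gamma>: "continuous_on {0..1} \<gamma>" "\<gamma> 0 = 0" "\<gamma> 1 = 1"
    "\<And>t. t \<in> {0..1} \<Longrightarrow> \<gamma> t \<notin> (\<Union>r<k. Z r)"
    using path_avoiding_finite[OF fin] good_iff[of 0] good_iff[of 1] w01 u(1) u'(1) by metis
  have good: "good (w (\<gamma> t))" if "t \<in> {0..1}" for t using \<gamma>(4)[OF that] good_iff by blast
  have "continuous_map (top_of_set {0..1}) (full_rank_topology k n) (\<lambda>t. B (w (\<gamma> t)))"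
    unfolding full_rank_topology_def
  proof (rule continuous_map_pullback')
    have "continuous_on {0..1} (\<lambda>t. w (\<gamma> t) r a)" for r a
      unfolding w_def by (intro continuous_intros \<gamma>(1))
    then have "continuous_on {0..1} (\<lambda>t. if i < k \<and> j < n then B (w (\<gamma> t)) $$ (i, j) else 0)" for i j
      by (cases "i < k \<and> j < n") (auto simp: B_def col_def intro!: continuous_intros)
    then show "continuous_map (top_of_set {0..1}) euclidean
        ((\<lambda>A (i, j). if i < k \<and> j < n then A $$ (i, j) else 0) \<circ> (\<lambda>t. B (w (\<gamma> t))))"
      unfolding comp_def continuous_map_iff_continuous
      by (intro continuous_on_coordinatewise_then_product) auto
    show "topspace (top_of_set {0..1}) \<subseteq> (\<lambda>t. B (w (\<gamma> t))) -` full_rank_mats k n"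
      using good good_full_rank by auto
  qed
  then have "continuous_map (top_of_set {0..1}) (Gr_topology k n) (row_span n \<circ> (\<lambda>t. B (w (\<gamma> t))))"
    using continuous_map_compose quotient_imp_continuous_map[OF quotient_map_row_span] by blast
  moreover have "connectedin (top_of_set {0..1::real}) {0..1}"
    by (simp add: connectedin_subtopology)
  ultimately have "connectedin (Gr_topology k n) ((row_span n \<circ> (\<lambda>t. B (w (\<gamma> t)))) ` {0..1})"
    by (rule connectedin_continuous_map_image)
  moreover have "(row_span n \<circ> (\<lambda>t. B (w (\<gamma> t)))) ` {0..1} \<subseteq> fixed_locus k l n"
  proof
    fix W assume "W \<in> (row_span n \<circ> (\<lambda>t. B (w (\<gamma> t)))) ` {0..1}"
    then obtain t where "t \<in> {0..1}" "W = row_span n (B (w (\<gamma> t)))" by auto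
    then have "W \<in> spans" using good unfolding spans_def by blast
    then show "W \<in> fixed_locus k l n" using spans_subset_fixed_locus by blast
  qed
  ultimately have "connectedin fixed_topology ((row_span n \<circ> (\<lambda>t. B (w (\<gamma> t)))) ` {0..1})"
    by (simp add: connectedin_subtopology)
  moreover have "V \<in> (row_span n \<circ> (\<lambda>t. B (w (\<gamma> t)))) ` {0..1}" "V' \<in> (row_span n \<circ> (\<lambda>t. B (w (\<gamma> t)))) ` {0..1}"
  proof -
    have "V = (row_span n \<circ> (\<lambda>t. B (w (\<gamma> t)))) 0" "V' = (row_span n \<circ> (\<lambda>t. B (w (\<gamma> t)))) 1"
      by (simp_all only: comp_def \<gamma>(2,3) w01 u(2) u'(2))
    then show "V \<in> (row_span n \<circ> (\<lambda>t. B (w (\<gamma> t)))) ` {0..1}" "V' \<in> (row_span n \<circ> (\<lambda>t. B (w (\<gamma> t)))) ` {0..1}"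
      by (auto intro: image_eqI[of _ _ 0] image_eqI[of _ _ 1] simp del: comp_apply)
  qed
  ultimately show ?thesis by blast
qed

text \<open>A connected clopen set is a component. Uniqueness of the described component holds
  because any candidate contains the nonnegative point given by \<open>u0\<close>.\<close>

lemma distinguished_component_eq: "distinguished_component k l n = spans"
proof -
  let ?V0 = "row_span n (B u0)"
  have V0: "?V0 \<in> spans" using good_u0 by (auto simp: spans_def)
  then have V0': "?V0 \<in> fixed_locus k l n" using spans_subset_fixed_locus by blast
  have C0: "connected_component_of_set fixed_topology ?V0 = spans"
  proof (intro equalityI subsetI)
    fix V assume "V \<in> connected_component_of_set fixed_topology ?V0"
    then obtain C where "connectedin fixed_topology C" "?V0 \<in> C" "V \<in> C"
      by (auto simp: connected_component_of_def)
    then show "V \<in> spans" using connectedin_clopen_subset[OF _ openin_spans closedin_spans _ V0] by blast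
  next
    fix V assume "V \<in> spans"
    then show "V \<in> connected_component_of_set fixed_topology ?V0"
      using spans_connected[OF V0] by (auto simp: connected_component_of_def)
  qed
  then have comp: "spans \<in> connected_components_of fixed_topology"
    unfolding connected_components_of_def topspace_fixed_topology using V0' by (metis image_eqI)
  show ?thesis
    unfolding distinguished_component_def
  proof (rule the_equality)
    show "spans \<in> connected_components_of fixed_topology \<and> {V \<in> fixed_locus k l n. plucker_nonneg k n V} \<subseteq> spans"
      using comp nonneg_in_spans by blast
    fix C assume C: "C \<in> connected_components_of fixed_topology \<and> {V \<in> fixed_locus k l n. plucker_nonneg k n V} \<subseteq> C"
    then have "?V0 \<in> C" using V0' u0_nonneg by blast
    moreover obtain W where "C = connected_component_of_set fixed_topology W"
      using C by (auto simp: connected_components_of_def)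
    ultimately have "C = connected_component_of_set fixed_topology ?V0"
      by (metis connected_component_of_equiv mem_Collect_eq)
    then show "C = spans" using C0 by simp
  qed
qed


section \<open>Laurent expansions\<close>

definition num_vars :: nat where
  "num_vars = num_mutable k l' + l'"

definition nz :: "(nat \<Rightarrow> nat \<Rightarrow> complex) \<Rightarrow> bool" where
  "nz u \<longleftrightarrow> (\<forall>m\<in>{1..num_vars}. x m u \<noteq> 0)"

text \<open>An inverse takes the default value 0 where \<open>x m\<close> vanishes, so functions are
  identified when they agree on \<open>nz\<close>; this is the purpose of the last rule.\<close>

inductive_set laurent :: "((nat \<Rightarrow> nat \<Rightarrow> complex) \<Rightarrow> complex) set" where
  laurent_const: "(\<lambda>u. c) \<in> laurent"
| laurent_x: "m \<in> {1..num_vars} \<Longrightarrow> x m \<in> laurent"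
| laurent_inverse: "m \<in> {1..num_vars} \<Longrightarrow> (\<lambda>u. 1 / x m u) \<in> laurent"
| laurent_add: "f \<in> laurent \<Longrightarrow> g \<in> laurent \<Longrightarrow> (\<lambda>u. f u + g u) \<in> laurent"
| laurent_mult: "f \<in> laurent \<Longrightarrow> g \<in> laurent \<Longrightarrow> (\<lambda>u. f u * g u) \<in> laurent"
| laurent_cong: "f \<in> laurent \<Longrightarrow> (\<And>u. nz u \<Longrightarrow> g u = f u) \<Longrightarrow> g \<in> laurent"

lemma laurent_sum: "(\<And>i. i \<in> A \<Longrightarrow> f i \<in> laurent) \<Longrightarrow> (\<lambda>u. \<Sum>i\<in>A. f i u) \<in> laurent"
proof (induction A rule: infinite_finite_induct)
  case (insert a A)
  then show ?case using laurent_add[of "f a" "\<lambda>u. \<Sum>i\<in>A. f i u"] by simp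
qed (simp_all add: laurent_const)

lemma laurent_prod: "(\<And>i. i \<in> A \<Longrightarrow> f i \<in> laurent) \<Longrightarrow> (\<lambda>u. \<Prod>i\<in>A. f i u) \<in> laurent"
proof (induction A rule: infinite_finite_induct)
  case (insert a A)
  then show ?case using laurent_mult[of "f a" "\<lambda>u. \<Prod>i\<in>A. f i u"] by simp
qed (simp_all add: laurent_const)

lemma laurent_diff: "f \<in> laurent \<Longrightarrow> g \<in> laurent \<Longrightarrow> (\<lambda>u. f u - g u) \<in> laurent"
  using laurent_add[OF _ laurent_mult[OF laurent_const[of "-1"]], of f g] by simp

lemma X_index:
  assumes "1 \<le> j" "j \<le> k" "1 \<le> i" "i \<le> l'"
  shows "\<exists>m\<in>{1..num_vars}. X j i = x m"
proof -
  have "(j - 1) * (l' - 1) \<le> (k - 1) * (l' - 1)" using assms by (intro mult_le_mono1) simp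
  then have "(j - 1) * (l' - 1) + i \<le> (k - 1) * (l' - 1) + l'" "1 \<le> (j - 1) * (l' - 1) + i" using assms by linarith+
  then have "(j - 1) * (l' - 1) + i \<in> {1..num_vars}" by (simp only: num_vars_def num_mutable_def atLeastAtMost_iff)
  then show ?thesis using x_eq_X[OF assms] by metis
qed

lemma X_nonzero: "nz u \<Longrightarrow> 1 \<le> j \<Longrightarrow> j \<le> k \<Longrightarrow> 1 \<le> i \<Longrightarrow> i \<le> l' \<Longrightarrow> X j i u \<noteq> 0"
  using X_index unfolding nz_def by metis

lemma X_laurent: "1 \<le> j \<Longrightarrow> j \<le> k \<Longrightarrow> 1 \<le> i \<Longrightarrow> i \<le> l' \<Longrightarrow> X j i \<in> laurent"
  using X_index laurent_x by metis

lemma X_inverse_laurent: "1 \<le> j \<Longrightarrow> j \<le> k \<Longrightarrow> 1 \<le> i \<Longrightarrow> i \<le> l' \<Longrightarrow> (\<lambda>u. 1 / X j i u) \<in> laurent"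
  using X_index laurent_inverse by metis

lemma X_11: "X 1 1 u = minor u (map (\<lambda>t. t * l') [0..<k])"
proof -
  have "[0..<k] = 0 # [1..<k]" using k2 by (simp add: upt_conv_Cons)
  then show ?thesis by (simp add: X_def xcols_def)
qed

text \<open>All columns will turn out to belong to this lattice, which is why their minors are Laurent polynomials.\<close>

definition lattice :: "((nat \<Rightarrow> nat \<Rightarrow> complex) \<Rightarrow> nat \<Rightarrow> complex) set" where
  "lattice = {v. \<exists>\<alpha>. (\<forall>t<k. \<alpha> t \<in> laurent) \<and>
     (\<forall>u. nz u \<longrightarrow> (\<forall>r<k. v u r = (\<Sum>t<k. \<alpha> t u * col u (t * l') r)))}"

lemma lattice_add_scale:
  assumes v: "v \<in> lattice" and w: "w \<in> lattice" and f: "f \<in> laurent"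
  shows "(\<lambda>u r. v u r + f u * w u r) \<in> lattice"
proof -
  obtain \<alpha> where \<alpha>: "\<forall>t<k. \<alpha> t \<in> laurent" "\<And>u r. nz u \<Longrightarrow> r < k \<Longrightarrow> v u r = (\<Sum>t<k. \<alpha> t u * col u (t * l') r)"
    using v by (auto simp: lattice_def simp del: col_mult)
  obtain \<beta> where \<beta>: "\<forall>t<k. \<beta> t \<in> laurent" "\<And>u r. nz u \<Longrightarrow> r < k \<Longrightarrow> w u r = (\<Sum>t<k. \<beta> t u * col u (t * l') r)"
    using w by (auto simp: lattice_def simp del: col_mult)
  have "v u r + f u * w u r = (\<Sum>t<k. (\<alpha> t u + f u * \<beta> t u) * col u (t * l') r)" if "nz u" "r < k" for u r
    unfolding \<alpha>(2)[OF that] \<beta>(2)[OF that] by (simp add: sum_distrib_left distrib_right sum.distrib mult.assoc)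
  moreover have "\<forall>t<k. (\<lambda>u. \<alpha> t u + f u * \<beta> t u) \<in> laurent"
    using \<alpha>(1) \<beta>(1) f by (intro allI impI laurent_add laurent_mult) auto
  ultimately show ?thesis unfolding lattice_def
    by (intro CollectI exI[of _ "\<lambda>t u. \<alpha> t u + f u * \<beta> t u"]) blast
qed

lemma lattice_zero: "(\<lambda>u r. 0) \<in> lattice"
  unfolding lattice_def by (intro CollectI exI[of _ "\<lambda>t u. 0"]) (simp add: laurent_const)

lemma lattice_cong:
  assumes "v \<in> lattice" "\<And>u r. nz u \<Longrightarrow> r < k \<Longrightarrow> w u r = v u r"
  shows "w \<in> lattice"
  using assms unfolding lattice_def by (auto simp del: col_mult)

lemma lattice_scale: "w \<in> lattice \<Longrightarrow> f \<in> laurent \<Longrightarrow> (\<lambda>u r. f u * w u r) \<in> lattice"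
  using lattice_add_scale[OF lattice_zero] by simp

lemma lattice_sum:
  assumes "\<And>i. i \<in> A \<Longrightarrow> w i \<in> lattice" "\<And>i. i \<in> A \<Longrightarrow> f i \<in> laurent"
  shows "(\<lambda>u r. \<Sum>i\<in>A. f i u * w i u r) \<in> lattice"
  using assms
proof (induction A rule: infinite_finite_induct)
  case (insert a A)
  have "(\<lambda>u r. (\<Sum>i\<in>A. f i u * w i u r) + f a u * w a u r) \<in> lattice"
    using insert by (intro lattice_add_scale) auto
  then show ?case by (rule lattice_cong) (simp only: sum.insert[OF insert.hyps] add.commute)
qed (simp_all add: lattice_zero)

lemma col_lt_k_lattice:
  assumes "t < k"
  shows "(\<lambda>u. col u (t * l')) \<in> lattice"
proof -
  have "col u (t * l') r = (\<Sum>s<k. of_bool (s = t) * col u (s * l') r)" for u r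
  proof -
    have "(\<Sum>s<k. of_bool (s = t) * col u (s * l') r) = (\<Sum>s<k. if s = t then col u (s * l') r else 0)"
      by (rule sum.cong) auto
    then show ?thesis using assms by (simp del: col_mult)
  qed
  then show ?thesis
    unfolding lattice_def by (intro CollectI exI[of _ "\<lambda>s u. of_bool (s = t)"] conjI allI impI laurent_const)
qed

text \<open>All \<open>zeta r\<close> are roots of one monic polynomial of degree \<open>k\<close>,
  so the coefficients of the reduction are constants independent of \<open>r\<close>.\<close>

lemma zeta_pow_k: "\<exists>a. \<forall>r<k. zeta r ^ k = (\<Sum>t<k. a t * zeta r ^ t)"
proof -
  define Q where "Q = (\<Prod>s<k. [:- zeta s, 1:])"
  have "degree (\<Prod>s<m. [:- zeta s, 1:]) = m \<and> coeff (\<Prod>s<m. [:- zeta s, 1:]) m = 1" for m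
  proof (induction m)
    case (Suc m)
    define A where "A = (\<Prod>s<m. [:- zeta s, 1:])"
    have A: "degree A = m" "coeff A m = 1" using Suc unfolding A_def by blast+
    then have "A \<noteq> 0" by auto
    then have "degree (A * [:- zeta m, 1:]) = Suc m" using degree_mult_eq[of A "[:- zeta m, 1:]"] A by simp
    moreover have "coeff (A * [:- zeta m, 1:]) (Suc m) = 1"
      using lead_coeff_mult[of A "[:- zeta m, 1:]"] A calculation by simp
    ultimately show ?case unfolding prod.lessThan_Suc A_def by (rule conjI)
  qed simp
  from this[of k] have Q: "degree Q = k" "coeff Q k = 1" unfolding Q_def by blast+
  have "zeta r ^ k = (\<Sum>t<k. - coeff Q t * zeta r ^ t)" if "r < k" for r
  proof -
    have "(\<Prod>s<k. poly [:- zeta s, 1:] (zeta r)) = 0"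
      by (rule prod_zero[OF finite_lessThan]) (intro bexI[of _ r]; use that in simp)
    then have "poly Q (zeta r) = 0" unfolding Q_def poly_prod .
    then have "(\<Sum>t<Suc k. coeff Q t * zeta r ^ t) = 0"
      unfolding poly_altdef lessThan_Suc_atMost by (simp only: Q(1))
    then have "(\<Sum>t<k. coeff Q t * zeta r ^ t) + zeta r ^ k = 0"
      by (simp only: sum.lessThan_Suc Q(2) mult_1)
    then have "zeta r ^ k = - (\<Sum>t<k. coeff Q t * zeta r ^ t)"
      by (simp only: eq_neg_iff_add_eq_0 add.commute)
    then show ?thesis by (simp only: sum_negf mult_minus_left)
  qed
  then show ?thesis by (intro exI[of _ "\<lambda>t. - coeff Q t"] allI impI)
qed

text \<open>Multiplication by \<open>zeta r\<close> moves the generator \<open>t * l'\<close> to the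
  next one; the column \<open>k * l'\<close> that leaves the range is brought back by
  \<open>zeta_pow_k\<close>.\<close>

lemma lattice_shift:
  assumes "v \<in> lattice"
  shows "(\<lambda>u r. zeta r * v u r) \<in> lattice"
proof -
  obtain \<alpha> where \<alpha>: "\<forall>t<k. \<alpha> t \<in> laurent" "\<And>u r. nz u \<Longrightarrow> r < k \<Longrightarrow> v u r = (\<Sum>t<k. \<alpha> t u * col u (t * l') r)"
    using assms by (auto simp: lattice_def simp del: col_mult)
  have next_col: "(\<lambda>u r. zeta r * col u (t * l') r) \<in> lattice" if "t < k" for t
  proof (cases "Suc t < k")
    case True
    show ?thesis
      by (rule lattice_cong[OF col_lt_k_lattice[OF True]]) (simp only: col_mult power_Suc mult.assoc)
  next
    case False
    then have t: "Suc t = k" using that by simp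
    obtain a where a: "\<And>r. r < k \<Longrightarrow> zeta r ^ k = (\<Sum>t<k. a t * zeta r ^ t)" using zeta_pow_k by blast
    have "(\<lambda>u r. \<Sum>s<k. a s * col u (s * l') r) \<in> lattice"
      using lattice_sum[of "{..<k}" "\<lambda>s u. col u (s * l')" "\<lambda>s u. a s"] col_lt_k_lattice laurent_const by simp
    then show ?thesis
    proof (rule lattice_cong)
      fix u r assume "r < k"
      have "zeta r * col u (t * l') r = zeta r ^ k * u r 0"
        using power_Suc[of "zeta r" t] unfolding t by (simp only: col_mult mult.assoc)
      then show "zeta r * col u (t * l') r = (\<Sum>s<k. a s * col u (s * l') r)"
        unfolding a[OF \<open>r < k\<close>] by (simp only: sum_distrib_right mult.assoc col_mult)
    qed
  qed
  have "(\<lambda>u r. \<Sum>t<k. \<alpha> t u * (zeta r * col u (t * l') r)) \<in> lattice"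
    using lattice_sum[of "{..<k}" "\<lambda>t u r. zeta r * col u (t * l') r" \<alpha>] next_col \<alpha>(1) by simp
  then show ?thesis
    by (rule lattice_cong) (simp only: \<alpha>(2) sum_distrib_left mult.left_commute)
qed

lemma col_shift_lattice:
  assumes "(\<lambda>u. col u c) \<in> lattice"
  shows "(\<lambda>u. col u (c + s * l')) \<in> lattice"
proof (induction s)
  case (Suc s)
  have "(\<lambda>u. col u (c + Suc s * l')) = (\<lambda>u r. zeta r * col u (c + s * l') r)"
    using col_shift[of _ "c + s * l'"] by (simp add: add.assoc add.commute[of l'])
  then show ?case using lattice_shift[OF Suc.IH] by simp
qed (use assms in simp)

lemma col_mult_lattice: "(\<lambda>u. col u (t * l')) \<in> lattice"
  using col_shift_lattice[of 0 t] col_lt_k_lattice[of 0] k2 by (simp del: col_mult)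

text \<open>The matrix is that of the generators times that of the coefficients, and the determinant
  of the first factor is the initial variable \<open>X 1 1\<close>.\<close>

lemma bracket_lattice:
  assumes len: "length vs = k" and vs: "set vs \<subseteq> lattice"
  shows "(\<lambda>u. bracket k (map (\<lambda>v. v u) vs)) \<in> laurent"
proof -
  have "\<forall>i<k. vs ! i \<in> lattice" using vs len by (metis nth_mem subsetD)
  then have "\<forall>i\<in>{..<k}. \<exists>\<alpha>. (\<forall>t<k. \<alpha> t \<in> laurent) \<and>
     (\<forall>u. nz u \<longrightarrow> (\<forall>r<k. (vs ! i) u r = (\<Sum>t<k. \<alpha> t u * col u (t * l') r)))"
    unfolding lattice_def by blast
  then have "\<exists>\<alpha>. \<forall>i\<in>{..<k}. (\<forall>t<k. \<alpha> i t \<in> laurent) \<and>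
     (\<forall>u. nz u \<longrightarrow> (\<forall>r<k. (vs ! i) u r = (\<Sum>t<k. \<alpha> i t u * col u (t * l') r)))"
    by (rule bchoice)
  then obtain \<alpha> where \<alpha>: "\<And>i t. i < k \<Longrightarrow> t < k \<Longrightarrow> \<alpha> i t \<in> laurent"
    "\<And>i u r. i < k \<Longrightarrow> nz u \<Longrightarrow> r < k \<Longrightarrow> (vs ! i) u r = (\<Sum>t<k. \<alpha> i t u * col u (t * l') r)"
    by blast
  have "(\<lambda>u. X 1 1 u * (\<Sum>\<sigma> | \<sigma> permutes {..<k}. signof \<sigma> * (\<Prod>i<k. \<alpha> i (\<sigma> i) u))) \<in> laurent"
  proof (rule laurent_mult)
    show "X 1 1 \<in> laurent" using k2 l'2 by (intro X_laurent) auto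
    show "(\<lambda>u. \<Sum>\<sigma> | \<sigma> permutes {..<k}. signof \<sigma> * (\<Prod>i<k. \<alpha> i (\<sigma> i) u)) \<in> laurent"
    proof (rule laurent_sum, rule laurent_mult[OF laurent_const], rule laurent_prod)
      fix \<sigma> i assume "\<sigma> \<in> {\<sigma>. \<sigma> permutes {..<k}}" "i \<in> {..<k}"
      then have "\<sigma> i < k" "i < k" using permutes_in_image[of \<sigma> "{..<k}" i] by simp_all
      then show "\<alpha> i (\<sigma> i) \<in> laurent" using \<alpha>(1) by blast
    qed
  qed
  then show ?thesis
  proof (rule laurent_cong)
    fix u assume u: "nz u"
    let ?W = "mat k k (\<lambda>(r, t). col u (t * l') r)" and ?C = "mat k k (\<lambda>(t, i). \<alpha> i t u)"
    have "mat k k (\<lambda>(r, i). (map (\<lambda>v. v u) vs ! i) r) = ?W * ?C"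
      using \<alpha>(2)[OF _ u] len
      by (intro eq_matI) (auto simp: scalar_prod_def lessThan_atLeast0 mult.commute simp del: col_mult)
    then have "bracket k (map (\<lambda>v. v u) vs) = Determinant.det ?W * Determinant.det ?C"
      unfolding bracket_def by (simp only: det_mult[of _ k] mat_carrier)
    also have "Determinant.det ?W = X 1 1 u"
      unfolding X_11 minor_def bracket_def
      by (intro arg_cong[of _ _ Determinant.det] eq_matI) (auto simp del: col_mult)
    also have "Determinant.det ?C = (\<Sum>\<sigma> | \<sigma> permutes {..<k}. signof \<sigma> * (\<Prod>i<k. \<alpha> i (\<sigma> i) u))"
      by (rule det_mat_expand)
    finally show "bracket k (map (\<lambda>v. v u) vs) = X 1 1 u * (\<Sum>\<sigma> | \<sigma> permutes {..<k}. signof \<sigma> * (\<Prod>i<k. \<alpha> i (\<sigma> i) u))" .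
  qed
qed

text \<open>Membership in the lattice modulo the span of \<open>W u\<close> is tested on the linear functionals that vanish
  on \<open>W u\<close>.\<close>

definition lattice_mod :: "((nat \<Rightarrow> nat \<Rightarrow> complex) \<Rightarrow> (nat \<Rightarrow> complex) set) \<Rightarrow> ((nat \<Rightarrow> nat \<Rightarrow> complex) \<Rightarrow> nat \<Rightarrow> complex) set" where
  "lattice_mod W = {v. \<exists>y\<in>lattice. \<forall>u c. nz u \<longrightarrow> (\<forall>w\<in>W u. (\<Sum>r<k. c r * w r) = 0) \<longrightarrow>
     (\<Sum>r<k. c r * v u r) = (\<Sum>r<k. c r * y u r)}"

lemma lattice_subset_mod: "v \<in> lattice \<Longrightarrow> v \<in> lattice_mod W"
  by (auto simp: lattice_mod_def)

lemma lattice_mod_mono: "v \<in> lattice_mod W \<Longrightarrow> (\<And>u. W u \<subseteq> W' u) \<Longrightarrow> v \<in> lattice_mod W'"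
  unfolding lattice_mod_def by blast

lemma lattice_mod_empty:
  assumes "v \<in> lattice_mod (\<lambda>u. {})"
  shows "v \<in> lattice"
proof -
  obtain y where y: "y \<in> lattice" "\<And>u c. nz u \<Longrightarrow> (\<Sum>r<k. c r * v u r) = (\<Sum>r<k. c r * y u r)"
    using assms by (auto simp: lattice_mod_def)
  show ?thesis
  proof (rule lattice_cong[OF y(1)])
    fix u r assume "nz u" "r < k"
    then show "v u r = y u r"
      using y(2)[of u "\<lambda>s. if s = r then 1 else 0"] by (simp add: if_distrib[of "\<lambda>x. x * _"] cong: if_cong)
  qed
qed

text \<open>Replacing the columns of such a list by lattice vectors, from the left, does not change a determinant.\<close>

primrec triangular :: "((nat \<Rightarrow> nat \<Rightarrow> complex) \<Rightarrow> nat \<Rightarrow> complex) list \<Rightarrow> bool" where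
  "triangular [] \<longleftrightarrow> True"
| "triangular (v # vs) \<longleftrightarrow> v \<in> lattice_mod (\<lambda>u. (\<lambda>w. w u) ` set vs) \<and> triangular vs"

text \<open>Here \<open>P\<close> holds the columns already replaced. The bracket is a functional of
  the next column that vanishes on all later ones, by repetition, so that column can be exchanged
  for its lattice representative.\<close>

lemma triangular_bracket:
  assumes "triangular vs"
  shows "\<exists>ys. length ys = length vs \<and> set ys \<subseteq> lattice \<and> (\<forall>P u. nz u \<longrightarrow> length P + length vs = k \<longrightarrow>
     bracket k (P @ map (\<lambda>v. v u) vs) = bracket k (P @ map (\<lambda>v. v u) ys))"
  using assms
proof (induction vs)
  case (Cons v vs)
  then obtain ys where ys: "length ys = length vs" "set ys \<subseteq> lattice"
    "\<And>P u. nz u \<Longrightarrow> length P + length vs = k \<Longrightarrow> bracket k (P @ map (\<lambda>v. v u) vs) = bracket k (P @ map (\<lambda>v. v u) ys)"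
    by auto
  obtain y where y: "y \<in> lattice" "\<And>u c. nz u \<Longrightarrow> (\<forall>w\<in>set vs. (\<Sum>r<k. c r * w u r) = 0) \<Longrightarrow>
     (\<Sum>r<k. c r * v u r) = (\<Sum>r<k. c r * y u r)"
    using Cons.prems by (auto simp: lattice_mod_def)
  have "bracket k (P @ map (\<lambda>v. v u) (v # vs)) = bracket k (P @ map (\<lambda>v. v u) (y # ys))"
    if u: "nz u" and len: "length P + length (v # vs) = k" for P u
  proof -
    let ?Z = "map (\<lambda>v. v u) vs"
    obtain c where c: "\<And>v. bracket k (P @ v # ?Z) = (\<Sum>r<k. c r * v r)"
      using bracket_linear[of P ?Z k] len by auto
    have "(\<Sum>r<k. c r * w u r) = 0" if w: "w \<in> set vs" for w
    proof -
      obtain i where i: "i < length vs" "vs ! i = w" using w by (auto simp: in_set_conv_nth)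
      have "bracket k (P @ w u # ?Z) = 0"
        by (rule bracket_repeat[of _ k "length P" "length P + Suc i"]) (use i len in \<open>auto simp: nth_append\<close>)
      then show ?thesis by (simp add: c)
    qed
    then have "bracket k (P @ v u # ?Z) = bracket k (P @ y u # ?Z)"
      unfolding c using y(2)[OF u] by blast
    also have "\<dots> = bracket k ((P @ [y u]) @ map (\<lambda>v. v u) ys)"
      using ys(3)[OF u, of "P @ [y u]"] len by simp
    finally show ?thesis by simp
  qed
  then show ?case using ys y(1) by (intro exI[of _ "y # ys"]) auto
qed auto

lemma triangular_laurent:
  assumes "triangular vs" "length vs = k"
  shows "(\<lambda>u. bracket k (map (\<lambda>v. v u) vs)) \<in> laurent"
proof -
  obtain ys where ys: "length ys = length vs" "set ys \<subseteq> lattice"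
    "\<And>P u. nz u \<Longrightarrow> length P + length vs = k \<Longrightarrow> bracket k (P @ map (\<lambda>v. v u) vs) = bracket k (P @ map (\<lambda>v. v u) ys)"
    using triangular_bracket[OF assms(1)] by blast
  have "(\<lambda>u. bracket k (map (\<lambda>v. v u) ys)) \<in> laurent" using bracket_lattice ys assms(2) by simp
  then show ?thesis by (rule laurent_cong) (use ys(3)[of _ "[]"] assms(2) in simp)
qed

lemma triangular_append:
  assumes "triangular ws" "\<And>i. i < length vs \<Longrightarrow> vs ! i \<in> lattice_mod (\<lambda>u. (\<lambda>w. w u) ` set (drop (Suc i) vs @ ws))"
  shows "triangular (vs @ ws)"
  using assms(2)
proof (induction vs)
  case (Cons v vs)
  have "triangular (vs @ ws)"
    by (rule Cons.IH) (use Cons.prems[of "Suc _"] in simp)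
  then show ?case using Cons.prems[of 0] by simp
qed (use assms(1) in simp)

lemma triangular_lattice: "set vs \<subseteq> lattice \<Longrightarrow> triangular vs"
  by (induction vs) (auto intro: lattice_subset_mod)

abbreviation tail :: "nat \<Rightarrow> (nat \<Rightarrow> nat \<Rightarrow> complex) \<Rightarrow> (nat \<Rightarrow> complex) set" where
  "tail j u \<equiv> (\<lambda>t. col u (t * l')) ` {j..<k}"

text \<open>Where \<open>X 1 1\<close> does not vanish the columns \<open>t * l'\<close> with
  \<open>t < k\<close> form a basis; a functional that kills them is zero, and 0 represents every
  vector.\<close>

lemma everything_mod_all: "v \<in> lattice_mod (tail 0)"
  unfolding lattice_mod_def
proof (intro CollectI bexI[of _ "\<lambda>u r. 0"] allI impI)
  fix u c assume u: "nz u" and c: "\<forall>w\<in>tail 0 u. (\<Sum>r<k. c r * w r) = 0"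
  let ?W = "mat k k (\<lambda>(r, t). col u (t * l') r)"
  have W: "?W \<in> carrier_mat k k" by simp
  have "Determinant.det ?W = X 1 1 u"
    unfolding X_11 minor_def bracket_def
    by (intro arg_cong[of _ _ Determinant.det] eq_matI) (auto simp del: col_mult)
  then have "Determinant.det (?W\<^sup>T) \<noteq> 0" using X_nonzero[OF u, of 1 1] k2 l'2 det_transpose[OF W] by simp
  moreover have "?W\<^sup>T *\<^sub>v vec k c = 0\<^sub>v k"
  proof (rule eq_vecI)
    fix t assume t: "t < dim_vec (0\<^sub>v k)"
    have "(?W\<^sup>T *\<^sub>v vec k c) $ t = (\<Sum>r<k. c r * col u (t * l') r)"
      using t by (subst transpose_mult_vec_index[OF W]) (auto simp: mult.commute simp del: col_mult)
    then show "(?W\<^sup>T *\<^sub>v vec k c) $ t = 0\<^sub>v k $ t" using c t by (simp del: col_mult)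
  qed simp
  ultimately have "vec k c = 0\<^sub>v k"
    using det_0_iff_vec_prod_zero_field[of "?W\<^sup>T" k] W vec_carrier[of k c] by (meson transpose_carrier_mat)
  then have "c r = 0" if "r < k" for r using that by (metis index_vec index_zero_vec(1))
  then show "(\<Sum>r<k. c r * v u r) = (\<Sum>r<k. c r * 0)" by simp
qed (rule lattice_zero)

text \<open>Multiplying the relation for \<open>v\<close> by the \<open>zeta r\<close> expresses the
  column through the lattice modulo the multiples \<open>j + 1\<close> to \<open>k\<close> of
  \<open>l'\<close>. One multiple too many has appeared, \<open>k * l'\<close>, and its coefficient
  is determined by Cramer's rule with the functional \<open>\<phi>\<close>.\<close>

lemma lattice_mod_step:
  assumes j: "j < k" and d: "1 \<le> d" "d < l'"
    and v: "v \<in> lattice_mod (tail j)" and shift: "\<And>u r. col u (j * l' + d) r = zeta r * v u r"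
    and smaller: "\<And>i c. i \<le> j \<Longrightarrow> c < l' \<Longrightarrow> i < j \<or> c < d \<Longrightarrow> (\<lambda>u. col u (i * l' + c)) \<in> lattice_mod (tail (Suc i))"
  shows "(\<lambda>u. col u (j * l' + d)) \<in> lattice_mod (tail (Suc j))"
proof -
  let ?C = "\<lambda>c u. col u c"
  define I where "I = [j * l' + d - j..<j * l' + d]"
  define Z where "Z = map (\<lambda>t. t * l') [Suc j..<k]"
  have jl: "j \<le> j * l'" using l'2 by simp
  then have lenI: "length I = j" unfolding I_def length_upt using d by linarith
  have len: "length I + length Z + 1 = k" unfolding lenI using j by (simp add: Z_def)
  obtain y where y: "y \<in> lattice" "\<And>u c. nz u \<Longrightarrow> (\<forall>w\<in>tail j u. (\<Sum>r<k. c r * w r) = 0) \<Longrightarrow>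
     (\<Sum>r<k. c r * v u r) = (\<Sum>r<k. c r * y u r)"
    using v by (auto simp: lattice_mod_def simp del: col_mult)
  define y' where "y' = (\<lambda>u r. zeta r * y u r)"
  have y'L: "y' \<in> lattice" unfolding y'_def by (rule lattice_shift[OF y(1)])
  have y': "(\<Sum>r<k. c r * col u (j * l' + d) r) = (\<Sum>r<k. c r * y' u r)"
    if u: "nz u" and c: "\<And>t. Suc j \<le> t \<Longrightarrow> t \<le> k \<Longrightarrow> (\<Sum>r<k. c r * col u (t * l') r) = 0" for u c
  proof -
    have "\<forall>w\<in>tail j u. (\<Sum>r<k. (c r * zeta r) * w r) = 0"
    proof
      fix w assume "w \<in> tail j u"
      then obtain t where "j \<le> t" "t < k" "w = col u (t * l')" by auto
      then have "(\<Sum>r<k. (c r * zeta r) * w r) = (\<Sum>r<k. c r * col u (Suc t * l') r)"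
        by (simp only: col_mult power_Suc mult.assoc)
      then show "(\<Sum>r<k. (c r * zeta r) * w r) = 0" using c[of "Suc t"] \<open>j \<le> t\<close> \<open>t < k\<close> by (metis Suc_leI Suc_le_mono)
    qed
    from y(2)[OF u this] show ?thesis by (simp add: shift y'_def mult.assoc)
  qed
  \<comment> \<open>The minor \<open>X (Suc j) (Suc d)\<close> with its column
    \<open>j * l' + d\<close> left free; it vanishes on the columns in \<open>Z\<close>.\<close>
  define \<phi> where "\<phi> = (\<lambda>u v. bracket k (map (col u) I @ v # map (col u) Z))"
  have \<phi>_linear: "\<exists>a. \<forall>v. \<phi> u v = (\<Sum>r<k. a r * v r)" for u
    using bracket_linear[of "map (col u) I" "map (col u) Z" k] len unfolding \<phi>_def by (metis length_map)
  have \<phi>_col: "\<phi> u (col u (j * l' + d)) = X (Suc j) (Suc d) u" for u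
  proof -
    have "xcols (Suc j) (Suc d) = I @ (j * l' + d) # Z"
      using jl by (simp add: xcols_def I_def Z_def)
    then show ?thesis by (simp add: \<phi>_def X_def minor_def)
  qed
  \<comment> \<open>Up to sign the value of \<open>\<phi>\<close> at the column
    \<open>k * l'\<close>, because the columns \<open>I\<close>, \<open>Z\<close>,
    \<open>k * l'\<close> are those of \<open>X j d\<close> moved by \<open>l'\<close>; for
    \<open>j = 0\<close> the list \<open>I\<close> is empty and \<open>X 1 1\<close>
    results.\<close>
  define pivot where "pivot = (if j = 0 then X 1 1 else X j d)"
  have \<phi>_pivot: "\<phi> u (col u (k * l')) = (-1) ^ length Z * pivot u" for u
  proof -
    have "\<phi> u (col u (k * l')) = (-1) ^ length Z * minor u (I @ Z @ [k * l'])"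
      using bracket_move[of "map (col u) I" "map (col u) Z" "[]" k "col u (k * l')"] len
      by (simp add: \<phi>_def minor_def del: col_mult)
    also have "I @ Z @ [k * l'] = [j * l' + d - j..<j * l' + d] @ map (\<lambda>t. t * l') [j + 1..<k + 1]"
      using j by (simp add: I_def Z_def)
    also have "minor u \<dots> = pivot u"
    proof (cases "j = 0")
      case True
      have "X 1 1 u = minor u (map (\<lambda>c. c + l') (map (\<lambda>t. t * l') [0..<k]))"
        unfolding X_11 by (rule minor_shift[symmetric]) simp
      then show ?thesis unfolding map_mult_Suc using True by (simp add: pivot_def)
    next
      case False
      then show ?thesis using X_up[of j d u] j d by (simp add: pivot_def)
    qed
    finally show ?thesis .
  qed
  have pivot: "pivot u \<noteq> 0" if "nz u" for u
    using X_nonzero[OF that] j d k2 l'2 by (simp add: pivot_def)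
  have pivot_inv: "(\<lambda>u. 1 / pivot u) \<in> laurent"
    using X_inverse_laurent[of 1 1] X_inverse_laurent[of j d] j d k2 l'2 by (cases "j = 0") (simp_all add: pivot_def)
  have "(\<lambda>u. \<phi> u (y' u)) \<in> laurent"
  proof -
    let ?vs = "map ?C I" and ?ws = "y' # map ?C Z"
    have "triangular (?vs @ ?ws)"
    proof (rule triangular_append)
      show "triangular ?ws"
        by (rule triangular_lattice) (use y'L col_mult_lattice in \<open>auto simp: Z_def simp del: col_mult\<close>)
      fix i assume i: "i < length ?vs"
      \<comment> \<open>The column \<open>c = s * l' + e\<close> is in the lattice modulo the larger
        multiples of \<open>l'\<close>; those up to \<open>j * l'\<close> occur further right in
        \<open>I\<close>, the others in \<open>Z\<close>. Hence the list is triangular.\<close>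
      define c where "c = I ! i"
      define s e where "s = c div l'" and "e = c mod l'"
      have c: "c = s * l' + e" and e: "e < l'" using l'2 by (simp_all add: s_def e_def)
      have c_eq: "c = j * l' + d - j + i" using i lenI unfolding c_def I_def by (subst nth_upt) auto
      moreover have "i < j" using i lenI by simp
      ultimately have c_lt: "c < j * l' + d" using jl by linarith
      have "s * l' < Suc j * l'" using c_lt c d by simp
      then have sj: "s \<le> j" by (metis less_Suc_eq_le mult_less_cancel2)
      have "s < j \<or> e < d" using c_lt sj c by (cases "s = j") auto
      then have "(\<lambda>u. col u c) \<in> lattice_mod (tail (Suc s))" using smaller[OF sj e] by (simp add: c)
      moreover have "t * l' \<in> set (drop (Suc i) I @ Z)" if "Suc s \<le> t" "t < k" for t
      proof (cases "t \<le> j")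
        case True
        have "Suc s * l' \<le> t * l'" "t * l' \<le> j * l'" using that True by (intro mult_le_mono1, simp)+
        then have lo: "c < t * l'" "t * l' < j * l' + d" using c e d unfolding mult_Suc by linarith+
        have "drop (Suc i) I = [Suc c..<j * l' + d]" using c_eq by (simp add: I_def)
        then show ?thesis using lo by simp
      next
        case False
        then have "t \<in> {Suc j..<k}" using that by simp
        then show ?thesis unfolding Z_def set_append set_map set_upt by blast
      qed
      then have "(\<lambda>t. t * l') ` {Suc s..<k} \<subseteq> set (drop (Suc i) I @ Z)"
        by (intro image_subsetI) simp
      then have "(\<lambda>c. ?C c u) ` (\<lambda>t. t * l') ` {Suc s..<k} \<subseteq> (\<lambda>c. ?C c u) ` set (drop (Suc i) I @ Z)" for u
        by (rule image_mono)
      then have "tail (Suc s) u \<subseteq> (\<lambda>w. w u) ` set (drop (Suc i) ?vs @ ?ws)" for u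
        unfolding set_append drop_map set_map list.set image_Un image_insert image_image by blast
      ultimately have "(\<lambda>u. col u c) \<in> lattice_mod (\<lambda>u. (\<lambda>w. w u) ` set (drop (Suc i) ?vs @ ?ws))"
        by (rule lattice_mod_mono)
      then show "?vs ! i \<in> lattice_mod (\<lambda>u. (\<lambda>w. w u) ` set (drop (Suc i) ?vs @ ?ws))"
        using i by (simp add: c_def)
    qed
    from triangular_laurent[OF this] show ?thesis using len by (simp add: \<phi>_def comp_def)
  qed
  \<comment> \<open>The coefficient for which \<open>\<phi>\<close> takes the same value on the
    corrected representative as on the column itself.\<close>
  then have lam: "(\<lambda>u. (X (Suc j) (Suc d) u - \<phi> u (y' u)) * ((-1) ^ length Z * (1 / pivot u))) \<in> laurent" (is "?lam \<in> _")
    using X_laurent[of "Suc j" "Suc d"] j d pivot_inv by (intro laurent_mult laurent_diff laurent_const) auto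
  have ystar: "(\<lambda>u r. y' u r + ?lam u * col u (k * l') r) \<in> lattice"
    by (rule lattice_add_scale[OF y'L col_mult_lattice lam])
  show ?thesis
    unfolding lattice_mod_def
  proof (intro CollectI bexI[OF _ ystar] allI impI)
    fix u c assume u: "nz u" and c: "\<forall>w\<in>tail (Suc j) u. (\<Sum>r<k. c r * w r) = 0"
    obtain a where a: "\<And>v. \<phi> u v = (\<Sum>r<k. a r * v r)" using \<phi>_linear by blast
    let ?K = "\<Sum>r<k. c r * col u (k * l') r"
    let ?q = "\<phi> u (col u (k * l'))"
    have q: "?q \<noteq> 0" using pivot[OF u] \<phi>_pivot by (simp del: col_mult)
    \<comment> \<open>A test functional that kills \<open>Z\<close> is corrected by a multiple of
      \<open>\<phi>\<close> so that it also kills the column \<open>k * l'\<close>; then the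
      relation for \<open>y'\<close> applies.\<close>
    define b where "b = (\<lambda>r. c r - ?K / ?q * a r)"
    have b: "(\<Sum>r<k. b r * w r) = (\<Sum>r<k. c r * w r) - ?K / ?q * \<phi> u w" for w
      by (simp add: b_def a left_diff_distrib sum_subtractf sum_distrib_left mult.assoc del: col_mult)
    have "(\<Sum>r<k. b r * col u (t * l') r) = 0" if t: "Suc j \<le> t" "t \<le> k" for t
    proof (cases "t = k")
      case True
      then show ?thesis unfolding b using q by (simp del: col_mult)
    next
      case False
      then have "(\<Sum>r<k. c r * col u (t * l') r) = 0" using c t by (auto simp del: col_mult)
      moreover have "\<phi> u (col u (t * l')) = 0"
      proof -
        have "t \<in> {Suc j..<k}" using t False by simp
        then have "t * l' \<in> set Z" unfolding Z_def set_map set_upt by blast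
        then obtain i where i: "i < length Z" "Z ! i = t * l'" by (auto simp: in_set_conv_nth)
        show ?thesis
          unfolding \<phi>_def by (rule bracket_repeat[of _ k "length I" "length I + Suc i"])
            (use i len in \<open>auto simp: nth_append simp del: col_mult\<close>)
      qed
      ultimately show ?thesis unfolding b by simp
    qed
    from y'[OF u this] have "(\<Sum>r<k. c r * col u (j * l' + d) r) - ?K / ?q * X (Suc j) (Suc d) u
        = (\<Sum>r<k. c r * y' u r) - ?K / ?q * \<phi> u (y' u)"
      unfolding b \<phi>_col .
    then have "(\<Sum>r<k. c r * col u (j * l' + d) r)
        = (\<Sum>r<k. c r * y' u r) + (X (Suc j) (Suc d) u - \<phi> u (y' u)) * (1 / ?q) * ?K"
      by (simp add: algebra_simps diff_divide_distrib del: col_mult)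
    also have "(X (Suc j) (Suc d) u - \<phi> u (y' u)) * (1 / ?q) = ?lam u"
    proof -
      have "(-1) ^ length Z * (-1) ^ length Z = (1 :: complex)" by (simp flip: power_mult_distrib)
      then have "1 / ?q = (-1) ^ length Z * (1 / pivot u)"
        unfolding \<phi>_pivot using pivot[OF u] by (simp add: field_simps)
      then show ?thesis by simp
    qed
    also have "(\<Sum>r<k. c r * y' u r) + ?lam u * ?K = (\<Sum>r<k. c r * (y' u r + ?lam u * col u (k * l') r))"
      unfolding sum_distrib_left distrib_left sum.distrib
      by (intro arg_cong2[of _ _ _ _ "(+)"] refl sum.cong) (simp only: mult_ac)
    finally show "(\<Sum>r<k. c r * col u (j * l' + d) r) = (\<Sum>r<k. c r * (y' u r + ?lam u * col u (k * l') r))" .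
  qed
qed

text \<open>Each column is obtained from the one \<open>l'\<close> before it. For
  \<open>j = 0\<close> there is none: \<open>col u d r / zeta r\<close> takes its place, and modulo
  all \<open>k\<close> generators any vector is admissible.\<close>

lemma col_lattice_mod:
  "j < k \<Longrightarrow> d < l' \<Longrightarrow> (\<lambda>u. col u (j * l' + d)) \<in> lattice_mod (tail (Suc j))"
proof (induction j arbitrary: d rule: less_induct)
  case (less j)
  note outer = less.IH
  show ?case using less.prems(2)
  proof (induction d rule: less_induct)
    case (less d)
    show ?case
    proof (cases "d = 0")
      case True
      then show ?thesis using lattice_subset_mod[OF col_mult_lattice] by (simp del: col_mult)
    next
      case False
      define v where "v = (if j = 0 then (\<lambda>u r. col u d r / zeta r) else (\<lambda>u. col u ((j - 1) * l' + d)))"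
      show ?thesis
      proof (rule lattice_mod_step)
        show "v \<in> lattice_mod (tail j)"
        proof (cases "j = 0")
          case True
          then show ?thesis using everything_mod_all by simp
        next
          case False
          then have "(\<lambda>u. col u ((j - 1) * l' + d)) \<in> lattice_mod (tail (Suc (j - 1)))"
            using \<open>j < k\<close> less.prems by (intro outer) simp_all
          then show ?thesis using False by (simp add: v_def)
        qed
        show "col u (j * l' + d) r = zeta r * v u r" for u r
        proof (cases "j = 0")
          case False
          then have "j * l' + d = (j - 1) * l' + d + l'" by (cases j) simp_all
          then show ?thesis using False by (simp only: v_def col_shift if_False)
        qed (simp add: v_def)
        show "(\<lambda>u. col u (i * l' + c)) \<in> lattice_mod (tail (Suc i))"
          if "i \<le> j" "c < l'" "i < j \<or> c < d" for i c
        proof (cases "i < j")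
          case True
          have "i < k" using True \<open>j < k\<close> by linarith
          then show ?thesis using outer[OF True] \<open>c < l'\<close> by blast
        next
          case False
          then have "i = j" "c < d" using that by auto
          then show ?thesis using less.IH[of c] \<open>c < l'\<close> by blast
        qed
      qed (use False less.prems \<open>j < k\<close> in auto)
    qed
  qed
qed

text \<open>For \<open>j = k - 1\<close> the modulus is empty, and moves by \<open>l'\<close> reach
  all larger columns. A smaller column equals, up to sign, the one \<open>n\<close> further on, and
  \<open>n \<ge> (k - 1) * l'\<close> because \<open>k \<le> p\<close>.\<close>

lemma col_lattice: "(\<lambda>u. col u c) \<in> lattice"
proof -
  have large: "(\<lambda>u. col u (c + (k - 1) * l')) \<in> lattice" for c
  proof -
    have "(\<lambda>u. col u ((k - 1) * l' + c mod l')) \<in> lattice_mod (tail (Suc (k - 1)))"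
      using col_lattice_mod[of "k - 1" "c mod l'"] k2 l'2 by simp
    moreover have "tail (Suc (k - 1)) = (\<lambda>u. {})" using k2 by simp
    ultimately have "(\<lambda>u. col u ((k - 1) * l' + c mod l')) \<in> lattice" using lattice_mod_empty by simp
    then have "(\<lambda>u. col u ((k - 1) * l' + c mod l' + c div l' * l')) \<in> lattice" by (rule col_shift_lattice)
    moreover have "(k - 1) * l' + c mod l' + c div l' * l' = c + (k - 1) * l'"
      using mod_div_mult_eq[of c l'] by linarith
    ultimately show ?thesis by simp
  qed
  have "k - 1 \<le> p" using kp by linarith
  then have "(k - 1) * l' \<le> n" unfolding n_eq by (rule mult_le_mono1)
  then have "c + n = (c + (n - (k - 1) * l')) + (k - 1) * l'" by simp
  then have "(\<lambda>u. col u (c + n)) \<in> lattice" using large by metis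
  then have "(\<lambda>u r. (-1) ^ (k - 1) * col u (c + n) r) \<in> lattice"
    using lattice_scale laurent_const by blast
  moreover have "(-1) ^ (k - 1) * col u (c + n) r = col u c r" for u r
  proof -
    have "(-1) ^ (k - 1) * (-1) ^ (k - 1) = (1 :: complex)" by (simp flip: power_mult_distrib)
    then show ?thesis by (simp add: col_add_n mult.assoc[symmetric])
  qed
  ultimately show ?thesis by simp
qed

lemma reg_subset_laurent: "f \<in> reg \<Longrightarrow> f \<in> laurent"
proof (induction rule: reg.induct)
  case (reg_minor cs)
  have "set (map (\<lambda>c u. col u c) cs) \<subseteq> lattice" using col_lattice by auto
  then show ?case using bracket_lattice[of "map (\<lambda>c u. col u c) cs"] reg_minor by (simp add: minor_def comp_def)
qed (intro laurent_const laurent_add laurent_mult; assumption)+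

section \<open>Clearing denominators\<close>

inductive_set cluster_poly :: "((nat \<Rightarrow> nat \<Rightarrow> complex) \<Rightarrow> complex) set" where
  cluster_poly_const: "(\<lambda>u. c) \<in> cluster_poly"
| cluster_poly_x: "m \<in> {1..num_vars} \<Longrightarrow> x m \<in> cluster_poly"
| cluster_poly_add: "f \<in> cluster_poly \<Longrightarrow> g \<in> cluster_poly \<Longrightarrow> (\<lambda>u. f u + g u) \<in> cluster_poly"
| cluster_poly_mult: "f \<in> cluster_poly \<Longrightarrow> g \<in> cluster_poly \<Longrightarrow> (\<lambda>u. f u * g u) \<in> cluster_poly"

inductive_set cluster_monomial :: "((nat \<Rightarrow> nat \<Rightarrow> complex) \<Rightarrow> complex) set" where
  cluster_monomial_one: "(\<lambda>u. 1) \<in> cluster_monomial"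
| cluster_monomial_mult: "m \<in> {1..num_vars} \<Longrightarrow> a \<in> cluster_monomial \<Longrightarrow> (\<lambda>u. x m u * a u) \<in> cluster_monomial"

lemma cluster_monomial_poly: "a \<in> cluster_monomial \<Longrightarrow> a \<in> cluster_poly"
  by (induction rule: cluster_monomial.induct) (intro cluster_poly_const cluster_poly_mult cluster_poly_x; assumption)+

lemma cluster_monomial_times:
  "a \<in> cluster_monomial \<Longrightarrow> b \<in> cluster_monomial \<Longrightarrow> (\<lambda>u. a u * b u) \<in> cluster_monomial"
  by (induction rule: cluster_monomial.induct) (simp_all add: mult.assoc cluster_monomial_mult)

lemma laurent_clear_denominator:
  "f \<in> laurent \<Longrightarrow> \<exists>a\<in>cluster_monomial. \<exists>h\<in>cluster_poly. \<forall>u. nz u \<longrightarrow> a u * f u = h u"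
proof (induction rule: laurent.induct)
  case (laurent_const c)
  show ?case by (intro bexI[OF _ cluster_monomial_one] bexI[OF _ cluster_poly_const[of c]]) simp
next
  case (laurent_x m)
  then show ?case by (intro bexI[OF _ cluster_monomial_one] bexI[OF _ cluster_poly_x[of m]]) simp_all
next
  case (laurent_inverse m)
  then show ?case
    by (intro bexI[OF _ cluster_monomial_mult[OF _ cluster_monomial_one, of m]] bexI[OF _ cluster_poly_const[of 1]])
      (auto simp: nz_def)
next
  case (laurent_add f g)
  then obtain a h b i where "a \<in> cluster_monomial" "h \<in> cluster_poly" "\<And>u. nz u \<Longrightarrow> h u = a u * f u"
    "b \<in> cluster_monomial" "i \<in> cluster_poly" "\<And>u. nz u \<Longrightarrow> i u = b u * g u" by metis
  then show ?case
    by - (rule bexI[of _ "\<lambda>u. a u * b u"], rule bexI[of _ "\<lambda>u. b u * h u + a u * i u"],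
      auto simp: algebra_simps intro!: cluster_monomial_times cluster_poly_add cluster_poly_mult intro: cluster_monomial_poly)
next
  case (laurent_mult f g)
  then obtain a h b i where "a \<in> cluster_monomial" "h \<in> cluster_poly" "\<And>u. nz u \<Longrightarrow> h u = a u * f u"
    "b \<in> cluster_monomial" "i \<in> cluster_poly" "\<And>u. nz u \<Longrightarrow> i u = b u * g u" by metis
  then show ?case
    by (intro bexI[of _ "\<lambda>u. a u * b u"] bexI[of _ "\<lambda>u. h u * i u"])
      (auto intro!: cluster_monomial_times cluster_poly_mult)
next
  case (laurent_cong f g)
  then show ?case by (metis (no_types))
qed

text \<open>The Laurent expansion gives an identity on \<open>nz\<close> only. Multiplication by the
  product \<open>q\<close> of all variables, which vanishes off \<open>nz\<close>, makes it valid
  for every \<open>u\<close>.\<close>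

lemma reg_clear_denominator:
  assumes "f \<in> reg"
  shows "\<exists>a\<in>cluster_monomial. \<exists>h\<in>cluster_poly. \<forall>u. a u * f u = h u"
proof -
  obtain a h where ah: "a \<in> cluster_monomial" "h \<in> cluster_poly" "\<And>u. nz u \<Longrightarrow> a u * f u = h u"
    using laurent_clear_denominator[OF reg_subset_laurent[OF assms]] by metis
  define q where "q = (\<lambda>u. \<Prod>m\<in>{1..num_vars}. x m u)"
  have "(\<lambda>u. \<Prod>m\<in>A. x m u) \<in> cluster_monomial" if "A \<subseteq> {1..num_vars}" for A
  proof -
    have "finite A" using that finite_subset by blast
    then show ?thesis using that
      by (induction A) (simp_all add: cluster_monomial_one cluster_monomial_mult)
  qed
  then have q: "q \<in> cluster_monomial" unfolding q_def by blast
  have "(q u * a u) * f u = q u * h u" for u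
  proof (cases "nz u")
    case False
    then have "q u = 0" by (auto simp: q_def nz_def)
    then show ?thesis by simp
  qed (simp add: ah(3) mult.assoc)
  then show ?thesis
    by (intro bexI[of _ "\<lambda>u. q u * a u"] bexI[of _ "\<lambda>u. q u * h u"])
      (auto intro: cluster_monomial_times cluster_poly_mult cluster_monomial_poly q ah)
qed


section \<open>The coordinate ring\<close>

definition Phi :: "(nat \<Rightarrow> nat \<Rightarrow> complex) \<Rightarrow> nat set \<Rightarrow> complex" where
  "Phi u = (\<lambda>I. if I \<subseteq> {1..n} \<and> card I = k then plucker (B u) I else 0)"

lemma plucker_eq_minor:
  assumes "I \<subseteq> {1..n}" "card I = k"
  obtains cs where "length cs = k" "\<And>u. plucker (B u) I = minor u cs"
proof -
  obtain f where f: "strict_mono_on {..<k} f" "\<And>i. i < k \<Longrightarrow> f i < n" "Suc ` f ` {..<k} = I"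
    using strict_mono_enumeration[OF assms] by metis
  have "plucker (B u) I = minor u (map f [0..<k])" for u
  proof -
    have "plucker (B u) I = Determinant.det (mat k k (\<lambda>(r, i). B u $$ (r, f i)))"
      using plucker_strict_mono[OF B_carrier f(1,2), of u] f(3) by simp
    also have "\<dots> = minor u (map f [0..<k])"
      unfolding minor_def bracket_def using f(2)
      by (intro arg_cong[of _ _ Determinant.det] eq_matI) (auto simp: B_def)
    finally show ?thesis .
  qed
  then show ?thesis by (intro that[of "map f [0..<k]"]) simp_all
qed

lemma minor_scale_row:
  assumes "j < k" "length cs = k"
  shows "minor (\<lambda>r a. if r = j then s * u r a else u r a) cs = s * minor u cs"
proof -
  let ?v = "\<lambda>r a. if r = j then s * u r a else u r a"
  have "(\<Prod>i<k. (map (col ?v) cs ! i) (\<sigma> i)) = s * (\<Prod>i<k. (map (col u) cs ! i) (\<sigma> i))"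
    if \<sigma>: "\<sigma> permutes {..<k}" for \<sigma>
  proof -
    have "(map (col ?v) cs ! i) (\<sigma> i) = (if i = inv_into UNIV \<sigma> j then s else 1) * (map (col u) cs ! i) (\<sigma> i)" if "i < k" for i
      using that assms(2) permutes_inverses[OF \<sigma>] by (auto simp: col_def)
    then have "(\<Prod>i<k. (map (col ?v) cs ! i) (\<sigma> i))
        = (\<Prod>i<k. (if i = inv_into UNIV \<sigma> j then s else 1) * (map (col u) cs ! i) (\<sigma> i))"
      by (intro prod.cong) simp_all
    also have "\<dots> = (\<Prod>i<k. if i = inv_into UNIV \<sigma> j then s else 1) * (\<Prod>i<k. (map (col u) cs ! i) (\<sigma> i))"
      by (rule prod.distrib)
    also have "(\<Prod>i<k. if i = inv_into UNIV \<sigma> j then s else 1) = s"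
      using permutes_in_image[OF permutes_inv[OF \<sigma>], of j] assms(1) by simp
    finally show ?thesis .
  qed
  then show ?thesis
    unfolding minor_def bracket_def det_mat_expand sum_distrib_left by (intro sum.cong) simp_all
qed

text \<open>The scalar \<open>t\<close> and the determinant of the base change are absorbed into row
  0. Conversely, a \<open>u\<close> with a zero row yields the apex of the cone, which is 0 times
  any Pluecker vector of the component.\<close>

lemma affine_cone_eq: "affine_cone k n (distinguished_component k l n) = range Phi"
proof (intro equalityI subsetI)
  fix P assume "P \<in> affine_cone k n (distinguished_component k l n)"
  then obtain t A where A: "A \<in> full_rank_mats k n" "row_span n A \<in> spans"
    and P: "P = (\<lambda>I. if I \<subseteq> {1..n} \<and> card I = k then t * plucker A I else 0)"
    unfolding affine_cone_def distinguished_component_eq by blast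
  obtain u where u: "row_span n A = row_span n (B u)" using A(2) by (auto simp: spans_def)
  obtain g where g: "g \<in> carrier_mat k k" "A = g * B u" using row_span_eqE[OF A(1) B_carrier u] by metis
  define v where "v = (\<lambda>r a. if r = 0 then t * Determinant.det g * u r a else u r a)"
  have "t * plucker A I = plucker (B v) I" if I: "I \<subseteq> {1..n}" "card I = k" for I
  proof -
    obtain cs where cs: "length cs = k" "\<And>u. plucker (B u) I = minor u cs" using plucker_eq_minor[OF I] by metis
    have "t * plucker A I = t * Determinant.det g * minor u cs"
      unfolding g(2) plucker_mult[OF B_carrier g(1) I] cs(2) by simp
    also have "\<dots> = minor v cs" using minor_scale_row[of 0 cs] k2 cs(1) unfolding v_def by simp
    finally show ?thesis by (simp only: cs(2))
  qed
  then have "P = Phi v" unfolding P Phi_def by auto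
  then show "P \<in> range Phi" by blast
next
  fix P assume "P \<in> range Phi"
  then obtain u where P: "P = Phi u" by blast
  show "P \<in> affine_cone k n (distinguished_component k l n)"
  proof (cases "good u")
    case True
    then show ?thesis unfolding affine_cone_def distinguished_component_eq P Phi_def
      by (intro CollectI exI[of _ 1] exI[of _ "B u"]) (auto simp: good_full_rank spans_def)
  next
    case False
    then obtain j where j: "j < k" "\<And>a. a < l' \<Longrightarrow> u j a = 0" by (auto simp: good_def)
    have "plucker (B u) I = 0" if I: "I \<subseteq> {1..n}" "card I = k" for I
    proof -
      obtain cs where cs: "length cs = k" "\<And>u. plucker (B u) I = minor u cs" using plucker_eq_minor[OF I] by metis
      have "col (\<lambda>r a. if r = j then 0 * u r a else u r a) = col u"
        using j(2) l'2 by (auto simp: col_def fun_eq_iff)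
      then have "minor u cs = 0 * minor u cs"
        using minor_scale_row[OF j(1) cs(1), of 0 u] unfolding minor_def by simp
      then show ?thesis by (simp add: cs(2))
    qed
    then have "P = (\<lambda>I. if I \<subseteq> {1..n} \<and> card I = k then 0 * plucker (B u0) I else 0)"
      unfolding P Phi_def by auto
    moreover have "row_span n (B u0) \<in> spans" using good_u0 by (auto simp: spans_def)
    ultimately show ?thesis unfolding affine_cone_def distinguished_component_eq
      using good_full_rank[OF good_u0] by blast
  qed
qed

section \<open>Regular functions of the parameters as elements of the coordinate ring\<close>

abbreviation R :: "((nat set \<Rightarrow> complex) \<Rightarrow> complex) ring" where
  "R \<equiv> D_ring k l n"

lemma D_ring_simps:
  "f \<otimes>\<^bsub>R\<^esub> g = (\<lambda>P\<in>range Phi. f P * g P)" "f \<oplus>\<^bsub>R\<^esub> g = (\<lambda>P\<in>range Phi. f P + g P)"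
  "\<one>\<^bsub>R\<^esub> = (\<lambda>P\<in>range Phi. 1)" "\<zero>\<^bsub>R\<^esub> = (\<lambda>P\<in>range Phi. 0)"
  by (simp_all add: D_ring_def coordinate_ring_def function_ring_def affine_cone_eq)

lemma D_ring_carrier:
  "carrier R = generate_ring (function_ring (range Phi))
     (range (\<lambda>c. \<lambda>P\<in>range Phi. c) \<union> {(\<lambda>P\<in>range Phi. P I) | I. I \<subseteq> {1..n} \<and> card I = k})"
  by (simp add: D_ring_def coordinate_ring_def const_fun_def coordinate_def affine_cone_eq)

lemma cring_D_ring: "cring R"
  unfolding D_ring_def by (rule cring_coordinate_ring)

lemma D_ring_extensional: "f \<in> carrier R \<Longrightarrow> f \<in> extensional (range Phi)"
proof -
  interpret F: cring "function_ring (range Phi)" by (rule cring_function_ring)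
  let ?G = "range (\<lambda>c. \<lambda>P\<in>range Phi. c) \<union> {(\<lambda>P\<in>range Phi. P I) | I. I \<subseteq> {1..n} \<and> card I = k}"
  have "?G \<subseteq> carrier (function_ring (range Phi))" by (auto simp: function_ring_def)
  then have "carrier R \<subseteq> carrier (function_ring (range Phi))"
    unfolding D_ring_carrier by (rule F.generate_ring_incl)
  moreover assume "f \<in> carrier R"
  ultimately show ?thesis by (auto simp: function_ring_def PiE_def)
qed

lemma D_ring_eqI:
  assumes "f \<in> carrier R" "g \<in> carrier R" "\<And>u. f (Phi u) = g (Phi u)"
  shows "f = g"
  using D_ring_extensional[OF assms(1)] D_ring_extensional[OF assms(2)]
  by (rule extensionalityI) (auto simp: assms(3))

lemma col_mod_n: "\<exists>d. \<forall>u. col u c = (\<lambda>r. d * col u (c mod n) r)"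
proof (induction c rule: less_induct)
  case (less c)
  show ?case
  proof (cases "c < n")
    case True
    then show ?thesis by (intro exI[of _ 1]) simp
  next
    case False
    then obtain d where "\<And>u. col u (c - n) = (\<lambda>r. d * col u ((c - n) mod n) r)"
      using less.IH[of "c - n"] n2 by auto
    moreover have "col u c = (\<lambda>r. (-1) ^ (k - 1) * col u (c - n) r)" for u
      using col_add_n[of u "c - n"] False by simp
    moreover have "(c - n) mod n = c mod n" using False by (simp add: le_mod_geq)
    ultimately show ?thesis by (intro exI[of _ "(-1) ^ (k - 1) * d"]) (simp add: mult.assoc)
  qed
qed

text \<open>Columns are reduced modulo \<open>n\<close> at the cost of constants and then sorted;
  neither depends on \<open>u\<close>, so columns beyond \<open>n\<close> give no new functions up
  to scalars.\<close>

lemma minor_eq_plucker: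
  assumes "length cs = k"
  obtains I d where "I \<subseteq> {1..n}" "card I = k" "\<And>u. minor u cs = d * plucker (B u) I"
proof -
  have "\<forall>c. \<exists>d. \<forall>u. col u c = (\<lambda>r. d * col u (c mod n) r)" using col_mod_n ..
  from choice[OF this] obtain d where d: "\<forall>c u. col u c = (\<lambda>r. d c * col u (c mod n) r)" ..
  define f where "f = (\<lambda>i. cs ! i mod n)"
  have f: "f i < n" if "i < k" for i using n2 by (simp add: f_def)
  obtain \<epsilon> I where I: "I \<subseteq> {1..n}" "card I = k"
    "\<And>A :: complex mat. A \<in> carrier_mat k n \<Longrightarrow> Determinant.det (mat k k (\<lambda>(r, i). A $$ (r, f i))) = \<epsilon> * plucker A I"
    by (rule det_columns_eq_plucker[where f = f and k = k and n = n]) (rule f, assumption, rule k_le_n, rule that)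
  have "minor u cs = ((\<Prod>i<k. d (cs ! i)) * \<epsilon>) * plucker (B u) I" for u
  proof -
    have "minor u cs = Determinant.det (mat k k (\<lambda>(r, i). d (cs ! i) * B u $$ (r, f i)))"
      unfolding minor_def bracket_def using assms f
      by (intro arg_cong[of _ _ Determinant.det] eq_matI) (simp_all add: B_def f_def d[rule_format, of u "cs ! _"])
    then show ?thesis unfolding det_scale_columns I(3)[OF B_carrier] by simp
  qed
  then show ?thesis by (rule that[OF I(1,2)])
qed

lemma reg_exists_D_ring:
  assumes "g \<in> reg"
  shows "\<exists>f\<in>carrier R. \<forall>u. f (Phi u) = g u"
  using assms
proof (induction rule: reg.induct)
  case (reg_const c)
  show ?case unfolding D_ring_carrier
    by (intro bexI[of _ "\<lambda>P\<in>range Phi. c"] generate_ring.incl) auto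
next
  case (reg_minor cs)
  interpret R: cring R by (rule cring_D_ring)
  obtain I d where I: "I \<subseteq> {1..n}" "card I = k" "\<And>u. minor u cs = d * plucker (B u) I"
    using minor_eq_plucker[OF reg_minor] by metis
  have "(\<lambda>P\<in>range Phi. d) \<in> carrier R" "(\<lambda>P\<in>range Phi. P I) \<in> carrier R"
    unfolding D_ring_carrier using I(1,2) by (auto intro!: generate_ring.incl)
  then show ?case
    by (intro bexI[of _ "(\<lambda>P\<in>range Phi. d) \<otimes>\<^bsub>R\<^esub> (\<lambda>P\<in>range Phi. P I)"] R.m_closed)
      (use I(1,2) in \<open>simp_all add: D_ring_simps I(3) Phi_def del: One_nat_def\<close>)
next
  case (reg_add f g)
  interpret R: cring R by (rule cring_D_ring)
  obtain f' g' where "f' \<in> carrier R" "\<forall>u. f' (Phi u) = f u" "g' \<in> carrier R" "\<forall>u. g' (Phi u) = g u"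
    using reg_add.IH by blast
  then show ?case by (intro bexI[of _ "f' \<oplus>\<^bsub>R\<^esub> g'"] R.a_closed) (simp_all add: D_ring_simps)
next
  case (reg_mult f g)
  interpret R: cring R by (rule cring_D_ring)
  obtain f' g' where "f' \<in> carrier R" "\<forall>u. f' (Phi u) = f u" "g' \<in> carrier R" "\<forall>u. g' (Phi u) = g u"
    using reg_mult.IH by blast
  then show ?case by (intro bexI[of _ "f' \<otimes>\<^bsub>R\<^esub> g'"] R.m_closed) (simp_all add: D_ring_simps)
qed

lemma D_ring_exists_reg:
  assumes "f \<in> carrier R"
  shows "(\<lambda>u. f (Phi u)) \<in> reg"
  using assms unfolding D_ring_carrier
proof (induction rule: generate_ring.induct)
  case (incl h)
  then show ?case
  proof
    assume "h \<in> {(\<lambda>P\<in>range Phi. P I) | I. I \<subseteq> {1..n} \<and> card I = k}"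
    then obtain I where I: "I \<subseteq> {1..n}" "card I = k" "h = (\<lambda>P\<in>range Phi. P I)" by blast
    obtain cs where "length cs = k" "\<And>u. plucker (B u) I = minor u cs" using plucker_eq_minor[OF I(1,2)] by metis
    then show ?thesis using I reg_minor[of cs] by (simp add: Phi_def)
  qed (auto intro: reg_const)
next
  case (a_inv h)
  interpret F: cring "function_ring (range Phi)" by (rule cring_function_ring)
  have "h \<in> carrier R" using a_inv by (simp add: D_ring_carrier)
  then have ext: "h \<in> extensional (range Phi)" by (rule D_ring_extensional)
  have "\<ominus>\<^bsub>function_ring (range Phi)\<^esub> h = (\<lambda>P\<in>range Phi. - h P)"
    by (rule F.minus_equality) (use ext in \<open>auto simp: function_ring_def fun_eq_iff PiE_def extensional_def\<close>)
  then show ?case using reg_diff[OF reg_const[of 0] a_inv.IH] by simp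
qed (auto simp: function_ring_def intro: reg_const reg_add reg_mult)

text \<open>The inverse of pulling back along \<open>Phi\<close>; uniqueness holds because the range
  of \<open>Phi\<close> is the whole cone.\<close>

definition lift :: "((nat \<Rightarrow> nat \<Rightarrow> complex) \<Rightarrow> complex) \<Rightarrow> (nat set \<Rightarrow> complex) \<Rightarrow> complex" where
  "lift g = (THE f. f \<in> carrier R \<and> (\<forall>u. f (Phi u) = g u))"

lemma lift_eqI:
  assumes "f \<in> carrier R" "\<And>u. f (Phi u) = g u"
  shows "lift g = f"
  unfolding lift_def by (rule the_equality) (use assms in \<open>auto intro: D_ring_eqI\<close>)

lemma lift:
  assumes "g \<in> reg"
  shows "lift g \<in> carrier R" "lift g (Phi u) = g u"
proof -
  obtain f where "f \<in> carrier R" "\<forall>u. f (Phi u) = g u" using reg_exists_D_ring[OF assms] by (rule bexE)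
  then show "lift g \<in> carrier R" "lift g (Phi u) = g u" using lift_eqI[of f g] by simp_all
qed

lemma D_ring_cases:
  assumes "f \<in> carrier R"
  obtains g where "g \<in> reg" "f = lift g"
  using that[OF D_ring_exists_reg[OF assms]] lift_eqI[OF assms, of "\<lambda>u. f (Phi u)"] by simp

text \<open>Restricting to lines reduces the absence of zero divisors to univariate polynomials.\<close>

lemma reg_on_line:
  assumes "g \<in> reg"
  shows "\<exists>P. \<forall>s. g (\<lambda>r a. u r a + s * (v r a - u r a)) = poly P s"
  using assms
proof (induction rule: reg.induct)
  case (reg_const c)
  show ?case by (intro exI[of _ "[:c:]"]) simp
next
  case (reg_minor cs)
  let ?w = "\<lambda>s r a. u r a + s * (v r a - u r a)"
  let ?e = "\<lambda>i r. [:col u (cs ! i) r, col v (cs ! i) r - col u (cs ! i) r:]"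
  have "(map (col (?w s)) cs ! i) r = poly (?e i r) s" if "i < k" for s i r
    using that reg_minor by (simp add: col_def algebra_simps)
  then have "minor (?w s) cs = poly (\<Sum>\<sigma> | \<sigma> permutes {..<k}. Polynomial.smult (signof \<sigma>) (\<Prod>i<k. ?e i (\<sigma> i))) s" for s
    unfolding minor_def bracket_def det_mat_expand poly_sum poly_smult poly_prod
    by (intro sum.cong prod.cong arg_cong2[of _ _ _ _ "(*)"] refl) simp
  then show ?case by (intro exI allI)
next
  case (reg_add f g)
  then obtain P Q where "\<forall>s. f (\<lambda>r a. u r a + s * (v r a - u r a)) = poly P s"
    "\<forall>s. g (\<lambda>r a. u r a + s * (v r a - u r a)) = poly Q s" by blast
  then show ?case by (intro exI[of _ "P + Q"]) simp
next
  case (reg_mult f g)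
  then obtain P Q where "\<forall>s. f (\<lambda>r a. u r a + s * (v r a - u r a)) = poly P s"
    "\<forall>s. g (\<lambda>r a. u r a + s * (v r a - u r a)) = poly Q s" by blast
  then show ?case by (intro exI[of _ "P * Q"]) simp
qed

lemma reg_integral:
  assumes f: "f \<in> reg" and g: "g \<in> reg" and fg: "\<And>u. f u * g u = 0" and u: "f u \<noteq> 0"
  shows "g v = 0"
proof (rule ccontr)
  assume v: "g v \<noteq> 0"
  obtain P where P: "\<forall>s. f (\<lambda>r a. u r a + s * (v r a - u r a)) = poly P s"
    using reg_on_line[OF f] ..
  obtain Q where Q: "\<forall>s. g (\<lambda>r a. u r a + s * (v r a - u r a)) = poly Q s"
    using reg_on_line[OF g] ..
  have "poly (P * Q) s = 0" for s
    unfolding poly_mult P[rule_format, symmetric] Q[rule_format, symmetric] by (rule fg)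
  then have "P * Q = 0" using poly_all_0_iff_0[of "P * Q"] by blast
  then have "P = 0 \<or> Q = 0" by simp
  then show False using P[rule_format, of 0] Q[rule_format, of 1] u v by auto
qed

lemma domain_D_ring: "domain R"
proof -
  interpret R: cring R by (rule cring_D_ring)
  show ?thesis
  proof
    have "\<one>\<^bsub>R\<^esub> (Phi u0) \<noteq> \<zero>\<^bsub>R\<^esub> (Phi u0)" by (simp add: D_ring_simps)
    then show "\<one>\<^bsub>R\<^esub> \<noteq> \<zero>\<^bsub>R\<^esub>" by (rule contrapos_nn) simp
  next
    fix a b assume ab: "a \<otimes>\<^bsub>R\<^esub> b = \<zero>\<^bsub>R\<^esub>" "a \<in> carrier R" "b \<in> carrier R"
    obtain f g where fg: "f \<in> reg" "g \<in> reg" "a = lift f" "b = lift g"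
      using D_ring_cases[OF ab(2)] D_ring_cases[OF ab(3)] by metis
    have "(a \<otimes>\<^bsub>R\<^esub> b) (Phi u) = \<zero>\<^bsub>R\<^esub> (Phi u)" for u using ab(1) by simp
    then have "f u * g u = 0" for u by (simp add: D_ring_simps fg lift)
    note integral = reg_integral[OF fg(1,2) this]
    show "a = \<zero>\<^bsub>R\<^esub> \<or> b = \<zero>\<^bsub>R\<^esub>"
    proof (cases "\<forall>u. f u = 0")
      case True
      then have "a = \<zero>\<^bsub>R\<^esub>" using ab(2) fg by (intro D_ring_eqI R.zero_closed) (simp_all add: D_ring_simps(4) lift)
      then show ?thesis ..
    next
      case False
      then have "\<And>v. g v = 0" using integral by blast
      then have "b = \<zero>\<^bsub>R\<^esub>" using ab(3) fg by (intro D_ring_eqI R.zero_closed) (simp_all add: D_ring_simps(4) lift)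
      then show ?thesis ..
    qed
  qed
qed


section \<open>Regular functions in the fraction field\<close>

abbreviation K :: "frac_elem ring" where
  "K \<equiv> D_field k l n"

lemma field_K: "field K"
  unfolding D_field_def by (rule domain.field_fraction_field[OF domain_D_ring])

definition E :: "((nat \<Rightarrow> nat \<Rightarrow> complex) \<Rightarrow> complex) \<Rightarrow> frac_elem" where
  "E g = fraction_embed R (lift g)"

lemma E_carrier: "g \<in> reg \<Longrightarrow> E g \<in> carrier K"
  unfolding E_def D_field_def
  by (rule ring_hom_closed[OF domain.fraction_embed_hom[OF domain_D_ring]]) (rule lift)

lemma lift_const: "lift (\<lambda>u. c) = (\<lambda>P\<in>range Phi. c)"
  unfolding D_ring_carrier
  by (rule lift_eqI) (auto simp: D_ring_carrier intro!: generate_ring.incl)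

lemma E_const: "E (\<lambda>u. c) = D_const k l n c"
  by (simp add: E_def D_const_def lift_const const_fun_def affine_cone_eq)

lemma E_add: "f \<in> reg \<Longrightarrow> g \<in> reg \<Longrightarrow> E (\<lambda>u. f u + g u) = E f \<oplus>\<^bsub>K\<^esub> E g"
proof -
  assume fg: "f \<in> reg" "g \<in> reg"
  interpret R: cring R by (rule cring_D_ring)
  have "lift (\<lambda>u. f u + g u) = lift f \<oplus>\<^bsub>R\<^esub> lift g"
    by (rule lift_eqI) (simp_all add: lift fg R.a_closed, simp add: D_ring_simps lift fg)
  then show ?thesis unfolding E_def D_field_def
    using ring_hom_add[OF domain.fraction_embed_hom[OF domain_D_ring]] lift(1) fg by simp
qed

lemma E_mult: "f \<in> reg \<Longrightarrow> g \<in> reg \<Longrightarrow> E (\<lambda>u. f u * g u) = E f \<otimes>\<^bsub>K\<^esub> E g"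
proof -
  assume fg: "f \<in> reg" "g \<in> reg"
  interpret R: cring R by (rule cring_D_ring)
  have "lift (\<lambda>u. f u * g u) = lift f \<otimes>\<^bsub>R\<^esub> lift g"
    by (rule lift_eqI) (simp_all add: lift fg R.m_closed, simp add: D_ring_simps lift fg)
  then show ?thesis unfolding E_def D_field_def
    using ring_hom_mult[OF domain.fraction_embed_hom[OF domain_D_ring]] lift(1) fg by simp
qed

lemma E_one: "E (\<lambda>u. 1) = \<one>\<^bsub>K\<^esub>"
  using ring_hom_one[OF domain.fraction_embed_hom[OF domain_D_ring]]
  by (simp add: E_def D_field_def lift_const D_ring_simps)

lemma E_zero: "E (\<lambda>u. 0) = \<zero>\<^bsub>K\<^esub>"
  by (simp add: E_def D_field_def lift_const D_ring_simps(4)[symmetric] fraction_embed_def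
      domain.zero_fraction_field[OF domain_D_ring])

lemma E_nonzero:
  assumes g: "g \<in> reg" and u: "g u \<noteq> 0"
  shows "E g \<noteq> \<zero>\<^bsub>K\<^esub>"
proof
  assume "E g = \<zero>\<^bsub>K\<^esub>"
  then have "fraction_embed R (lift g) = fraction_embed R (lift (\<lambda>u. 0))"
    unfolding E_zero[symmetric] by (simp add: E_def)
  then have "lift g = lift (\<lambda>u. 0)"
    by (rule inj_onD[OF domain.fraction_embed_inj[OF domain_D_ring] _ lift(1)[OF g] lift(1)[OF reg_const]])
  then show False using lift(2)[OF g, of u] lift(2)[OF reg_const, of 0 u] u by simp
qed

lemma reg_power: "f \<in> reg \<Longrightarrow> (\<lambda>u. f u ^ (m::nat)) \<in> reg"
  using reg_prod[of "{..<m}" "\<lambda>_. f"] by simp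

lemma E_power:
  assumes "f \<in> reg"
  shows "E (\<lambda>u. f u ^ (m::nat)) = E f [^]\<^bsub>K\<^esub> m"
proof (induction m)
  case (Suc m)
  then show ?case using E_mult[OF reg_power[OF assms, of m] assms] by (simp add: mult.commute)
qed (simp add: E_one)

lemma E_sum:
  assumes "finite A" "\<And>i. i \<in> A \<Longrightarrow> f i \<in> reg"
  shows "E (\<lambda>u. \<Sum>i\<in>A. f i u) = (\<Oplus>\<^bsub>K\<^esub>i\<in>A. E (f i))"
  using assms
proof (induction A)
  case empty
  interpret K: field K by (rule field_K)
  show ?case by (simp add: E_zero)
next
  case (insert a A)
  interpret K: field K by (rule field_K)
  have "(\<lambda>u. \<Sum>i\<in>insert a A. f i u) = (\<lambda>u. f a u + (\<Sum>i\<in>A. f i u))" using insert by simp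
  then show ?case
    using insert E_add[of "f a" "\<lambda>u. \<Sum>i\<in>A. f i u"] reg_sum[of A f]
    by (subst K.finsum_insert) (auto simp: E_carrier)
qed

lemma E_prod:
  assumes "finite A" "\<And>i. i \<in> A \<Longrightarrow> f i \<in> reg"
  shows "E (\<lambda>u. \<Prod>i\<in>A. f i u) = (\<Otimes>\<^bsub>K\<^esub>i\<in>A. E (f i))"
  using assms
proof (induction A)
  case empty
  interpret K: field K by (rule field_K)
  show ?case by (simp add: E_one)
next
  case (insert a A)
  interpret K: field K by (rule field_K)
  have "(\<lambda>u. \<Prod>i\<in>insert a A. f i u) = (\<lambda>u. f a u * (\<Prod>i\<in>A. f i u))" using insert by simp
  then show ?case
    using insert E_mult[of "f a" "\<lambda>u. \<Prod>i\<in>A. f i u"] reg_prod[of A f]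
    by (subst K.finprod_insert) (auto simp: E_carrier)
qed

lemma D_ring_image_eq: "D_ring_image k l n = E ` reg"
proof -
  have "carrier R = lift ` reg" using lift(1) by (auto elim: D_ring_cases)
  then show ?thesis by (simp add: D_ring_image_def E_def image_image)
qed

section \<open>The initial cluster, the quiver and the neighbouring variables\<close>

text \<open>The last frozen index set thus ends at \<open>k * l'\<close>, and
  \<open>k \<le> p\<close> keeps it inside \<open>{1..n}\<close>.\<close>

lemma num_vars_eq: "num_vars + k = k * l' + 1"
proof -
  have "(k - 1) * (l' - 1) + l' + k = k * l' + 1"
    using k2 l'2 by (cases k; cases l') (auto simp: algebra_simps)
  then show ?thesis by (simp add: num_vars_def num_mutable_def)
qed

text \<open>For mutable \<open>m\<close> the interval ends before \<open>j * l'\<close>, so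
  \<open>xlist m\<close> is increasing and enumerates the index set lowered by 1; no sign
  arises.\<close>

lemma x_eq_plucker:
  assumes "m \<in> {1..num_vars}"
  shows "initial_index k l' m \<subseteq> {1..n}" "card (initial_index k l' m) = k"
    "x m u = plucker (B u) (initial_index k l' m)"
proof -
  have kl: "k * l' \<le> n" unfolding n_eq using kp by (rule mult_le_mono1)
  have "sorted_wrt (<) (xlist m) \<and> length (xlist m) = k \<and> set (xlist m) \<subseteq> {..<n}
      \<and> Suc ` set (xlist m) = initial_index k l' m"
  proof (cases "m \<le> num_mutable k l'")
    case False
    have "m \<le> num_vars" "1 \<le> m" using assms by simp_all
    then have lt: "m - 1 + k \<le> n" using num_vars_eq kl by linarith
    have "Suc ` {m - 1..<m - 1 + k} = {m..m + k - 1}"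
      using assms k2 by (simp add: image_Suc_atLeastLessThan atLeastLessThanSuc_atLeastAtMost[symmetric])
    then show ?thesis using False lt by (auto simp: xlist_def initial_index_def)
  next
    case True
    obtain j i where m: "m = (j - 1) * (l' - 1) + i" and ji: "1 \<le> j" "j < k" "1 \<le> i" "i < l'"
      using position_cases[of m] assms True by auto
    have div: "(m - 1) div (l' - 1) + 1 = j"
    proof -
      have "m - 1 = (i - 1) + (j - 1) * (l' - 1)" and "i - 1 < l' - 1" using m ji by auto
      then have "(m - 1) div (l' - 1) = j - 1" by (simp only:) simp
      then show ?thesis using ji by simp
    qed
    have xl: "xlist m = [m - 1..<m - 1 + j] @ map (\<lambda>t. t * l') [j..<k]"
      and ii: "initial_index k l' m = {m..m + j - 1} \<union> {1 + t * l' | t. j \<le> t \<and> t \<le> k - 1}"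
      using True div by (simp_all add: xlist_def initial_index_def Let_def)
    have top: "m - 1 + j \<le> j * l'"
    proof -
      have "(j - 1) * (l' - 1) + (l' - 1) = j * (l' - 1)" using ji by (cases j) simp_all
      moreover have "j * (l' - 1) + j = j * l'" using l'2 by (cases l') simp_all
      ultimately show ?thesis using m ji by linarith
    qed
    have step: "s * l' < t * l'" if "s < t" for s t using that l'2 by simp
    have lower: "j * l' \<le> t * l'" if "j \<le> t" for t using that by (rule mult_le_mono1)
    have upper: "t * l' < n" if "t < k" for t using step[OF that] kl by linarith
    have "sorted_wrt (<) (xlist m)"
      unfolding xl sorted_wrt_append sorted_wrt_map
    proof (intro conjI ballI)
      show "sorted_wrt (\<lambda>s t. s * l' < t * l') [j..<k]"
        by (rule sorted_wrt_mono_rel[of _ "(<)"]) (simp_all only: step sorted_wrt_upt)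
      fix a b assume "a \<in> set [m - 1..<m - 1 + j]" "b \<in> set (map (\<lambda>t. t * l') [j..<k])"
      then obtain t where "a < m - 1 + j" "j \<le> t" "b = t * l'" by auto
      then show "a < b" using top lower[of t] by linarith
    qed simp
    moreover have "length (xlist m) = k" using ji by (simp add: xl)
    moreover have "set (xlist m) \<subseteq> {..<n}"
    proof
      fix a assume "a \<in> set (xlist m)"
      then consider "a < m - 1 + j" | t where "t < k" "a = t * l'" unfolding xl by auto
      then show "a \<in> {..<n}"
      proof cases
        case 1
        then show ?thesis using top upper[OF ji(2)] by simp
      next
        case 2
        then show ?thesis using upper by simp
      qed
    qed
    moreover have "Suc ` set (xlist m) = initial_index k l' m"
    proof -
      have "Suc ` {m - 1..<m - 1 + j} = {m..m + j - 1}"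
        using assms ji by (simp add: image_Suc_atLeastLessThan atLeastLessThanSuc_atLeastAtMost[symmetric])
      moreover have "Suc ` (\<lambda>t. t * l') ` {j..<k} = {1 + t * l' | t. j \<le> t \<and> t \<le> k - 1}"
      proof -
        have "{1 + t * l' | t. j \<le> t \<and> t \<le> k - 1} = (\<lambda>t. 1 + t * l') ` {t. j \<le> t \<and> t \<le> k - 1}" by blast
        moreover have "{t. j \<le> t \<and> t \<le> k - 1} = {j..<k}" using k2 by auto
        ultimately show ?thesis by (simp only: image_image plus_1_eq_Suc)
      qed
      ultimately show ?thesis unfolding xl ii set_append set_map set_upt image_Un by (simp only:)
    qed
    ultimately show ?thesis by blast
  qed
  then have xs: "sorted_wrt (<) (xlist m)" "length (xlist m) = k" "set (xlist m) \<subseteq> {..<n}"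
    and I: "Suc ` set (xlist m) = initial_index k l' m" by auto
  have set_eq: "(!) (xlist m) ` {..<k} = set (xlist m)" using xs(2) by (auto simp: set_conv_nth)
  show "initial_index k l' m \<subseteq> {1..n}" unfolding I[symmetric] using xs(3) by auto
  have "distinct (xlist m)" using xs(1) strict_sorted_iff by blast
  then show "card (initial_index k l' m) = k"
    unfolding I[symmetric] by (simp add: card_image distinct_card xs(2))
  have mono: "strict_mono_on {..<k} ((!) (xlist m))"
    using xs(1,2) by (auto simp: strict_mono_on_def sorted_wrt_iff_nth_less)
  have lt: "xlist m ! i < n" if "i < k" for i using that xs(2,3) by (metis lessThan_iff nth_mem subsetD)
  have "plucker (B u) (initial_index k l' m) = Determinant.det (mat k k (\<lambda>(r, i). B u $$ (r, xlist m ! i)))"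
    using plucker_strict_mono[OF B_carrier mono lt] unfolding set_eq I .
  also have "\<dots> = x m u" unfolding x_def minor_def bracket_def using xs(2) lt
    by (intro arg_cong[of _ _ Determinant.det] eq_matI) (auto simp: B_def)
  finally show "x m u = plucker (B u) (initial_index k l' m)" ..
qed

lemma reg_x: "m \<in> {1..num_vars} \<Longrightarrow> x m \<in> reg"
proof -
  assume m: "m \<in> {1..num_vars}"
  obtain cs where "length cs = k" "\<And>u. plucker (B u) (initial_index k l' m) = minor u cs"
    by (rule plucker_eq_minor[OF x_eq_plucker(1,2)[OF m]]) (rule that; simp)
  then have "x m = (\<lambda>u. minor u cs)" using x_eq_plucker(3)[OF m] by auto
  then show ?thesis using reg_minor \<open>length cs = k\<close> by simp
qed

lemma cluster_var_eq: "m \<in> {1..num_vars} \<Longrightarrow> cluster_var k l n m = E (x m)"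
proof -
  assume m: "m \<in> {1..num_vars}"
  have "lift (x m) = (\<lambda>P\<in>range Phi. P (initial_index k l' m))"
    by (rule lift_eqI) (use x_eq_plucker[OF m] in \<open>auto simp: Phi_def D_ring_carrier intro!: generate_ring.incl\<close>)
  then show ?thesis
    by (simp add: cluster_var_def D_plucker_def E_def coordinate_def affine_cone_eq l'_def[symmetric])
qed

lemma cluster_var_nonzero:
  assumes m: "m \<in> {1..num_vars}"
  shows "E (x m) \<noteq> \<zero>\<^bsub>K\<^esub>"
  by (rule E_nonzero[OF reg_x[OF m], of u0])
    (simp add: x_eq_plucker(3)[OF m] plucker_u0_nonzero[OF x_eq_plucker(1,2)[OF m]])

lemma count_quiver:
  assumes "a \<le> num_mutable k l' \<or> b \<le> num_mutable k l'"
  shows "count (quiver k l') (a, b) = (\<Sum>i\<in>{1..num_mutable k l'}.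
    of_bool (a = i + 1 \<and> b = i) + of_bool (a = i \<and> b = i + l') + of_bool (a = i + l' \<and> b = i + 1))"
proof -
  have c: "count {#(i + 1, i), (i, i + l'), (i + l', i + 1)#} (a, b)
      = of_bool (a = i + 1 \<and> b = i) + of_bool (a = i \<and> b = i + l') + of_bool (a = i + l' \<and> b = i + 1)" for i
    by auto
  show ?thesis
    unfolding quiver_def count_filter_mset count_sum c case_prod_conv using assms by (simp only: if_True)
qed

lemma sum_of_bool_eq:
  assumes "\<And>i. i \<in> A \<Longrightarrow> P i \<longleftrightarrow> i = c \<and> Q" "finite A"
  shows "(\<Sum>i\<in>A. of_bool (P i)) = (of_bool (c \<in> A \<and> Q) :: nat)"
proof -
  have "(\<Sum>i\<in>A. of_bool (P i)) = (\<Sum>i\<in>A. if i = c then of_bool Q else (0::nat))"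
    using assms(1) by (intro sum.cong) auto
  then show ?thesis using assms(2) by simp
qed

text \<open>The three terms come from the triangles numbered \<open>i\<close>, \<open>i - l'\<close>
  and \<open>i - 1\<close>, one arrow each; the second of these triangles exists only for
  \<open>l' < i\<close>.\<close>

lemma count_quiver_in:
  assumes "2 \<le> i" "i \<le> num_mutable k l'"
  shows "count (quiver k l') (m, i) = of_bool (m = i + 1) + of_bool (l' < i \<and> m = i - l') + of_bool (m = i + l' - 1)"
proof -
  let ?A = "{1..num_mutable k l'}"
  have 1: "(\<Sum>j\<in>?A. of_bool (m = j + 1 \<and> i = j)) = (of_bool (m = i + 1) :: nat)"
    by (subst sum_of_bool_eq[where c = "i" and Q = "m = i + 1"]) (use assms in auto)
  have 2: "(\<Sum>j\<in>?A. of_bool (m = j \<and> i = j + l')) = (of_bool (l' < i \<and> m = i - l') :: nat)"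
    by (subst sum_of_bool_eq[where c = "i - l'" and Q = "l' < i \<and> m = i - l'"]) (use assms in auto)
  have 3: "(\<Sum>j\<in>?A. of_bool (m = j + l' \<and> i = j + 1)) = (of_bool (m = i + l' - 1) :: nat)"
    by (subst sum_of_bool_eq[where c = "i - 1" and Q = "m = i + l' - 1"]) (use assms in auto)
  show ?thesis using count_quiver[of m i] assms(2) unfolding sum.distrib 1 2 3 by blast
qed

lemma count_quiver_out:
  assumes "2 \<le> i" "i \<le> num_mutable k l'"
  shows "count (quiver k l') (i, m) = of_bool (m = i - 1) + of_bool (m = i + l') + of_bool (l' < i \<and> m = i - l' + 1)"
proof -
  let ?A = "{1..num_mutable k l'}"
  have 1: "(\<Sum>j\<in>?A. of_bool (i = j + 1 \<and> m = j)) = (of_bool (m = i - 1) :: nat)"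
    by (subst sum_of_bool_eq[where c = "i - 1" and Q = "m = i - 1"]) (use assms in auto)
  have 2: "(\<Sum>j\<in>?A. of_bool (i = j \<and> m = j + l')) = (of_bool (m = i + l') :: nat)"
    by (subst sum_of_bool_eq[where c = "i" and Q = "m = i + l'"]) (use assms in auto)
  have 3: "(\<Sum>j\<in>?A. of_bool (i = j + l' \<and> m = j + 1)) = (of_bool (l' < i \<and> m = i - l' + 1) :: nat)"
    by (subst sum_of_bool_eq[where c = "i - l'" and Q = "l' < i \<and> m = i - l' + 1"]) (use assms in auto)
  show ?thesis using count_quiver[of i m] assms(2) unfolding sum.distrib 1 2 3 by blast
qed

lemma prod_power_of_bool:
  fixes y :: "nat \<Rightarrow> complex"
  assumes "finite V" "c \<in> V"
  shows "(\<Prod>m\<in>V. y m ^ of_bool (m = c)) = y c"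
proof -
  have "(\<Prod>m\<in>V. y m ^ of_bool (m = c)) = (\<Prod>m\<in>V. if m = c then y m else 1)"
    by (intro prod.cong) auto
  then show ?thesis using assms by simp
qed

lemma prod_power_of_bool_if:
  fixes y :: "nat \<Rightarrow> complex"
  assumes "finite V" "P \<Longrightarrow> c \<in> V"
  shows "(\<Prod>m\<in>V. y m ^ of_bool (P \<and> m = c)) = (if P then y c else 1)"
  using assms prod_power_of_bool[of V c y] by (cases P) simp_all

lemma exchange_in:
  assumes "2 \<le> i" "i \<le> num_mutable k l'"
  shows "(\<Prod>m\<in>{1..num_vars}. y m ^ count (quiver k l') (m, i))
    = y (i + 1) * y (i + l' - 1) * (if l' < i then y (i - l') else 1 :: complex)"
proof -
  have 1: "(\<Prod>m\<in>{1..num_vars}. y m ^ of_bool (m = i + 1)) = y (i + 1)"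
    by (rule prod_power_of_bool) (use assms l'2 in \<open>auto simp: num_vars_def\<close>)
  have 2: "(\<Prod>m\<in>{1..num_vars}. y m ^ of_bool (m = i + l' - 1)) = y (i + l' - 1)"
    by (rule prod_power_of_bool) (use assms l'2 in \<open>auto simp: num_vars_def\<close>)
  have 3: "(\<Prod>m\<in>{1..num_vars}. y m ^ of_bool (l' < i \<and> m = i - l')) = (if l' < i then y (i - l') else 1)"
    by (rule prod_power_of_bool_if) (use assms l'2 in \<open>auto simp: num_vars_def\<close>)
  show ?thesis unfolding count_quiver_in[OF assms] power_add prod.distrib 1 2 3 by (simp only: mult_ac)
qed

lemma exchange_out:
  assumes "2 \<le> i" "i \<le> num_mutable k l'"
  shows "(\<Prod>m\<in>{1..num_vars}. y m ^ count (quiver k l') (i, m))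
    = y (i + l') * y (i - 1) * (if l' < i then y (i - l' + 1) else 1 :: complex)"
proof -
  have 1: "(\<Prod>m\<in>{1..num_vars}. y m ^ of_bool (m = i - 1)) = y (i - 1)"
    by (rule prod_power_of_bool) (use assms l'2 in \<open>auto simp: num_vars_def\<close>)
  have 2: "(\<Prod>m\<in>{1..num_vars}. y m ^ of_bool (m = i + l')) = y (i + l')"
    by (rule prod_power_of_bool) (use assms l'2 in \<open>auto simp: num_vars_def\<close>)
  have 3: "(\<Prod>m\<in>{1..num_vars}. y m ^ of_bool (l' < i \<and> m = i - l' + 1)) = (if l' < i then y (i - l' + 1) else 1)"
    by (rule prod_power_of_bool_if) (use assms l'2 in \<open>auto simp: num_vars_def\<close>)
  show ?thesis unfolding count_quiver_out[OF assms] power_add prod.distrib 1 2 3 by (simp only: mult_ac)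
qed

lemma exchange_poly_initial:
  "exchange_poly k l n 1 = E (\<lambda>u. \<Sum>s\<le>k. eta k p s * x 2 u ^ s * x (l' + 1) u ^ (k - s))"
proof -
  interpret K: field K by (rule field_K)
  have "1 \<le> (k - 1) * (l' - 1)" using k2 l'2 mult_le_mono[of 1 "k - 1" 1 "l' - 1"] by linarith
  then have V: "2 \<in> {1..num_vars}" "l' + 1 \<in> {1..num_vars}"
    using l'2 by (simp_all add: num_vars_def num_mutable_def)
  note r = reg_x[OF V(1)] reg_x[OF V(2)]
  have t: "E (\<lambda>u. eta k p s * x 2 u ^ s * x (l' + 1) u ^ (k - s))
      = D_const k l n (eta k p s) \<otimes>\<^bsub>K\<^esub> E (x 2) [^]\<^bsub>K\<^esub> s \<otimes>\<^bsub>K\<^esub> E (x (l' + 1)) [^]\<^bsub>K\<^esub> (k - s)" for s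
    using E_mult[OF reg_mult[OF reg_const[of "eta k p s"] reg_power[OF r(1), of s]] reg_power[OF r(2), of "k - s"]]
      E_mult[OF reg_const[of "eta k p s"] reg_power[OF r(1), of s]]
    by (simp only: E_const E_power[OF r(1)] E_power[OF r(2)])
  have "E (\<lambda>u. \<Sum>s\<le>k. eta k p s * x 2 u ^ s * x (l' + 1) u ^ (k - s))
      = (\<Oplus>\<^bsub>K\<^esub>s\<in>{..k}. E (\<lambda>u. eta k p s * x 2 u ^ s * x (l' + 1) u ^ (k - s)))"
    by (intro E_sum reg_mult reg_const reg_power r) simp
  then show ?thesis
    unfolding t by (simp add: exchange_poly_def Let_def l'_def[symmetric] p_def[symmetric] cluster_var_eq[OF V(1)] cluster_var_eq[OF V(2)] atLeast0AtMost del: One_nat_def)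
qed

lemma exchange_poly_quiver:
  assumes "2 \<le> i"
  shows "exchange_poly k l n i = E (\<lambda>u. (\<Prod>m\<in>{1..num_vars}. x m u ^ count (quiver k l') (m, i))
     + (\<Prod>m\<in>{1..num_vars}. x m u ^ count (quiver k l') (i, m)))"
proof -
  interpret K: field K by (rule field_K)
  have E: "E (\<lambda>u. \<Prod>m\<in>{1..num_vars}. x m u ^ c m) = (\<Otimes>\<^bsub>K\<^esub>m\<in>{1..num_vars}. cluster_var k l n m [^]\<^bsub>K\<^esub> c m)"
    for c :: "nat \<Rightarrow> nat"
  proof -
    have "E (\<lambda>u. \<Prod>m\<in>{1..num_vars}. x m u ^ c m) = (\<Otimes>\<^bsub>K\<^esub>m\<in>{1..num_vars}. E (\<lambda>u. x m u ^ c m))"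
      by (rule E_prod, simp) (rule reg_power, rule reg_x)
    also have "\<dots> = (\<Otimes>\<^bsub>K\<^esub>m\<in>{1..num_vars}. cluster_var k l n m [^]\<^bsub>K\<^esub> c m)"
      by (rule K.finprod_cong') (auto simp: E_power reg_x cluster_var_eq E_carrier)
    finally show ?thesis .
  qed
  have reg: "(\<lambda>u. \<Prod>m\<in>{1..num_vars}. x m u ^ c m) \<in> reg" for c :: "nat \<Rightarrow> nat"
    by (rule reg_prod, rule reg_power, rule reg_x)
  show ?thesis
    unfolding E_add[OF reg reg] E using assms
    by (simp add: exchange_poly_def Let_def l'_def[symmetric] num_vars_def)
qed

text \<open>The cluster variable is nonzero in the field, so the defining equation has at most one
  solution, and the exchange relation provides a regular one.\<close>

lemma neighbour_in_reg:
  assumes "1 \<le> i" "i \<le> num_mutable k l'"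
  shows "neighbour_var k l n i \<in> E ` reg"
proof -
  interpret K: field K by (rule field_K)
  have i: "i \<in> {1..num_vars}" using assms by (simp add: num_vars_def)
  obtain y where y: "y \<in> reg" "exchange_poly k l n i = E (\<lambda>u. x i u * y u)"
  proof (cases "i = 1")
    case True
    obtain y where y: "y \<in> reg" "\<forall>u. x 1 u * y u = (\<Sum>s\<le>k. eta k p s * x 2 u ^ s * x (l' + 1) u ^ (k - s))"
      using exchange_initial by (rule bexE)
    show ?thesis by (rule that[OF y(1)]) (simp only: True y(2)[rule_format] exchange_poly_initial)
  next
    case False
    then have i2: "2 \<le> i" using assms by simp
    obtain y where y: "y \<in> reg" "\<forall>u. x i u * y u = x (i + 1) u * x (i + l' - 1) u * (if l' < i then x (i - l') u else 1)
       + x (i + l') u * x (i - 1) u * (if l' < i then x (i - l' + 1) u else 1)"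
      using exchange[OF i2 assms(2)] by (rule bexE)
    show ?thesis
      by (rule that[OF y(1)])
        (simp only: y(2)[rule_format] exchange_poly_quiver[OF i2] exchange_in[OF i2 assms(2)] exchange_out[OF i2 assms(2)])
  qed
  have eq: "E (x i) \<otimes>\<^bsub>K\<^esub> E y = exchange_poly k l n i" unfolding y(2) by (rule E_mult[symmetric, OF reg_x[OF i] y(1)])
  have "neighbour_var k l n i = E y"
    unfolding neighbour_var_def cluster_var_eq[OF i]
  proof (rule the_equality)
    show "E y \<in> carrier K \<and> E (x i) \<otimes>\<^bsub>K\<^esub> E y = exchange_poly k l n i" using eq E_carrier[OF y(1)] by simp
    fix z assume "z \<in> carrier K \<and> E (x i) \<otimes>\<^bsub>K\<^esub> z = exchange_poly k l n i"
    then show "z = E y"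
      unfolding eq[symmetric] using K.m_lcancel[OF cluster_var_nonzero[OF i] E_carrier[OF reg_x[OF i]]] E_carrier[OF y(1)]
      by blast
  qed
  then show ?thesis using y(1) by blast
qed

section \<open>The two inclusions\<close>

lemma generated_subset_image:
  assumes "S \<subseteq> E ` reg"
  shows "D_subalgebra k l n S \<subseteq> E ` reg"
proof
  interpret K: field K by (rule field_K)
  fix f assume "f \<in> D_subalgebra k l n S"
  then show "f \<in> E ` reg"
    unfolding D_subalgebra_def
  proof (induction rule: generate_ring.induct)
    case one
    show ?case unfolding E_one[symmetric] by (intro imageI reg_const)
  next
    case (incl h)
    then show ?case using assms by (auto simp: E_const[symmetric] intro: reg_const)
  next
    case (a_inv h)
    then obtain g where g: "g \<in> reg" "h = E g" by blast
    have m: "(\<lambda>u. - g u) \<in> reg" using reg_diff[OF reg_const[of 0] g(1)] by simp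
    have "E (\<lambda>u. - g u) \<oplus>\<^bsub>K\<^esub> E g = \<zero>\<^bsub>K\<^esub>"
      unfolding E_add[OF m g(1), symmetric] by (simp add: E_zero)
    then have "\<ominus>\<^bsub>K\<^esub> h = E (\<lambda>u. - g u)"
      unfolding g(2) by (rule K.minus_equality) (simp_all add: E_carrier g(1) m)
    then show ?case using m by blast
  next
    case (eng_add h1 h2)
    then obtain f g where fg: "f \<in> reg" "h1 = E f" "g \<in> reg" "h2 = E g" by (auto elim!: imageE)
    then show ?case using imageI[OF reg_add[OF fg(1,3)], of E] by (simp add: E_add)
  next
    case (eng_mult h1 h2)
    then obtain f g where fg: "f \<in> reg" "h1 = E f" "g \<in> reg" "h2 = E g" by (auto elim!: imageE)
    then show ?case using imageI[OF reg_mult[OF fg(1,3)], of E] by (simp add: E_mult)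
  qed
qed

lemma lower_bound_subset: "lower_bound k l n \<subseteq> D_ring_image k l n"
  unfolding lower_bound_def D_ring_image_eq l'_def[symmetric] num_vars_def[symmetric]
proof (intro generated_subset_image Un_least image_subsetI)
  show "cluster_var k l n m \<in> E ` reg" if "m \<in> {1..num_vars}" for m
    using that by (simp add: cluster_var_eq reg_x)
  show "neighbour_var k l n i \<in> E ` reg" if "i \<in> {1..num_mutable k l'}" for i
    using that neighbour_in_reg by simp
qed

lemma cluster_poly_reg: "f \<in> cluster_poly \<Longrightarrow> f \<in> reg"
  by (induction rule: cluster_poly.induct) (simp_all add: reg_const reg_x reg_add reg_mult)

lemma laurent_ring_eq: "laurent_ring k l n = D_subalgebra k l n
     (\<Union>m\<in>{1..num_vars}. {E (x m), inv\<^bsub>K\<^esub> E (x m)})"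
  unfolding laurent_ring_def l'_def[symmetric] num_vars_def[symmetric]
  by (intro arg_cong[of _ _ "D_subalgebra k l n"] SUP_cong) (simp_all add: cluster_var_eq)

lemma cluster_poly_laurent_ring: "f \<in> cluster_poly \<Longrightarrow> E f \<in> laurent_ring k l n"
proof (induction rule: cluster_poly.induct)
  case (cluster_poly_const c)
  show ?case unfolding laurent_ring_eq D_subalgebra_def E_const by (rule generate_ring.incl) simp
next
  case (cluster_poly_x m)
  then show ?case unfolding laurent_ring_eq D_subalgebra_def by (intro generate_ring.incl) blast
next
  case (cluster_poly_add f g)
  then show ?case unfolding E_add[OF cluster_poly_reg cluster_poly_reg, OF cluster_poly_add.hyps]
      laurent_ring_def D_subalgebra_def by (intro generate_ring.eng_add)
next
  case (cluster_poly_mult f g)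
  then show ?case unfolding E_mult[OF cluster_poly_reg cluster_poly_reg, OF cluster_poly_mult.hyps]
      laurent_ring_def D_subalgebra_def by (intro generate_ring.eng_mult)
qed

lemma cluster_monomial_inverse:
  "a \<in> cluster_monomial \<Longrightarrow> \<exists>b\<in>laurent_ring k l n. b \<in> carrier K \<and> b \<otimes>\<^bsub>K\<^esub> E a = \<one>\<^bsub>K\<^esub>"
proof (induction rule: cluster_monomial.induct)
  case cluster_monomial_one
  interpret K: field K by (rule field_K)
  show ?case
    unfolding laurent_ring_def D_subalgebra_def E_one
    by (intro bexI[of _ "\<one>\<^bsub>K\<^esub>"] generate_ring.one) simp
next
  case (cluster_monomial_mult m a)
  interpret K: field K by (rule field_K)
  obtain b where b: "b \<in> laurent_ring k l n" "b \<in> carrier K" "b \<otimes>\<^bsub>K\<^esub> E a = \<one>\<^bsub>K\<^esub>"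
    using cluster_monomial_mult.IH by blast
  have a: "a \<in> reg" using cluster_monomial_poly[OF cluster_monomial_mult.hyps(2)] by (rule cluster_poly_reg)
  note xm = reg_x[OF cluster_monomial_mult.hyps(1)]
  let ?c = "inv\<^bsub>K\<^esub> E (x m)"
  have "E (x m) \<in> Units K"
    using cluster_var_nonzero[OF cluster_monomial_mult.hyps(1)] E_carrier[OF xm] by (simp add: K.field_Units)
  then have c: "?c \<in> carrier K" "?c \<otimes>\<^bsub>K\<^esub> E (x m) = \<one>\<^bsub>K\<^esub>" by (simp_all add: K.Units_inv_closed K.Units_l_inv)
  have "?c \<in> laurent_ring k l n"
    unfolding laurent_ring_eq D_subalgebra_def using cluster_monomial_mult.hyps(1) by (intro generate_ring.incl) blast
  then have "b \<otimes>\<^bsub>K\<^esub> ?c \<in> laurent_ring k l n"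
    using b(1) unfolding laurent_ring_def D_subalgebra_def by (intro generate_ring.eng_mult)
  moreover have "(b \<otimes>\<^bsub>K\<^esub> ?c) \<otimes>\<^bsub>K\<^esub> E (\<lambda>u. x m u * a u) = \<one>\<^bsub>K\<^esub>"
  proof -
    have "(b \<otimes>\<^bsub>K\<^esub> ?c) \<otimes>\<^bsub>K\<^esub> (E (x m) \<otimes>\<^bsub>K\<^esub> E a) = (?c \<otimes>\<^bsub>K\<^esub> E (x m)) \<otimes>\<^bsub>K\<^esub> (b \<otimes>\<^bsub>K\<^esub> E a)"
      using b(2) c(1) E_carrier[OF xm] E_carrier[OF a] by (simp add: K.m_ac)
    then show ?thesis unfolding E_mult[OF xm a] c(2) b(3) by simp
  qed
  ultimately show ?case using b(2) c(1) by (intro bexI[of _ "b \<otimes>\<^bsub>K\<^esub> ?c"]) simp_all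
qed

text \<open>From \<open>a u * f u = h u\<close> with a monomial \<open>a\<close> and a polynomial
  \<open>h\<close> in the initial variables, the element of \<open>f\<close> is that of
  \<open>h\<close> times the inverse of that of \<open>a\<close>.\<close>

lemma D_ring_image_subset: "D_ring_image k l n \<subseteq> laurent_ring k l n"
  unfolding D_ring_image_eq
proof (rule image_subsetI)
  interpret K: field K by (rule field_K)
  fix f assume f: "f \<in> reg"
  obtain a where ah: "a \<in> cluster_monomial" "\<exists>h\<in>cluster_poly. \<forall>u. a u * f u = h u"
    using reg_clear_denominator[OF f] by (rule bexE)
  from ah(2) obtain h where h: "h \<in> cluster_poly" "\<forall>u. a u * f u = h u" by (rule bexE)
  obtain b where b: "b \<in> laurent_ring k l n" "b \<in> carrier K" "b \<otimes>\<^bsub>K\<^esub> E a = \<one>\<^bsub>K\<^esub>"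
    using cluster_monomial_inverse[OF ah(1)] by blast
  have a: "a \<in> reg" using cluster_monomial_poly[OF ah(1)] by (rule cluster_poly_reg)
  have "E f = (b \<otimes>\<^bsub>K\<^esub> E a) \<otimes>\<^bsub>K\<^esub> E f" unfolding b(3) using E_carrier[OF f] by simp
  also have "\<dots> = b \<otimes>\<^bsub>K\<^esub> E (\<lambda>u. a u * f u)"
    unfolding E_mult[OF a f] using b(2) E_carrier[OF a] E_carrier[OF f] by (simp add: K.m_assoc)
  also have "\<dots> = b \<otimes>\<^bsub>K\<^esub> E h" by (simp only: h(2)[rule_format])
  finally show "E f \<in> laurent_ring k l n"
    using b(1) cluster_poly_laurent_ring[OF h(1)]
    unfolding laurent_ring_def D_subalgebra_def by (simp add: generate_ring.eng_mult)
qed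

end

theorem theorem7p5:
  fixes k l n l' p :: nat
  assumes "k \<ge> 2" and "l \<ge> 2" and "n \<ge> 2"
    and "l' = gcd l n" and "l' \<ge> 2"
    and "p = n div l'" and "p \<ge> k"
  shows "lower_bound k l n \<subseteq> D_ring_image k l n \<and> D_ring_image k l n \<subseteq> laurent_ring k l n"
proof -
  interpret cyclic_setup k l n l' p
    by (unfold_locales) (fact assms)+
  show ?thesis using lower_bound_subset D_ring_image_subset by blast
qed

end
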